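(* Let $T>0$ and let $\sigma:[0,T]\to\mathbb{M}^d$ be a bounded measurable function. Suppose that $X$ solves $$dX=\sigma\,dW,$$ where $W$ is a $d$-dimensional Brownian motion, and write $\Sigma=\sigma\sigma^\top$. Suppose that $Q:[0,T]\to\mathbb{S}^d_+$ and $z:[0,T]\to\mathbb{R}^d$ are bounded measurable functions such that $Q^{-1}$ is also bounded. Define $$\ell(s)=\tfrac12\,X(s)\cdot Q(s)X(s)+z(s)\cdot X(s),$$ $$F(t,x)=E\left[\exp\left\{-\int_t^T\ell(s)\,ds-\ell(T)\right\}\,\Big|\,X(t)=x\right].$$ Then, for $t \in [0,T]$ and $x \in \mathbb{R}^d$, $F(t,x)$ is given explicitly as $$F(t,x)=\exp\left(-\tfrac12\,x\cdot V(t)x-b(t)\cdot x-\gamma(t)\right),$$ where $V,b,\gamma$ are obtained as the unique solutions on $[0,T]$ to the system of ordinary differential equations $$\dot V=V\Sigma V-Q,$$ $$\dot b=V\Sigma b-z,$$ $$2\dot\gamma=b^\top\Sigma b-\mathrm{tr}(V\Sigma),$$ subject to the boundary conditions $V(T)=Q(T)$, $b(T)=z(T)$, $\gamma(T)=0$.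
   Context: $\mathbb{M}^d$ is the space of $d\times d$ real matrices; $\mathbb{S}^d_+$ is the space of strictly positive-definite symmetric $d\times d$ real matrices. An overdot denotes the derivative with respect to $t$, and the time argument $t$ is often omitted. Here $V$ is $d\times d$ matrix-valued, $b$ is $\mathbb{R}^d$-valued and $\gamma$ is real-valued. Since the coefficients are only assumed bounded and measurable in time, the ODEs are understood in integrated form (absolutely continuous solutions, equations holding for almost every $t$). The conditional expectation given $X(t)=x$ is the expectation when the SDE is started from $x$ at time $t$. *)

theory Defs
  imports "HOL-Probability.Probability"
begin

definition pos_def_sym :: "real^'n^'n \<Rightarrow> bool" where
  "pos_def_sym A \<longleftrightarrow> transpose A = A \<and> (\<forall>x. x \<noteq> 0 \<longrightarrow> 0 < x \<bullet> (A *v x))"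

definition bounded_measurable_on :: "real set \<Rightarrow> (real \<Rightarrow> 'a::euclidean_space) \<Rightarrow> bool" where
  "bounded_measurable_on S f \<longleftrightarrow> f \<in> borel_measurable (lebesgue_on S) \<and> bounded (f ` S)"


text \<open>Standard \<open>d\<close>-dimensional Brownian motion with \<open>d = CARD('n)\<close>, indexed by time in \<open>[0, \<infinity>)\<close>
  (values at negative times are irrelevant).\<close>

locale brownian_motion = prob_space M
  for M :: "'w measure" and W :: "real \<Rightarrow> 'w \<Rightarrow> real^'n" +
  assumes BM_measurable: "0 \<le> t \<Longrightarrow> W t \<in> borel_measurable M"
    and BM_start: "AE \<omega> in M. W 0 \<omega> = 0"
    and BM_continuous: "AE \<omega> in M. continuous_on {0..} (\<lambda>t. W t \<omega>)"
    and BM_indep_increments: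
      "\<And>(\<tau> :: nat \<Rightarrow> real) n. 0 \<le> \<tau> 0 \<Longrightarrow> (\<forall>i<n. \<tau> i \<le> \<tau> (Suc i)) \<Longrightarrow>
         indep_vars (\<lambda>_. borel) (\<lambda>i \<omega>. W (\<tau> (Suc i)) \<omega> - W (\<tau> i) \<omega>) {..<n}"
    and BM_indep_components:
      "0 \<le> s \<Longrightarrow> s < t \<Longrightarrow>
         indep_vars (\<lambda>_. borel) (\<lambda>i \<omega>. (W t \<omega> - W s \<omega>) $ i) (UNIV :: 'n set)"
    and BM_normal_components:
      "0 \<le> s \<Longrightarrow> s < t \<Longrightarrow>
         distributed M lborel (\<lambda>\<omega>. (W t \<omega> - W s \<omega>) $ i) (normal_density 0 (sqrt (t - s)))"


text \<open>The stochastic integral of a deterministic matrix-valued integrand is, as usual, the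
  \<open>L\<^sup>2\<close>-limit of the elementary integrals of step functions that approximate the
  integrand in \<open>L\<^sup>2\<close>. By the Ito isometry the limit does not depend on the approximating
  sequence and is determined up to a null set; hence a relation, rather than a function.\<close>

definition is_partition :: "real \<Rightarrow> real \<Rightarrow> nat \<Rightarrow> (nat \<Rightarrow> real) \<Rightarrow> bool" where
  "is_partition s t n \<tau> \<longleftrightarrow> \<tau> 0 = s \<and> \<tau> n = t \<and> (\<forall>i<n. \<tau> i \<le> \<tau> (Suc i))"

definition step_function ::
    "nat \<Rightarrow> (nat \<Rightarrow> real) \<Rightarrow> (nat \<Rightarrow> 'a::real_vector) \<Rightarrow> real \<Rightarrow> 'a" where
  "step_function n \<tau> A r = (\<Sum>i<n. indicator {\<tau> i<..\<tau> (Suc i)} r *\<^sub>R A i)"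

definition elementary_integral ::
    "(real \<Rightarrow> 'w \<Rightarrow> real^'n) \<Rightarrow> nat \<Rightarrow> (nat \<Rightarrow> real) \<Rightarrow> (nat \<Rightarrow> real^'n^'n) \<Rightarrow> 'w \<Rightarrow> real^'n" where
  "elementary_integral W n \<tau> A \<omega> = (\<Sum>i<n. A i *v (W (\<tau> (Suc i)) \<omega> - W (\<tau> i) \<omega>))"

definition has_stochastic_integral ::
    "'w measure \<Rightarrow> (real \<Rightarrow> 'w \<Rightarrow> real^'n) \<Rightarrow> (real \<Rightarrow> real^'n^'n) \<Rightarrow> real \<Rightarrow> real
      \<Rightarrow> ('w \<Rightarrow> real^'n) \<Rightarrow> bool" where
  "has_stochastic_integral M W \<sigma> s t Y \<longleftrightarrow>
     Y \<in> borel_measurable M \<and>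
     (\<exists>N \<tau> A. (\<forall>k. is_partition s t (N k) (\<tau> k)) \<and>
        (\<lambda>k. \<integral>\<^sup>+ r\<in>{s..t}. ennreal ((norm (step_function (N k) (\<tau> k) (A k) r - \<sigma> r))\<^sup>2) \<partial>lebesgue)
          \<longlonglongrightarrow> 0 \<and>
        (\<lambda>k. \<integral>\<^sup>+ \<omega>. ennreal ((norm (elementary_integral W (N k) (\<tau> k) (A k) \<omega> - Y \<omega>))\<^sup>2) \<partial>M)
          \<longlonglongrightarrow> 0)"

text \<open>\<open>X\<close> is a continuous solution of \<open>dX = \<sigma> dW\<close> on \<open>[t, T]\<close> started from \<open>x\<close> at time \<open>t\<close>.\<close>

definition sde_solution ::
    "'w measure \<Rightarrow> (real \<Rightarrow> 'w \<Rightarrow> real^'n) \<Rightarrow> (real \<Rightarrow> real^'n^'n) \<Rightarrow> real \<Rightarrow> real \<Rightarrow> real^'n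
      \<Rightarrow> (real \<Rightarrow> 'w \<Rightarrow> real^'n) \<Rightarrow> bool" where
  "sde_solution M W \<sigma> T t x X \<longleftrightarrow>
     (\<forall>s\<in>{t..T}. X s \<in> borel_measurable M) \<and>
     (\<forall>\<omega>\<in>space M. continuous_on {t..T} (\<lambda>s. X s \<omega>)) \<and>
     (AE \<omega> in M. X t \<omega> = x) \<and>
     (\<forall>s\<in>{t..T}. has_stochastic_integral M W \<sigma> t s (\<lambda>\<omega>. X s \<omega> - X t \<omega>))"


definition quadratic_cost ::
    "(real \<Rightarrow> real^'n^'n) \<Rightarrow> (real \<Rightarrow> real^'n) \<Rightarrow> (real \<Rightarrow> 'w \<Rightarrow> real^'n) \<Rightarrow> real \<Rightarrow> 'w \<Rightarrow> real" where
  "quadratic_cost Q z X s \<omega> = 1/2 * (X s \<omega> \<bullet> (Q s *v X s \<omega>)) + z s \<bullet> X s \<omega>"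

text \<open>Here \<open>X t x\<close> is the process started from \<open>x\<close> at time \<open>t\<close>, so that the expectation below
  is the conditional expectation given \<open>X(t) = x\<close>.\<close>

definition exp_functional ::
    "'w measure \<Rightarrow> real \<Rightarrow> (real \<Rightarrow> real^'n^'n) \<Rightarrow> (real \<Rightarrow> real^'n)
      \<Rightarrow> (real \<Rightarrow> real^'n \<Rightarrow> real \<Rightarrow> 'w \<Rightarrow> real^'n) \<Rightarrow> real \<Rightarrow> real^'n \<Rightarrow> real" where
  "exp_functional M T Q z X t x =
     prob_space.expectation M (\<lambda>\<omega>.
       exp (- (LINT s:{t..T}|lebesgue. quadratic_cost Q z (X t x) s \<omega>)
            - quadratic_cost Q z (X t x) T \<omega>))"


text \<open>\<open>y\<close> is absolutely continuous on \<open>[0, T]\<close> with derivative \<open>f\<close> almost everywhere, and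
  \<open>y T = yT\<close>. Integrability has to be required because the Lebesgue integral of a
  non-integrable function is \<open>0\<close> by convention.\<close>

definition ac_terminal_solution ::
    "real \<Rightarrow> (real \<Rightarrow> 'a::euclidean_space) \<Rightarrow> (real \<Rightarrow> 'a) \<Rightarrow> 'a \<Rightarrow> bool" where
  "ac_terminal_solution T y f yT \<longleftrightarrow>
     set_integrable lebesgue {0..T} f \<and>
     (\<forall>t\<in>{0..T}. y t = yT - (LINT s:{t..T}|lebesgue. f s))"

definition riccati_system ::
    "real \<Rightarrow> (real \<Rightarrow> real^'n^'n) \<Rightarrow> (real \<Rightarrow> real^'n^'n) \<Rightarrow> (real \<Rightarrow> real^'n)
      \<Rightarrow> (real \<Rightarrow> real^'n^'n) \<Rightarrow> (real \<Rightarrow> real^'n) \<Rightarrow> (real \<Rightarrow> real) \<Rightarrow> bool" where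
  "riccati_system T \<Sigma> Q z V b \<gamma> \<longleftrightarrow>
     ac_terminal_solution T V (\<lambda>s. V s ** \<Sigma> s ** V s - Q s) (Q T) \<and>
     ac_terminal_solution T b (\<lambda>s. (V s ** \<Sigma> s) *v b s - z s) (z T) \<and>
     ac_terminal_solution T (\<lambda>s. 2 * \<gamma> s) (\<lambda>s. b s \<bullet> (\<Sigma> s *v b s) - trace (V s ** \<Sigma> s)) 0"

end

theory Submission
  imports Defs
begin

text \<open>
Write \<open>f t x = exp (- U t x)\<close> for the claimed formula, with
\<open>U t x = 1/2 * (x \<bullet> (V t *v x)) + b t \<bullet> x + \<gamma> t\<close> and gradient \<open>p = V t *v x + b t\<close>. Comparing
coefficients of powers of \<open>x\<close>, the Riccati system says precisely that
\<open>dU/dt = 1/2 * (p \<bullet> (\<Sigma> *v p) - trace (V ** \<Sigma>)) - \<ell> t x\<close> (lemma \<open>value_increment\<close>), which is the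
backward equation for \<open>f\<close>: the process \<open>exp (- \<integral>\<ell>) * f s (X s)\<close> is a martingale. Its value at \<open>t\<close> is
\<open>f t x\<close>, and its expectation at \<open>T\<close> is \<open>F t x\<close>, because \<open>U T = \<ell> T\<close>.

The system has a global solution because the Riccati equation is the quotient of a linear system
whose denominator stays invertible (\<open>riccati_matrix_solution_exists\<close>); this argument also shows that
\<open>V\<close> is symmetric and bounded below by a positive constant, so that \<open>f\<close> and its derivatives decay
faster than any polynomial. Uniqueness is Gronwall's inequality (\<open>riccati_system_unique\<close>). The
equations are understood in integrated form; since all derivatives are bounded, product and quotient
rules follow from quadratic estimates of increments (\<open>has_ac_derivative_from_quadratic_increments\<close>).

In place of stochastic calculus, an approximate martingale property on a grid of \<open>n\<close> cells is used.
The matrix \<open>\<sigma>\<close> is replaced by a bounded \<open>A k\<close> on cell \<open>k\<close>, so that the diffusion becomes a Markov chain with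
Gaussian steps \<open>A k *v (W s' - W s)\<close>. A Taylor expansion of third order, the moments of the steps and
the integrated Riccati system show that one step changes the expectation by at most
\<open>C * (h * sqrt h + h\<^sup>2 + \<integral>\<parallel>A k - \<sigma>\<parallel>)\<close>, with \<open>h\<close> the length of the cell and the integral taken
over it, uniformly in the position (\<open>one_step_error\<close>). By independence of increments these errors add
up along the grid (\<open>stage_value_error\<close>), and their sum is small if the grid is fine and the step
function is close to \<open>\<sigma>\<close> in \<open>L\<^sup>1\<close> (\<open>step_approximation_L1\<close>).

It remains to pass from the chain to \<open>X\<close>. The Ito isometry bounds their distance in mean square by
that of the step function to \<open>\<sigma>\<close> (\<open>stochastic_integral_elementary_approx\<close>). Positivity of \<open>Q\<close> with a
bounded inverse makes \<open>\<ell>\<close> bounded below; hence \<open>exp (- \<integral>\<ell>)\<close> is bounded and Lipschitz in the costs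
(\<open>grid_functional_approx\<close>), and Riemann sums along the continuous paths of \<open>X\<close> converge dominatedly
(\<open>expectation_eq_value\<close>).
\<close>

section \<open>Matrix norms\<close>

lemma norm_matrix_vector_mult_le:
  fixes A :: "real^'n^'m"
  shows "norm (A *v x) \<le> norm A * norm x"
proof -
  have row: "(A *v x) $ i = (A $ i) \<bullet> x" for i
    by (simp add: matrix_vector_mult_def inner_vec_def)
  have "norm (A *v x) \<le> L2_set (\<lambda>i. norm (A $ i) * norm x) UNIV"
    unfolding norm_vec_def[of "A *v x"]
    by (rule L2_set_mono) (auto simp: row Cauchy_Schwarz_ineq2)
  also have "\<dots> = norm A * norm x"
    unfolding norm_vec_def[of A] by (rule L2_set_left_distrib[symmetric]) simp
  finally show ?thesis .
qed

lemma inner_matrix_le: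
  fixes S :: "real^'n^'n"
  assumes "norm x \<le> p" "norm S \<le> k" "norm y \<le> q"
  shows "\<bar>x \<bullet> (S *v y)\<bar> \<le> p * (k * q)"
proof -
  have "\<bar>x \<bullet> (S *v y)\<bar> \<le> norm x * (norm S * norm y)"
    by (intro order_trans[OF Cauchy_Schwarz_ineq2] mult_left_mono norm_matrix_vector_mult_le norm_ge_zero)
  also have "\<dots> \<le> p * (k * q)"
    using assms order_trans[OF norm_ge_zero assms(1)] order_trans[OF norm_ge_zero assms(2)]
    by (intro mult_mono mult_nonneg_nonneg) auto
  finally show ?thesis .
qed

lemma norm_transpose [simp]:
  fixes A :: "real^'n^'m"
  shows "norm (transpose A) = norm A"
proof -
  have "(norm (transpose A))\<^sup>2 = (norm A)\<^sup>2"
    unfolding power2_norm_eq_inner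
    by (simp add: inner_vec_def transpose_def) (rule sum.swap)
  then show ?thesis by simp
qed

lemma norm_matrix_mult_le:
  fixes A :: "real^'n^'m" and B :: "real^'p^'n"
  shows "norm (A ** B) \<le> norm A * norm B"
proof -
  have row: "(A ** B) $ i = transpose B *v (A $ i)" for i
    by (simp add: matrix_matrix_mult_def matrix_vector_mult_def transpose_def vec_eq_iff mult.commute)
  have "norm (A ** B) \<le> L2_set (\<lambda>i. norm (A $ i) * norm B) UNIV"
    unfolding norm_vec_def[of "A ** B"]
  proof (rule L2_set_mono)
    show "norm ((A ** B) $ i) \<le> norm (A $ i) * norm B" for i
      using norm_matrix_vector_mult_le[of "transpose B" "A $ i"] unfolding row
      by (simp only: norm_transpose mult.commute)
  qed simp
  also have "\<dots> = norm A * norm B"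
    unfolding norm_vec_def[of A] by (rule L2_set_left_distrib[symmetric]) simp
  finally show ?thesis .
qed

lemma bounded_bilinear_matrix_mult:
  "bounded_bilinear ((**) :: real^'n^'m \<Rightarrow> real^'p^'n \<Rightarrow> real^'p^'m)"
proof
  show "\<exists>K. \<forall>(a :: real^'n^'m) (b :: real^'p^'n). norm (a ** b) \<le> norm a * norm b * K"
    using norm_matrix_mult_le by (metis mult.right_neutral)
qed (simp_all add: vec_eq_iff matrix_matrix_mult_def algebra_simps sum.distrib sum_distrib_left)

lemma bounded_bilinear_matrix_vector_mult:
  "bounded_bilinear ((*v) :: real^'n^'m \<Rightarrow> real^'n \<Rightarrow> real^'m)"
proof
  show "\<exists>K. \<forall>(a :: real^'n^'m) b. norm (a *v b) \<le> norm a * norm b * K"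
    using norm_matrix_vector_mult_le by (metis mult.right_neutral)
qed (simp_all add: vec_eq_iff matrix_vector_mult_def algebra_simps sum.distrib sum_distrib_left)

lemma bounded_linear_transpose: "bounded_linear (transpose :: real^'n^'m \<Rightarrow> real^'m^'n)"
proof
  show "\<exists>K. \<forall>x :: real^'n^'m. norm (transpose x) \<le> norm x * K"
    by (intro exI[of _ 1]) simp
qed (simp_all add: vec_eq_iff transpose_def)

lemma bounded_linear_trace: "bounded_linear (trace :: real^'n^'n \<Rightarrow> real)"
  unfolding linear_conv_bounded_linear[symmetric]
  by (rule linearI) (simp_all add: trace_def sum.distrib sum_distrib_left)

section \<open>Bounded measurable functions of time\<close>

lemma bounded_measurable_on_bound:
  assumes "bounded_measurable_on S f"
  obtains K where "0 < K" "\<And>s. s \<in> S \<Longrightarrow> norm (f s) \<le> K"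
  using assms unfolding bounded_measurable_on_def bounded_pos by auto

text \<open>The class of bounded measurable functions of time is closed under every operation that occurs in
the Riccati system, all of which are bilinear or linear. This replaces measurability and
integrability side conditions throughout, since on a compact interval every member of the class is
absolutely integrable.\<close>

lemma bounded_measurable_on_subset:
  assumes "bounded_measurable_on S f" "S' \<subseteq> S" "S \<in> sets lebesgue" "S' \<in> sets lebesgue"
  shows "bounded_measurable_on S' f"
  using assms unfolding bounded_measurable_on_def
  by (meson bounded_subset image_mono measurable_restrict_mono)

lemma bounded_measurable_on_cong:
  assumes "bounded_measurable_on S f" "\<And>s. s \<in> S \<Longrightarrow> f s = g s" 
  shows "bounded_measurable_on S g"
proof -
  have "g \<in> borel_measurable (lebesgue_on S) \<longleftrightarrow> f \<in> borel_measurable (lebesgue_on S)"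
    by (rule measurable_cong) (simp add: assms(2))
  moreover have "g ` S = f ` S" using assms(2) by auto
  ultimately show ?thesis using assms(1) unfolding bounded_measurable_on_def by simp
qed

lemma bounded_measurable_on_continuous:
  assumes "continuous_on {a..b::real} f"
  shows "bounded_measurable_on {a..b} f"
  unfolding bounded_measurable_on_def
  using assms compact_continuous_image[OF assms compact_Icc]
  by (auto intro: continuous_imp_measurable_on_sets_lebesgue compact_imp_bounded)

lemma bounded_measurable_on_const [simp]: "bounded_measurable_on S (\<lambda>_. c)"
  unfolding bounded_measurable_on_def by (auto intro: bounded_subset[of "{c}"])

lemma bounded_measurable_on_bilinear:
  assumes p: "bounded_bilinear p"
    and f: "bounded_measurable_on S f" and g: "bounded_measurable_on S g"
  shows "bounded_measurable_on S (\<lambda>s. p (f s) (g s))"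
proof -
  interpret p: bounded_bilinear p by (rule p)
  have "continuous_on UNIV (\<lambda>x. p (fst x) (snd x))"
    by (intro p.continuous_on continuous_intros)
  then have "(\<lambda>s. p (f s) (g s)) \<in> borel_measurable (lebesgue_on S)"
    using f g unfolding bounded_measurable_on_def
    by (intro borel_measurable_continuous_Pair[where H=p]) (simp_all add: case_prod_beta')
  moreover obtain a b where ab: "\<forall>x\<in>S. norm (f x) \<le> a" "\<forall>x\<in>S. norm (g x) \<le> b"
    using f g unfolding bounded_measurable_on_def bounded_iff by auto
  obtain K where K: "K \<ge> 0" "\<And>x y. norm (p x y) \<le> norm x * norm y * K"
    using p.nonneg_bounded by auto
  have "norm (p (f x) (g x)) \<le> a * b * K" if "x \<in> S" for x
    using K(2)[of "f x" "g x"] ab that K(1)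
    by (smt (verit) mult_mono mult_right_mono norm_ge_zero mult_nonneg_nonneg)
  ultimately show ?thesis
    unfolding bounded_measurable_on_def bounded_iff by blast
qed

lemma bounded_measurable_on_linear:
  assumes p: "bounded_linear p" and f: "bounded_measurable_on S f"
  shows "bounded_measurable_on S (\<lambda>s. p (f s))"
proof -
  have "continuous_on UNIV p"
    using p by (intro linear_continuous_on)
  then have "(\<lambda>s. p (f s)) \<in> borel_measurable (lebesgue_on S)"
    using f unfolding bounded_measurable_on_def
    by (intro borel_measurable_continuous_on[where f=p]) simp_all
  moreover have "bounded ((\<lambda>s. p (f s)) ` S)"
    using bounded_linear_image[OF _ p, of "f ` S"] f
    unfolding bounded_measurable_on_def image_image by simp
  ultimately show ?thesis unfolding bounded_measurable_on_def by simp
qed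

lemma bounded_measurable_on_add:
  assumes f: "bounded_measurable_on S f" and g: "bounded_measurable_on S g"
  shows "bounded_measurable_on S (\<lambda>s. f s + g s)"
  using assms unfolding bounded_measurable_on_def
  by (auto intro: bounded_plus_comp)

lemmas bounded_measurable_on_matrix_mult = bounded_measurable_on_bilinear[OF bounded_bilinear_matrix_mult]
lemmas bounded_measurable_on_matrix_vector_mult = bounded_measurable_on_bilinear[OF bounded_bilinear_matrix_vector_mult]
lemmas bounded_measurable_on_inner = bounded_measurable_on_bilinear[OF bounded_bilinear_inner]
lemmas bounded_measurable_on_transpose = bounded_measurable_on_linear[OF bounded_linear_transpose]
lemmas bounded_measurable_on_minus = bounded_measurable_on_linear[OF bounded_linear_minus[OF bounded_linear_ident]]

lemma bounded_measurable_on_diff: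
  assumes f: "bounded_measurable_on S f" and g: "bounded_measurable_on S g"
  shows "bounded_measurable_on S (\<lambda>s. f s - g s)"
  using bounded_measurable_on_add[OF f bounded_measurable_on_minus[OF g]] by simp

lemma bounded_measurable_on_norm:
  assumes f: "bounded_measurable_on S f"
  shows "bounded_measurable_on S (\<lambda>s. norm (f s))"
  using assms unfolding bounded_measurable_on_def by (auto simp: bounded_iff)

text \<open>The bridge between the Lebesgue integrals of the problem and the Henstock--Kurzweil integral, whose
calculus on subintervals is used from here on.\<close>

lemma bounded_measurable_on_imp_absolutely_integrable:
  assumes f: "bounded_measurable_on {a..b::real} f"
    and cd: "{c..d} \<subseteq> {a..b}"
  shows "f absolutely_integrable_on {c..d}"
proof -
  have f': "bounded_measurable_on {c..d} f"
    using bounded_measurable_on_subset[OF f cd] by simp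
  then obtain B where B: "\<forall>x\<in>{c..d}. norm (f x) \<le> B"
    unfolding bounded_measurable_on_def bounded_iff by auto
  show ?thesis
    using f' B unfolding bounded_measurable_on_def
    by (intro measurable_bounded_by_integrable_imp_absolutely_integrable[where g="\<lambda>_. B"]) auto
qed

lemma bounded_measurable_on_imp_integrable:
  assumes f: "bounded_measurable_on {a..b::real} f" "{c..d} \<subseteq> {a..b}"
  shows "f integrable_on {c..d}"
  using bounded_measurable_on_imp_absolutely_integrable[OF f] set_lebesgue_integral_eq_integral(1) by blast

lemma bounded_measurable_on_integral_norm_le:
  assumes f: "bounded_measurable_on {a..b::real} f" "{c..d} \<subseteq> {a..b}"
    and B: "\<And>s. s \<in> {c..d} \<Longrightarrow> norm (f s) \<le> B" and "c \<le> d"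
  shows "norm (integral {c..d} f) \<le> B * (d - c)"
proof -
  have "norm (integral {c..d} f) \<le> integral {c..d} (\<lambda>_. B)"
    by (rule integral_norm_bound_integral) (use bounded_measurable_on_imp_integrable[OF f] B in auto)
  then show ?thesis using \<open>c \<le> d\<close> by (simp add: mult.commute)
qed

lemma integral_norm_nonneg: "0 \<le> integral S (\<lambda>r. norm (f r))"
  using integral_nonneg[of "\<lambda>r. norm (f r)" S] not_integrable_integral[of "\<lambda>r. norm (f r)" S]
  by (cases "(\<lambda>r. norm (f r)) integrable_on S") auto

section \<open>Lipschitz functions and their derivatives\<close>

text \<open>Solutions of the system are not merely absolutely continuous: their derivatives are bounded, so that
they are Lipschitz. Lipschitz functions admit a product rule and a rule for inverses without any
differentiation theorem for the Lebesgue integral.\<close>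

definition has_ac_derivative :: "real \<Rightarrow> (real \<Rightarrow> 'a::euclidean_space) \<Rightarrow> (real \<Rightarrow> 'a) \<Rightarrow> bool" where
  "has_ac_derivative T y f \<longleftrightarrow> bounded_measurable_on {0..T} f \<and>
     (\<forall>r s. 0 \<le> r \<and> r \<le> s \<and> s \<le> T \<longrightarrow> y s - y r = integral {r..s} f)"

lemma has_ac_derivative_lipschitz:
  assumes "has_ac_derivative T y f"
  obtains L where "L \<ge> 0" "\<And>r s. r \<in> {0..T} \<Longrightarrow> s \<in> {0..T} \<Longrightarrow> norm (y s - y r) \<le> L * \<bar>s - r\<bar>"
proof -
  have bm: "bounded_measurable_on {0..T} f"
    using assms unfolding has_ac_derivative_def by blast
  then obtain L where L: "L > 0" "\<forall>x\<in>{0..T}. norm (f x) \<le> L"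
    unfolding bounded_measurable_on_def bounded_pos by auto
  have *: "norm (y s - y r) \<le> L * (s - r)" if "0 \<le> r" "r \<le> s" "s \<le> T" for r s
  proof -
    have "y s - y r = integral {r..s} f"
      using assms that unfolding has_ac_derivative_def by auto
    then show ?thesis
      using bounded_measurable_on_integral_norm_le[OF bm, of r s L] L(2) that by auto
  qed
  show thesis
  proof
    show "L \<ge> 0" using L by simp
    fix r s assume "r \<in> {0..T}" "s \<in> {0..T}"
    then show "norm (y s - y r) \<le> L * \<bar>s - r\<bar>"
      using *[of r s] *[of s r] by (cases "r \<le> s") (auto simp: norm_minus_commute)
  qed
qed

lemma has_ac_derivative_continuous:
  assumes "has_ac_derivative T y f"
  shows "continuous_on {0..T} y"
proof -
  obtain L where L: "L \<ge> 0" "\<And>r s. r \<in> {0..T} \<Longrightarrow> s \<in> {0..T} \<Longrightarrow> norm (y s - y r) \<le> L * \<bar>s - r\<bar>"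
    using has_ac_derivative_lipschitz[OF assms] by blast
  have "L-lipschitz_on {0..T} y"
    using L by (intro lipschitz_onI) (auto simp: dist_norm)
  then show ?thesis by (rule lipschitz_on_continuous_on)
qed

lemma has_ac_derivative_bounded_measurable:
  assumes "has_ac_derivative T y f"
  shows "bounded_measurable_on {0..T} y"
  using has_ac_derivative_continuous[OF assms] by (rule bounded_measurable_on_continuous)

text \<open>The function \<open>y - \<integral>f\<close> has increments of order \<open>(s - r)\<^sup>2\<close>, hence derivative \<open>0\<close>
everywhere, hence is constant. Thus an increment formula only has to be verified up to a quadratic
error, which is what freezing factors at one endpoint produces.\<close>

lemma has_ac_derivative_from_quadratic_increments:
  fixes y :: "real \<Rightarrow> 'a::euclidean_space"
  assumes f: "bounded_measurable_on {0..T} f"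
    and inc: "\<And>r s. 0 \<le> r \<Longrightarrow> r \<le> s \<Longrightarrow> s \<le> T \<Longrightarrow> norm (y s - y r - integral {r..s} f) \<le> C * (s - r)\<^sup>2"
  shows "has_ac_derivative T y f"
proof -
  define D where "D s = y s - integral {0..s} f" for s
  have D: "D s - D r = y s - y r - integral {r..s} f" if "0 \<le> r" "r \<le> s" "s \<le> T" for r s
  proof -
    have "integral {0..r} f + integral {r..s} f = integral {0..s} f"
      using that by (intro Henstock_Kurzweil_Integration.integral_combine
          bounded_measurable_on_imp_integrable[OF f]) auto
    then show ?thesis unfolding D_def by (simp add: algebra_simps)
  qed
  have le: "norm (D s - D r) \<le> \<bar>C\<bar> * \<bar>s - r\<bar> * norm (s - r)" if "r \<in> {0..T}" "s \<in> {0..T}" for r s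
  proof (cases "r \<le> s")
    case True
    have "norm (D s - D r) \<le> C * (s - r)\<^sup>2"
      using D[of r s] inc[of r s] that True by simp
    also have "\<dots> \<le> \<bar>C\<bar> * (s - r)\<^sup>2" by (intro mult_right_mono) auto
    finally show ?thesis using True by (simp add: power2_eq_square)
  next
    case False
    have "norm (D r - D s) \<le> C * (r - s)\<^sup>2"
      using D[of s r] inc[of s r] that False by simp
    also have "\<dots> \<le> \<bar>C\<bar> * (r - s)\<^sup>2" by (intro mult_right_mono) auto
    finally show ?thesis using False by (simp add: power2_eq_square norm_minus_commute algebra_simps)
  qed
  have "(D has_derivative (\<lambda>_. 0)) (at r within {0..T})" if r: "r \<in> {0..T}" for r
  proof (rule has_derivativeI_sandwich[where e=1])
    show "norm (D s - D r - 0) / norm (s - r) \<le> \<bar>C\<bar> * \<bar>s - r\<bar>"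
      if "s \<in> {0..T}" "s \<noteq> r" "dist s r < 1" for s
      using le[OF r that(1)] that(2) by (simp add: divide_le_eq)
    have "((\<lambda>s. \<bar>C\<bar> * \<bar>s - r\<bar>) \<longlongrightarrow> \<bar>C\<bar> * \<bar>r - r\<bar>) (at r within {0..T})"
      by (intro tendsto_intros)
    then show "((\<lambda>s. \<bar>C\<bar> * \<bar>s - r\<bar>) \<longlongrightarrow> 0) (at r within {0..T})" by simp
  qed auto
  then obtain c where c: "\<And>s. s \<in> {0..T} \<Longrightarrow> D s = c"
    using has_derivative_zero_constant[of "{0..T}" D] by auto
  show ?thesis
    unfolding has_ac_derivative_def
  proof (intro conjI allI impI)
    fix r s assume "0 \<le> r \<and> r \<le> s \<and> s \<le> T"
    then show "y s - y r = integral {r..s} f"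
      using D[of r s] c[of r] c[of s] by simp
  qed (rule f)
qed

text \<open>Freezing \<open>w\<close> and \<open>y\<close> at the left endpoint in the integrand makes the product rule exact up to
\<open>p (y s - y r) (w s - w r)\<close>; both this term and the cost of freezing are quadratic in \<open>s - r\<close>.\<close>

lemma has_ac_derivative_bilinear:
  fixes y :: "real \<Rightarrow> 'a::euclidean_space" and w :: "real \<Rightarrow> 'b::euclidean_space"
    and p :: "'a \<Rightarrow> 'b \<Rightarrow> 'c::euclidean_space"
  assumes p: "bounded_bilinear p" and y: "has_ac_derivative T y f" and w: "has_ac_derivative T w g"
  shows "has_ac_derivative T (\<lambda>s. p (y s) (w s)) (\<lambda>s. p (f s) (w s) + p (y s) (g s))"
proof -
  interpret p: bounded_bilinear p by (rule p)
  obtain K where K: "K \<ge> 0" "\<And>x y. norm (p x y) \<le> norm x * norm y * K"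
    using p.nonneg_bounded by auto
  obtain L1 where L1: "L1 \<ge> 0" "\<And>r s. r \<in> {0..T} \<Longrightarrow> s \<in> {0..T} \<Longrightarrow> norm (y s - y r) \<le> L1 * \<bar>s - r\<bar>"
    using has_ac_derivative_lipschitz[OF y] by blast
  obtain L2 where L2: "L2 \<ge> 0" "\<And>r s. r \<in> {0..T} \<Longrightarrow> s \<in> {0..T} \<Longrightarrow> norm (w s - w r) \<le> L2 * \<bar>s - r\<bar>"
    using has_ac_derivative_lipschitz[OF w] by blast
  have bf: "bounded_measurable_on {0..T} f" and bg: "bounded_measurable_on {0..T} g"
    using y w unfolding has_ac_derivative_def by auto
  note by' = has_ac_derivative_bounded_measurable[OF y]
  note bw = has_ac_derivative_bounded_measurable[OF w]
  obtain B1 where B1: "B1 > 0" "\<forall>x\<in>{0..T}. norm (f x) \<le> B1"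
    using bf unfolding bounded_measurable_on_def bounded_pos by auto
  obtain B2 where B2: "B2 > 0" "\<forall>x\<in>{0..T}. norm (g x) \<le> B2"
    using bg unfolding bounded_measurable_on_def bounded_pos by auto
  have bm: "bounded_measurable_on {0..T} (\<lambda>s. p (f s) (w s) + p (y s) (g s))"
    by (intro bounded_measurable_on_add bounded_measurable_on_bilinear[OF p] bf bg by' bw)
  show ?thesis
  proof (rule has_ac_derivative_from_quadratic_increments[OF bm])
    fix r s assume rs: "0 \<le> r" "r \<le> s" "s \<le> T"
    then have sub: "{r..s} \<subseteq> {0..T}" by auto
    have yi: "y s - y r = integral {r..s} f" and wi: "w s - w r = integral {r..s} g"
      using y w rs unfolding has_ac_derivative_def by auto
    note int = bounded_measurable_on_imp_integrable[OF _ sub]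
    let ?h = "\<lambda>u. p (f u) (w u) + p (y u) (g u)"
    \<comment> \<open>The integrand with \<open>w\<close> and \<open>y\<close> frozen at the left endpoint.\<close>
    let ?k = "\<lambda>u. p (f u) (w r) + p (y r) (g u)"
    have "integral {r..s} ?k = p (integral {r..s} f) (w r) + p (y r) (integral {r..s} g)"
    proof -
      have "((\<lambda>u. p (f u) (w r)) has_integral p (integral {r..s} f) (w r)) {r..s}"
        using has_integral_linear[OF integrable_integral[OF int[OF bf]] p.bounded_linear_left[of "w r"]]
        by (simp add: o_def)
      moreover have "((\<lambda>u. p (y r) (g u)) has_integral p (y r) (integral {r..s} g)) {r..s}"
        using has_integral_linear[OF integrable_integral[OF int[OF bg]] p.bounded_linear_right[of "y r"]]
        by (simp add: o_def)
      ultimately show ?thesis by (intro integral_unique has_integral_add)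
    qed
    moreover have bk: "bounded_measurable_on {0..T} ?k"
      by (intro bounded_measurable_on_add bounded_measurable_on_bilinear[OF p] bf bg) auto
    ultimately have e: "p (y s) (w s) - p (y r) (w r) - integral {r..s} ?h
        = p (y s - y r) (w s - w r) - integral {r..s} (\<lambda>u. ?h u - ?k u)"
      by (simp only: Henstock_Kurzweil_Integration.integral_diff[OF int[OF bm] int[OF bk]] flip: yi wi)
        (simp add: p.diff_left p.diff_right)
    have "norm (p (y s - y r) (w s - w r)) \<le> (L1 * (s - r)) * (L2 * (s - r)) * K"
      using L1(2)[of r s] L2(2)[of r s] rs L1(1) L2(1) K(1)
      by (intro order_trans[OF K(2)] mult_right_mono mult_mono) auto
    moreover have "norm (integral {r..s} (\<lambda>u. ?h u - ?k u)) \<le> ((B1 * L2 + L1 * B2) * K * (s - r)) * (s - r)"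
    proof (rule bounded_measurable_on_integral_norm_le[OF bounded_measurable_on_diff[OF bm bk] sub _ rs(2)])
      fix u assume u: "u \<in> {r..s}"
      have "?h u - ?k u = p (f u) (w u - w r) + p (y u - y r) (g u)"
        by (simp add: p.diff_left p.diff_right)
      moreover have "norm (p (f u) (w u - w r)) \<le> B1 * (L2 * (s - r)) * K"
      proof (intro order_trans[OF K(2)] mult_right_mono mult_mono)
        have "norm (w u - w r) \<le> L2 * (u - r)" using L2(2)[of r u] u rs by auto
        also have "\<dots> \<le> L2 * (s - r)" using u L2(1) by (intro mult_left_mono) auto
        finally show "norm (w u - w r) \<le> L2 * (s - r)" .
      qed (use B1 K u sub rs in auto)
      moreover have "norm (p (y u - y r) (g u)) \<le> (L1 * (s - r)) * B2 * K"
      proof (intro order_trans[OF K(2)] mult_right_mono mult_mono)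
        have "norm (y u - y r) \<le> L1 * (u - r)" using L1(2)[of r u] u rs by auto
        also have "\<dots> \<le> L1 * (s - r)" using u L1(1) by (intro mult_left_mono) auto
        finally show "norm (y u - y r) \<le> L1 * (s - r)" .
      qed (use B2 L1(1) K u sub rs in auto)
      ultimately show "norm (?h u - ?k u) \<le> (B1 * L2 + L1 * B2) * K * (s - r)"
        by (simp add: algebra_simps) (smt (verit) norm_triangle_ineq)
    qed
    ultimately have "norm (p (y s) (w s) - p (y r) (w r) - integral {r..s} ?h)
       \<le> (L1 * (s - r)) * (L2 * (s - r)) * K + ((B1 * L2 + L1 * B2) * K * (s - r)) * (s - r)"
      unfolding e by (smt (verit) norm_triangle_ineq4)
    also have "\<dots> = ((L1 * L2 + B1 * L2 + L1 * B2) * K) * (s - r)\<^sup>2"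
      by (simp add: algebra_simps power2_eq_square)
    finally show "norm (p (y s) (w s) - p (y r) (w r) - integral {r..s} ?h)
       \<le> ((L1 * L2 + B1 * L2 + L1 * B2) * K) * (s - r)\<^sup>2" .
  qed
qed

lemma has_ac_derivative_cong:
  assumes "has_ac_derivative T y f" "\<And>s. s \<in> {0..T} \<Longrightarrow> f s = g s" "\<And>s. s \<in> {0..T} \<Longrightarrow> y s = w s"
  shows "has_ac_derivative T w g"
proof -
  have "integral {r..s} g = integral {r..s} f" if "0 \<le> r" "s \<le> T" for r s
    by (rule Henstock_Kurzweil_Integration.integral_cong) (use that assms(2) in auto)
  moreover have "bounded_measurable_on {0..T} g"
    using assms(1,2) bounded_measurable_on_cong[of "{0..T}" f g] unfolding has_ac_derivative_def by blast
  moreover have "w s - w r = y s - y r" if "0 \<le> r" "r \<le> s" "s \<le> T" for r s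
    using assms(3)[of r] assms(3)[of s] that by simp
  ultimately show ?thesis
    using assms(1) unfolding has_ac_derivative_def by simp
qed

lemma has_ac_derivative_linear:
  assumes p: "bounded_linear p" and y: "has_ac_derivative T y f"
  shows "has_ac_derivative T (\<lambda>s. p (y s)) (\<lambda>s. p (f s))"
  unfolding has_ac_derivative_def
proof (intro conjI allI impI)
  have bf: "bounded_measurable_on {0..T} f" using y unfolding has_ac_derivative_def by auto
  then show "bounded_measurable_on {0..T} (\<lambda>s. p (f s))" by (rule bounded_measurable_on_linear[OF p])
  fix r s assume rs: "0 \<le> r \<and> r \<le> s \<and> s \<le> T"
  have "p (integral {r..s} f) = integral {r..s} (\<lambda>s. p (f s))"
    using integral_linear[OF bounded_measurable_on_imp_integrable[OF bf] p, of r s] rs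
    by (simp add: o_def)
  moreover have "y s - y r = integral {r..s} f" using y rs unfolding has_ac_derivative_def by auto
  ultimately show "p (y s) - p (y r) = integral {r..s} (\<lambda>s. p (f s))"
    by (metis bounded_linear.linear linear_diff p)
qed

section \<open>Terminal value problems\<close>

text \<open>Measured against the weight \<open>exp (2 * L * (T - t))\<close>, integration of an \<open>L\<close>-Lipschitz right-hand side
over \<open>{t..T}\<close> contracts by the factor \<open>1 / 2\<close>, whatever the length of the interval. Both uniqueness
and global existence follow by iteration.\<close>

lemma integral_exp_weight_le:
  fixes L K t T :: real
  assumes "0 < L" "0 \<le> K" "t \<le> T"
  shows "(\<lambda>s. L * (K * exp (2 * L * (T - s)))) integrable_on {t..T}"
    and "integral {t..T} (\<lambda>s. L * (K * exp (2 * L * (T - s)))) \<le> K / 2 * exp (2 * L * (T - t))"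
proof -
  have "((\<lambda>s. L * (K * exp (2 * L * (T - s)))) has_integral
      (- K / 2 * exp (2 * L * (T - T)) - - K / 2 * exp (2 * L * (T - t)))) {t..T}"
    by (rule fundamental_theorem_of_calculus[OF \<open>t \<le> T\<close>])
      (auto intro!: derivative_eq_intros simp: has_real_derivative_iff_has_vector_derivative[symmetric])
  moreover have "- K / 2 * exp (2 * L * (T - T)) - - K / 2 * exp (2 * L * (T - t)) \<le> K / 2 * exp (2 * L * (T - t))"
    using assms by simp
  ultimately show "(\<lambda>s. L * (K * exp (2 * L * (T - s)))) integrable_on {t..T}"
    and "integral {t..T} (\<lambda>s. L * (K * exp (2 * L * (T - s)))) \<le> K / 2 * exp (2 * L * (T - t))"
    by (auto simp: has_integral_iff)
qed

lemma gronwall_terminal: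
  fixes u :: "real \<Rightarrow> real"
  assumes L: "0 < L" and u: "continuous_on {0..T} u" and nonneg: "\<And>t. t \<in> {0..T} \<Longrightarrow> 0 \<le> u t"
    and le: "\<And>t. t \<in> {0..T} \<Longrightarrow> u t \<le> integral {t..T} (\<lambda>s. L * u s)"
    and t: "t \<in> {0..T}"
  shows "u t = 0"
proof -
  obtain K where K: "K > 0" "\<forall>x\<in>{0..T}. norm (u x) \<le> K"
    using bounded_measurable_on_continuous[OF u]
    unfolding bounded_measurable_on_def bounded_pos by auto
  have *: "\<forall>t\<in>{0..T}. u t \<le> K / 2 ^ k * exp (2 * L * (T - t))" for k
  proof (induction k)
    case 0
    show ?case
    proof
      fix t assume t: "t \<in> {0..T}"
      have "u t \<le> K * 1" using K(2)[rule_format, OF t] by auto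
      also have "\<dots> \<le> K * exp (2 * L * (T - t))" using K t L by (intro mult_left_mono) auto
      finally show "u t \<le> K / 2 ^ 0 * exp (2 * L * (T - t))" by simp
    qed
  next
    case (Suc k)
    show ?case
    proof
      fix t assume t: "t \<in> {0..T}"
      have "u t \<le> integral {t..T} (\<lambda>s. L * u s)" by (rule le[OF t])
      also have "\<dots> \<le> integral {t..T} (\<lambda>s. L * (K / 2 ^ k * exp (2 * L * (T - s))))"
      proof (rule integral_le)
        show "(\<lambda>s. L * u s) integrable_on {t..T}"
          using t by (intro integrable_continuous_interval continuous_intros continuous_on_subset[OF u]) auto
        show "L * u s \<le> L * (K / 2 ^ k * exp (2 * L * (T - s)))" if "s \<in> {t..T}" for s
          using Suc that t L by (intro mult_left_mono) auto
        show "(\<lambda>s. L * (K / 2 ^ k * exp (2 * L * (T - s)))) integrable_on {t..T}"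
          by (rule integral_exp_weight_le(1)) (use L K t in auto)
      qed
      also have "\<dots> \<le> K / 2 ^ k / 2 * exp (2 * L * (T - t))"
        by (rule integral_exp_weight_le(2)) (use L K t in auto)
      finally show "u t \<le> K / 2 ^ Suc k * exp (2 * L * (T - t))" by (simp add: mult.commute)
    qed
  qed
  have "(\<lambda>k. K * exp (2 * L * (T - t)) * (1 / 2) ^ k) \<longlonglongrightarrow> K * exp (2 * L * (T - t)) * 0"
    by (intro tendsto_intros LIMSEQ_abs_realpow_zero2) auto
  moreover have "u t \<le> K * exp (2 * L * (T - t)) * (1 / 2) ^ k" for k
    using *[of k] t by (simp add: power_divide mult_ac)
  ultimately have "u t \<le> 0"
    using LIMSEQ_le_const[of "\<lambda>k. K * exp (2 * L * (T - t)) * (1 / 2) ^ k" 0 "u t"] by auto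
  then show ?thesis using nonneg[OF t] by simp
qed

lemma has_ac_derivative_terminal_integral:
  assumes f: "bounded_measurable_on {0..T} f"
    and y: "\<And>t. t \<in> {0..T} \<Longrightarrow> y t = yT - integral {t..T} f"
  shows "has_ac_derivative T y f"
  unfolding has_ac_derivative_def
proof (intro conjI allI impI f)
  fix r s assume rs: "0 \<le> r \<and> r \<le> s \<and> s \<le> T"
  have "integral {r..s} f + integral {s..T} f = integral {r..T} f"
    using rs by (intro Henstock_Kurzweil_Integration.integral_combine bounded_measurable_on_imp_integrable[OF f]) auto
  moreover have "y s - y r = integral {r..T} f - integral {s..T} f"
    using y[of r] y[of s] rs by simp
  ultimately show "y s - y r = integral {r..s} f" by (metis add_diff_cancel_right')
qed

text \<open>Picard iteration from the terminal time. In the exponential weight the successive differences decay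
geometrically, so that the iterates converge uniformly on all of \<open>{0..T}\<close>.\<close>

lemma lipschitz_terminal_ode_exists:
  fixes F :: "real \<Rightarrow> 'a::euclidean_space \<Rightarrow> 'a"
  assumes T: "0 \<le> T" and lip: "\<And>s x y. s \<in> {0..T} \<Longrightarrow> norm (F s x - F s y) \<le> L * norm (x - y)"
    and meas: "\<And>y. continuous_on {0..T} y \<Longrightarrow> bounded_measurable_on {0..T} (\<lambda>s. F s (y s))"
  obtains y where "has_ac_derivative T y (\<lambda>s. F s (y s))" "y T = yT"
proof -
  \<comment> \<open>The weight needs a positive constant, also for a right-hand side that does not depend on the state.\<close>
  define L' where "L' = \<bar>L\<bar> + 1"
  have L': "L' > 0" unfolding L'_def by simp
  have lip': "norm (F s x - F s y) \<le> L' * norm (x - y)" if "s \<in> {0..T}" for s x y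
    using lip[OF that, of x y] unfolding L'_def
    by (smt (verit) mult_right_mono norm_ge_zero)
  define u where "u k = ((\<lambda>v t. yT - integral {t..T} (\<lambda>s. F s (v s))) ^^ k) (\<lambda>_. yT)" for k :: nat
  have u0: "u 0 = (\<lambda>_. yT)" and uS: "u (Suc k) t = yT - integral {t..T} (\<lambda>s. F s (u k s))" for k t
    unfolding u_def by simp_all
  have cont: "continuous_on {0..T} (u k)" for k
  proof (induction k)
    case (Suc k)
    have "has_ac_derivative T (u (Suc k)) (\<lambda>s. F s (u k s))"
      by (rule has_ac_derivative_terminal_integral[OF meas[OF Suc] uS])
    then show ?case by (rule has_ac_derivative_continuous)
  qed (simp add: u0)
  have int: "(\<lambda>s. F s (y s)) integrable_on {t..T}" if "continuous_on {0..T} y" "t \<in> {0..T}" for y t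
    using bounded_measurable_on_imp_integrable[OF meas[OF that(1)], of t T] that(2) by auto
  obtain K where K: "K > 0" "\<forall>x\<in>{0..T}. norm (u 1 x - u 0 x) \<le> K"
    using bounded_measurable_on_continuous[OF continuous_on_diff[OF cont[of 1] cont[of 0]]]
    unfolding bounded_measurable_on_def bounded_pos by auto
  have step: "\<forall>t\<in>{0..T}. norm (u (Suc k) t - u k t) \<le> K / 2 ^ k * exp (2 * L' * (T - t))" for k
  proof (induction k)
    case 0
    show ?case
    proof
      fix t assume t: "t \<in> {0..T}"
      have "norm (u 1 t - u 0 t) \<le> K * 1" using K(2) t by auto
      also have "\<dots> \<le> K * exp (2 * L' * (T - t))" using K t L' by (intro mult_left_mono) auto
      finally show "norm (u (Suc 0) t - u 0 t) \<le> K / 2 ^ 0 * exp (2 * L' * (T - t))" by simp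
    qed
  next
    case (Suc k)
    show ?case
    proof
      fix t assume t: "t \<in> {0..T}"
      have "u (Suc (Suc k)) t - u (Suc k) t = - integral {t..T} (\<lambda>s. F s (u (Suc k) s) - F s (u k s))"
        unfolding uS[of "Suc k"] uS[of k t]
        by (subst Henstock_Kurzweil_Integration.integral_diff[OF int[OF cont t] int[OF cont t]]) simp
      moreover have "norm (integral {t..T} (\<lambda>s. F s (u (Suc k) s) - F s (u k s)))
          \<le> integral {t..T} (\<lambda>s. L' * (K / 2 ^ k * exp (2 * L' * (T - s))))"
      proof (rule integral_norm_bound_integral)
        show "(\<lambda>s. F s (u (Suc k) s) - F s (u k s)) integrable_on {t..T}"
          by (intro integrable_diff int cont t)
        show "(\<lambda>s. L' * (K / 2 ^ k * exp (2 * L' * (T - s)))) integrable_on {t..T}"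
          by (rule integral_exp_weight_le(1)) (use L' K t in auto)
        fix s assume "s \<in> {t..T}"
        then have s: "s \<in> {0..T}" using t by auto
        show "norm (F s (u (Suc k) s) - F s (u k s)) \<le> L' * (K / 2 ^ k * exp (2 * L' * (T - s)))"
          by (rule order_trans[OF lip'[OF s]]) (use Suc s L' in \<open>intro mult_left_mono; auto\<close>)
      qed
      moreover have "\<dots> \<le> K / 2 ^ k / 2 * exp (2 * L' * (T - t))"
        by (rule integral_exp_weight_le(2)) (use L' K t in auto)
      ultimately show "norm (u (Suc (Suc k)) t - u (Suc k) t) \<le> K / 2 ^ Suc k * exp (2 * L' * (T - t))"
        by (simp add: mult.commute)
    qed
  qed
  define M where "M k = K * exp (2 * L' * T) * (1 / 2) ^ k" for k :: nat
  have stepM: "norm (u (Suc k) t - u k t) \<le> M k" if "t \<in> {0..T}" for k t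
  proof -
    have "norm (u (Suc k) t - u k t) \<le> K / 2 ^ k * exp (2 * L' * (T - t))" using step that by auto
    also have "\<dots> \<le> K / 2 ^ k * exp (2 * L' * T)"
      using that L' K by (intro mult_left_mono) (auto intro: mult_left_mono)
    finally show ?thesis by (simp add: M_def power_divide)
  qed
  have sM: "summable M" unfolding M_def by (intro summable_mult summable_geometric) auto
  define y where "y t = yT + (\<Sum>k. u (Suc k) t - u k t)" for t
  have "uniform_limit {0..T} (\<lambda>n t. \<Sum>i<n. u (Suc i) t - u i t) (\<lambda>t. \<Sum>i. u (Suc i) t - u i t) sequentially"
    by (rule Weierstrass_m_test[OF _ sM]) (use stepM in auto)
  moreover have "(\<lambda>n t. \<Sum>i<n. u (Suc i) t - u i t) = (\<lambda>n t. u n t - yT)"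
    using sum_lessThan_telescope[of "\<lambda>i. u i _"] u0 by (auto simp: fun_eq_iff)
  ultimately have ul: "uniform_limit {0..T} (\<lambda>n t. u n t - yT) (\<lambda>t. y t - yT) sequentially"
    by (simp add: y_def)
  have ul: "uniform_limit {0..T} u y sequentially"
    using uniform_limit_add[OF ul uniform_limit_const[of "\<lambda>_. yT"]] by simp
  have cy: "continuous_on {0..T} y"
    by (rule uniform_limit_theorem[OF _ ul]) (use cont in auto)
  have eq: "y t = yT - integral {t..T} (\<lambda>s. F s (y s))" if t: "t \<in> {0..T}" for t
  proof -
    have l1: "(\<lambda>k. u (Suc k) t) \<longlonglongrightarrow> y t"
      using tendsto_uniform_limitI[OF ul t] by (rule LIMSEQ_Suc)
    have "(\<lambda>k. integral {t..T} (\<lambda>s. F s (u k s))) \<longlonglongrightarrow> integral {t..T} (\<lambda>s. F s (y s))"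
    proof (rule tendstoI)
      fix e :: real assume e: "e > 0"
      define e' where "e' = e / (L' * (T - t) + 1)"
      have pos: "L' * (T - t) + 1 > 0" using L' t by (simp add: add_nonneg_pos)
      have e': "e' > 0" unfolding e'_def using e pos by simp
      have "\<forall>\<^sub>F k in sequentially. \<forall>s\<in>{0..T}. dist (u k s) (y s) < e'"
        using ul e' unfolding uniform_limit_iff by blast
      then show "\<forall>\<^sub>F k in sequentially. dist (integral {t..T} (\<lambda>s. F s (u k s))) (integral {t..T} (\<lambda>s. F s (y s))) < e"
      proof eventually_elim
        case (elim k)
        have "norm (integral {t..T} (\<lambda>s. F s (u k s) - F s (y s))) \<le> integral {t..T} (\<lambda>_. L' * e')"
        proof (rule integral_norm_bound_integral)
          show "(\<lambda>s. F s (u k s) - F s (y s)) integrable_on {t..T}"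
            by (intro integrable_diff int cont cy t)
          fix s assume "s \<in> {t..T}"
          then have s: "s \<in> {0..T}" using t by auto
          show "norm (F s (u k s) - F s (y s)) \<le> L' * e'"
            by (rule order_trans[OF lip'[OF s]])
              (use elim s L' in \<open>intro mult_left_mono; auto simp: dist_norm less_imp_le\<close>)
        qed auto
        also have "\<dots> = L' * (T - t) * e'" using t by simp
        also have "\<dots> < (L' * (T - t) + 1) * e'" using e' by (intro mult_strict_right_mono) auto
        also have "\<dots> = e" unfolding e'_def using pos by simp
        finally show ?case
          unfolding dist_norm
            Henstock_Kurzweil_Integration.integral_diff[OF int[OF cont t] int[OF cy t]] .
      qed
    qed
    then have "(\<lambda>k. u (Suc k) t) \<longlonglongrightarrow> yT - integral {t..T} (\<lambda>s. F s (y s))"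
      unfolding uS by (intro tendsto_intros)
    then show ?thesis using l1 LIMSEQ_unique by blast
  qed
  show thesis
  proof
    show "has_ac_derivative T y (\<lambda>s. F s (y s))"
      by (rule has_ac_derivative_terminal_integral[OF meas[OF cy] eq])
    show "y T = yT"
      using eq[of T] T by simp
  qed
qed

section \<open>The Riccati system\<close>

lemma bounded_measurable_on_Pair:
  assumes f: "bounded_measurable_on S f" and g: "bounded_measurable_on S g"
  shows "bounded_measurable_on S (\<lambda>s. (f s, g s))"
  using bounded_measurable_on_add[OF bounded_measurable_on_linear[OF _ f, of "\<lambda>x. (x, 0)"]
      bounded_measurable_on_linear[OF _ g, of "\<lambda>x. (0, x)"]]
  by (simp add: bounded_linear_Pair bounded_linear_zero bounded_linear_ident)

lemma matrix_vector_mult_minus_left: "(- A) *v x = - (A *v x)" for A :: "real^'n^'m"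
  by (simp add: vec_eq_iff matrix_vector_mult_def sum_negf)

lemma matrix_mult_minus: "(- A) ** B = - (A ** B)" "A ** (- B) = - (A ** B)"
  for A :: "real^'n^'m" and B :: "real^'p^'n"
  by (simp_all add: vec_eq_iff matrix_matrix_mult_def sum_negf)

lemma transpose_add_minus: "transpose (A + B) = transpose A + transpose B" "transpose (- A) = - transpose A"
  "transpose (A - B) = transpose A - transpose B"
  for A :: "real^'n^'m"
  by (simp_all add: vec_eq_iff transpose_def)

lemma inner_matrix_vector_transpose: "x \<bullet> (A *v y) = (transpose A *v x) \<bullet> y"
  for A :: "real^'n^'m"
  by (metis dot_lmul_matrix vector_transpose_matrix transpose_transpose inner_commute)

text \<open>The identity \<open>P s - P r = - P r (Y s - Y r) P s\<close> turns the increment of the inverse into an integral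
that differs from the claimed one only in the time arguments of the outer factors. A bound for the
inverses makes them Lipschitz, so that the difference is quadratic.\<close>

lemma has_ac_derivative_matrix_inverse:
  fixes Y P :: "real \<Rightarrow> real^'n^'n"
  assumes Y: "has_ac_derivative T Y f"
    and PY: "\<And>s. s \<in> {0..T} \<Longrightarrow> P s ** Y s = mat 1" and YP: "\<And>s. s \<in> {0..T} \<Longrightarrow> Y s ** P s = mat 1"
    and bound: "\<And>s. s \<in> {0..T} \<Longrightarrow> norm (P s) \<le> B"
  shows "has_ac_derivative T P (\<lambda>s. - (P s ** f s ** P s))"
proof -
  obtain L where L: "L \<ge> 0" "\<And>r s. r \<in> {0..T} \<Longrightarrow> s \<in> {0..T} \<Longrightarrow> norm (Y s - Y r) \<le> L * \<bar>s - r\<bar>"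
    using has_ac_derivative_lipschitz[OF Y] by blast
  have bf: "bounded_measurable_on {0..T} f" using Y unfolding has_ac_derivative_def by blast
  obtain K where K: "K > 0" "\<forall>x\<in>{0..T}. norm (f x) \<le> K"
    using bf unfolding bounded_measurable_on_def bounded_pos by auto
  have diff: "P s - P r = - (P r ** (Y s - Y r) ** P s)" if "r \<in> {0..T}" "s \<in> {0..T}" for r s
  proof -
    have "P r ** (Y s - Y r) ** P s = P r ** (Y s ** P s) - (P r ** Y r) ** P s"
      by (simp add: matrix_mul_assoc bounded_bilinear.diff_left[OF bounded_bilinear_matrix_mult]
          bounded_bilinear.diff_right[OF bounded_bilinear_matrix_mult])
    then show ?thesis using PY[OF that(1)] YP[OF that(2)] by simp
  qed
  have nmm: "norm (A ** C ** D) \<le> a * c * d" if "norm A \<le> a" "norm C \<le> c" "norm D \<le> d"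
    for A C D :: "real^'n^'n" and a c d
  proof -
    have "norm (A ** C ** D) \<le> norm A * norm C * norm D"
      by (rule order_trans[OF norm_matrix_mult_le]) (intro mult_right_mono norm_matrix_mult_le norm_ge_zero)
    also have "\<dots> \<le> a * c * d"
      using that by (meson mult_mono mult_nonneg_nonneg norm_ge_zero order_trans)
    finally show ?thesis .
  qed
  have lipP: "norm (P s - P r) \<le> B * L * B * \<bar>s - r\<bar>" if "r \<in> {0..T}" "s \<in> {0..T}" for r s
    unfolding diff[OF that] norm_minus_cancel
    using nmm[OF bound[OF that(1)] L(2)[OF that] bound[OF that(2)]] by (simp add: mult_ac)
  have "0 \<le> (B * B) * L" using L(1) by simp
  then have "(B * L * B)-lipschitz_on {0..T} P"
    using lipP by (intro lipschitz_onI) (auto simp: dist_norm mult_ac)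
  then have "continuous_on {0..T} P" by (rule lipschitz_on_continuous_on)
  then have bP: "bounded_measurable_on {0..T} P" by (rule bounded_measurable_on_continuous)
  have bg: "bounded_measurable_on {0..T} (\<lambda>s. - (P s ** f s ** P s))"
    by (intro bounded_measurable_on_minus bounded_measurable_on_matrix_mult bP bf)
  show ?thesis
  proof (rule has_ac_derivative_from_quadratic_increments[OF bg])
    fix r s assume rs: "0 \<le> r" "r \<le> s" "s \<le> T"
    then have sub: "{r..s} \<subseteq> {0..T}" and rs': "r \<in> {0..T}" "s \<in> {0..T}" by auto
    have B: "B \<ge> 0" using bound[of r] rs order_trans[OF norm_ge_zero] by auto
    have Yi: "Y s - Y r = integral {r..s} f" using Y rs unfolding has_ac_derivative_def by auto
    have "((\<lambda>u. - (P r ** f u ** P s)) has_integral - (P r ** integral {r..s} f ** P s)) {r..s}"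
      using has_integral_linear[OF integrable_integral[OF bounded_measurable_on_imp_integrable[OF bf sub]]
        bounded_linear_minus[OF bounded_linear_compose[OF bounded_bilinear.bounded_linear_left[OF bounded_bilinear_matrix_mult, of "P s"]
            bounded_bilinear.bounded_linear_right[OF bounded_bilinear_matrix_mult, of "P r"]]]]
      by (simp add: o_def)
    then have i: "integral {r..s} (\<lambda>u. - (P r ** f u ** P s)) = P s - P r"
      unfolding diff[OF rs'] Yi by (rule integral_unique)
    have bk: "bounded_measurable_on {0..T} (\<lambda>u. - (P r ** f u ** P s))"
      by (intro bounded_measurable_on_minus bounded_measurable_on_matrix_mult bf) auto
    have e: "P s - P r - integral {r..s} (\<lambda>s. - (P s ** f s ** P s))
        = integral {r..s} (\<lambda>u. - (P r ** f u ** P s) - - (P u ** f u ** P u))"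
      unfolding i[symmetric]
      by (rule Henstock_Kurzweil_Integration.integral_diff[symmetric]; rule bounded_measurable_on_imp_integrable[OF _ sub]; fact)
    have "norm (integral {r..s} (\<lambda>u. - (P r ** f u ** P s) - - (P u ** f u ** P u)))
        \<le> (2 * (B * L * B) * K * B * (s - r)) * (s - r)"
    proof (rule bounded_measurable_on_integral_norm_le[OF bounded_measurable_on_diff[OF bk bg] sub _ rs(2)])
      fix u assume u: "u \<in> {r..s}"
      then have u': "u \<in> {0..T}" using sub by auto
      have d: "- (P r ** f u ** P s) - - (P u ** f u ** P u)
         = (P u - P r) ** f u ** P u - P r ** f u ** (P s - P u)"
        by (simp add: bounded_bilinear.diff_left[OF bounded_bilinear_matrix_mult]
          bounded_bilinear.diff_right[OF bounded_bilinear_matrix_mult])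
      have le: "B * L * B * \<bar>v - w\<bar> \<le> B * L * B * (s - r)" if "v \<in> {r..s}" "w \<in> {r..s}" for v w
        using that B L(1) by (intro mult_left_mono) auto
      have "norm ((P u - P r) ** f u ** P u) \<le> (B * L * B * (s - r)) * K * B"
        by (rule nmm) (use lipP[OF rs'(1) u'] le[of u r] u rs K(2) u' bound in auto)
      moreover have "norm (P r ** f u ** (P s - P u)) \<le> B * K * (B * L * B * (s - r))"
        by (rule nmm) (use lipP[OF u' rs'(2)] le[of s u] u rs K(2) u' bound in auto)
      ultimately have "norm (- (P r ** f u ** P s) - - (P u ** f u ** P u))
          \<le> (B * L * B * (s - r)) * K * B + B * K * (B * L * B * (s - r))"
        unfolding d using norm_triangle_ineq4[of "(P u - P r) ** f u ** P u" "P r ** f u ** (P s - P u)"]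
        by linarith
      also have "\<dots> = 2 * (B * L * B) * K * B * (s - r)" by (simp add: algebra_simps)
      finally show "norm (- (P r ** f u ** P s) - - (P u ** f u ** P u)) \<le> 2 * (B * L * B) * K * B * (s - r)" .
    qed
    then show "norm (P s - P r - integral {r..s} (\<lambda>s. - (P s ** f s ** P s))) \<le> (2 * (B * L * B) * K * B) * (s - r)\<^sup>2"
      unfolding e by (simp add: power2_eq_square mult_ac)
  qed
qed


lemma norm_le_of_operator_bound:
  fixes A :: "real^'n^'m"
  assumes "\<And>x. norm (A *v x) \<le> K * norm x"
  shows "norm A \<le> real CARD('m) * (real CARD('n) * K)"
proof -
  have "\<bar>A $ i $ j\<bar> \<le> K" for i j
  proof -
    have "A $ i $ j = (A *v axis j 1) $ i" by (simp add: matrix_vector_mult_basis column_def)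
    also have "\<bar>\<dots>\<bar> \<le> K" using component_le_norm_cart[of "A *v axis j 1" i] assms[of "axis j 1"] by simp
    finally show ?thesis .
  qed
  then have "norm (A $ i) \<le> real CARD('n) * K" for i
    using order_trans[OF norm_le_l1_cart sum_bounded_above[of UNIV "\<lambda>j. \<bar>A $ i $ j\<bar>" K]] by simp
  then have "(\<Sum>i\<in>UNIV. norm (A $ i)) \<le> real CARD('m) * (real CARD('n) * K)"
    using sum_bounded_above[of UNIV "\<lambda>i. norm (A $ i)" "real CARD('n) * K"] by simp
  moreover have "norm A \<le> (\<Sum>i\<in>UNIV. norm (A $ i))"
    unfolding norm_vec_def[of A] by (rule L2_set_le_sum) simp
  ultimately show ?thesis by linarith
qed

lemma matrix_inv_mult:
  fixes A :: "real^'n^'n"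
  assumes "invertible A"
  shows "A ** matrix_inv A = mat 1 \<and> matrix_inv A ** A = mat 1"
  unfolding matrix_inv_def by (rule someI_ex) (use assms in \<open>simp add: invertible_def\<close>)

text \<open>The quadratic form of \<open>A\<close> is nonnegative at \<open>K *\<^sub>R x - matrix_inv A *v x\<close>. Expanding it there, the cross
terms are multiples of \<open>x \<bullet> x\<close>, and the last term is at most \<open>K * (x \<bullet> x)\<close> by the bound of the inverse.\<close>

lemma pos_def_coercive:
  fixes A :: "real^'n^'n"
  assumes A: "pos_def_sym A" and K: "norm (matrix_inv A) \<le> K" "0 < K"
  shows "1 / K * (norm x)\<^sup>2 \<le> x \<bullet> (A *v x)"
proof -
  have sym: "transpose A = A" and pos: "\<And>y. y \<noteq> 0 \<Longrightarrow> 0 < y \<bullet> (A *v y)"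
    using A unfolding pos_def_sym_def by auto
  have nonneg: "0 \<le> y \<bullet> (A *v y)" for y using pos[of y] by (cases "y = 0") auto
  have "y = 0" if "A *v y = 0" for y using pos[of y] that by auto
  then have "invertible A"
    unfolding invertible_def using matrix_left_invertible_ker[of A] matrix_left_right_inverse by blast
  then have inv: "A *v (matrix_inv A *v x) = x"
    using matrix_inv_mult[of A] by (simp add: matrix_vector_mul_assoc)
  let ?y = "matrix_inv A *v x" and ?a = "x \<bullet> (A *v x)" and ?s = "x \<bullet> x"
  have sw: "?y \<bullet> (A *v x) = ?s"
    unfolding inner_matrix_vector_transpose sym inv ..
  have yy: "?y \<bullet> (A *v ?y) \<le> K * ?s"
  proof -
    have "?y \<bullet> x \<le> norm ?y * norm x" by (rule norm_cauchy_schwarz)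
    also have "\<dots> \<le> (K * norm x) * norm x"
      using K norm_matrix_vector_mult_le[of "matrix_inv A" x]
      by (intro mult_right_mono order_trans[OF norm_matrix_vector_mult_le] mult_right_mono) auto
    also have "\<dots> = K * ?s" by (simp add: dot_square_norm power2_eq_square)
    finally show ?thesis unfolding inv .
  qed
  have "0 \<le> (K *\<^sub>R x - ?y) \<bullet> (A *v (K *\<^sub>R x - ?y))" by (rule nonneg)
  also have "\<dots> = K\<^sup>2 * ?a - 2 * K * ?s + ?y \<bullet> (A *v ?y)"
    using sw by (simp add: matrix_vector_mult_diff_distrib matrix_vector_mult_scaleR inner_diff_left inner_diff_right inv
        power2_eq_square algebra_simps inner_commute)
  also have "\<dots> \<le> K\<^sup>2 * ?a - K * ?s" using yy by simp
  finally have "K * ?s \<le> K * (K * ?a)" by (simp add: power2_eq_square)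
  then have "?s \<le> K * ?a" using K(2) by (simp only: mult_le_cancel_left_pos)
  then show ?thesis using K(2) by (simp add: dot_square_norm field_simps)
qed

text \<open>The Riccati equation is linearised: if \<open>Y' = - \<Sigma> Z\<close>, \<open>Z' = - Q Y\<close> with \<open>Y T = 1\<close>, \<open>Z T = Q T\<close>,
then \<open>V = Z P\<close> with \<open>P\<close> the inverse of \<open>Y\<close> solves it wherever \<open>Y\<close> is invertible. The linear system has a global solution,
so that blow-up is excluded by inverting \<open>Y\<close>. Write \<open>M\<close> for the product of the transpose of \<open>Y\<close>
with \<open>Z\<close>. Its derivative is symmetric and negative semidefinite; hence \<open>M\<close> is symmetric and
decreases in time, so that \<open>M s \<ge> M T = Q T \<ge> c\<close>. Then \<open>Y s *v x = 0\<close> forces \<open>x = 0\<close>, the inverses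
are bounded, and \<open>V\<close> inherits symmetry and a lower bound from \<open>M\<close>.\<close>

lemma riccati_matrix_solution_exists:
  fixes \<Sigma> Q :: "real \<Rightarrow> real^'n^'n"
  assumes T: "0 \<le> T" and \<Sigma>: "bounded_measurable_on {0..T} \<Sigma>" and Q: "bounded_measurable_on {0..T} Q"
    and \<Sigma>_sym: "\<And>s. s \<in> {0..T} \<Longrightarrow> transpose (\<Sigma> s) = \<Sigma> s"
    and \<Sigma>_pos: "\<And>s x. s \<in> {0..T} \<Longrightarrow> 0 \<le> x \<bullet> (\<Sigma> s *v x)"
    and Q_sym: "\<And>s. s \<in> {0..T} \<Longrightarrow> transpose (Q s) = Q s"
    and Q_pos: "\<And>s x. s \<in> {0..T} \<Longrightarrow> 0 \<le> x \<bullet> (Q s *v x)"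
    and c: "0 < c" and QT: "\<And>x. c * (norm x)\<^sup>2 \<le> x \<bullet> (Q T *v x)"
  obtains V c' where "has_ac_derivative T V (\<lambda>s. V s ** \<Sigma> s ** V s - Q s)" "V T = Q T"
    "\<And>s. s \<in> {0..T} \<Longrightarrow> transpose (V s) = V s"
    "0 < c'" "\<And>s x. s \<in> {0..T} \<Longrightarrow> c' * (norm x)\<^sup>2 \<le> x \<bullet> (V s *v x)"
proof -
  obtain B where B: "B > 0" "\<forall>x\<in>{0..T}. norm (\<Sigma> x) \<le> B"
    using \<Sigma> unfolding bounded_measurable_on_def bounded_pos by auto
  obtain B' where B': "B' > 0" "\<forall>x\<in>{0..T}. norm (Q x) \<le> B'"
    using Q unfolding bounded_measurable_on_def bounded_pos by auto
  obtain u where u: "has_ac_derivative T u (\<lambda>s. (- (\<Sigma> s ** snd (u s)), - (Q s ** fst (u s))))" "u T = (mat 1, Q T)"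
  proof (rule lipschitz_terminal_ode_exists[OF T, of "\<lambda>s w. (- (\<Sigma> s ** snd w), - (Q s ** fst w))" "B + B'" "(mat 1, Q T)"])
    fix s and x y :: "(real^'n^'n) \<times> (real^'n^'n)" assume s: "s \<in> {0..T}"
    have "(- (\<Sigma> s ** snd x), - (Q s ** fst x)) - (- (\<Sigma> s ** snd y), - (Q s ** fst y))
        = (- (\<Sigma> s ** snd (x - y)), - (Q s ** fst (x - y)))"
      by (simp add: bounded_bilinear.diff_right[OF bounded_bilinear_matrix_mult])
    also have "norm \<dots> \<le> norm (\<Sigma> s ** snd (x - y)) + norm (Q s ** fst (x - y))"
      using norm_Pair_le[of "- (\<Sigma> s ** snd (x - y))" "- (Q s ** fst (x - y))"] by simp
    also have "\<dots> \<le> B * norm (x - y) + B' * norm (x - y)"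
    proof (intro add_mono order_trans[OF norm_matrix_mult_le] mult_mono)
      show "norm (snd (x - y)) \<le> norm (x - y)" "norm (fst (x - y)) \<le> norm (x - y)"
        by (metis norm_snd_le prod.collapse) (metis norm_fst_le prod.collapse)
    qed (use s B B' in auto)
    finally show "norm ((- (\<Sigma> s ** snd x), - (Q s ** fst x)) - (- (\<Sigma> s ** snd y), - (Q s ** fst y))) \<le> (B + B') * norm (x - y)"
      by (simp add: algebra_simps)
  next
    fix y :: "real \<Rightarrow> (real^'n^'n) \<times> (real^'n^'n)" assume "continuous_on {0..T} y"
    then have "bounded_measurable_on {0..T} y" by (rule bounded_measurable_on_continuous)
    then show "bounded_measurable_on {0..T} (\<lambda>s. (- (\<Sigma> s ** snd (y s)), - (Q s ** fst (y s))))"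
      by (intro bounded_measurable_on_Pair bounded_measurable_on_minus bounded_measurable_on_matrix_mult \<Sigma> Q
          bounded_measurable_on_linear[OF bounded_linear_fst] bounded_measurable_on_linear[OF bounded_linear_snd])
  qed
  define Y where "Y s = fst (u s)" for s
  define Z where "Z s = snd (u s)" for s
  have dY: "has_ac_derivative T Y (\<lambda>s. - (\<Sigma> s ** Z s))"
    using has_ac_derivative_linear[OF bounded_linear_fst u(1)] unfolding Y_def Z_def by simp
  have dZ: "has_ac_derivative T Z (\<lambda>s. - (Q s ** Y s))"
    using has_ac_derivative_linear[OF bounded_linear_snd u(1)] unfolding Y_def Z_def by simp
  have YT: "Y T = mat 1" and ZT: "Z T = Q T" using u(2) unfolding Y_def Z_def by auto
  define g where "g s = - (transpose (Z s) ** \<Sigma> s ** Z s) - transpose (Y s) ** Q s ** Y s" for s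
  have dM: "has_ac_derivative T (\<lambda>s. transpose (Y s) ** Z s) g"
    by (rule has_ac_derivative_cong[OF has_ac_derivative_bilinear[OF bounded_bilinear_matrix_mult
        has_ac_derivative_linear[OF bounded_linear_transpose dY] dZ]])
      (auto simp: g_def transpose_add_minus matrix_mult_minus matrix_transpose_mul \<Sigma>_sym matrix_mul_assoc)
  have g_sym: "transpose (g s) = g s" if "s \<in> {0..T}" for s
    unfolding g_def using that by (simp add: transpose_add_minus matrix_transpose_mul \<Sigma>_sym Q_sym matrix_mul_assoc)
  have M_sym: "transpose (Y s) ** Z s = transpose (Z s) ** Y s" if s: "s \<in> {0..T}" for s
  proof -
    have dM': "has_ac_derivative T (\<lambda>s. transpose (Z s) ** Y s) g"
      by (rule has_ac_derivative_cong[OF has_ac_derivative_linear[OF bounded_linear_transpose dM]])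
        (auto simp: g_sym matrix_transpose_mul)
    have "transpose (Y T) ** Z T - transpose (Y s) ** Z s = transpose (Z T) ** Y T - transpose (Z s) ** Y s"
      using dM dM' s unfolding has_ac_derivative_def by auto
    then show ?thesis using T by (simp add: YT ZT transpose_mat Q_sym)
  qed
  have M_pos: "c * (norm x)\<^sup>2 \<le> (Y s *v x) \<bullet> (Z s *v x)" if s: "s \<in> {0..T}" for s x
  proof -
    have bl: "bounded_linear (\<lambda>M. x \<bullet> (M *v x))"
      by (rule bounded_linear_compose[OF bounded_linear_inner_right
          bounded_bilinear.bounded_linear_left[OF bounded_bilinear_matrix_vector_mult]])
    have e: "x \<bullet> ((transpose (Y s) ** Z s) *v x) = (Y s *v x) \<bullet> (Z s *v x)" for s
      unfolding matrix_vector_mul_assoc[symmetric] inner_matrix_vector_transpose[of x "transpose (Y s)"]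
        transpose_transpose ..
    have "has_ac_derivative T (\<lambda>s. (Y s *v x) \<bullet> (Z s *v x)) (\<lambda>s. x \<bullet> (g s *v x))"
      using has_ac_derivative_linear[OF bl dM] unfolding e .
    then have "(Y T *v x) \<bullet> (Z T *v x) - (Y s *v x) \<bullet> (Z s *v x) = integral {s..T} (\<lambda>s. x \<bullet> (g s *v x))"
      and bg: "bounded_measurable_on {0..T} (\<lambda>s. x \<bullet> (g s *v x))"
      using s unfolding has_ac_derivative_def by auto
    moreover have "integral {s..T} (\<lambda>s. x \<bullet> (g s *v x)) \<le> integral {s..T} (\<lambda>s. 0)"
    proof (rule integral_le)
      show "(\<lambda>s. x \<bullet> (g s *v x)) integrable_on {s..T}"
        using s by (intro bounded_measurable_on_imp_integrable[OF bg]) auto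
      fix r assume "r \<in> {s..T}"
      then have r: "r \<in> {0..T}" using s by auto
      have "x \<bullet> (g r *v x) = - ((Z r *v x) \<bullet> (\<Sigma> r *v (Z r *v x))) - (Y r *v x) \<bullet> (Q r *v (Y r *v x))"
        unfolding g_def matrix_vector_mult_diff_rdistrib matrix_vector_mult_minus_left inner_diff_right
          inner_minus_right matrix_vector_mul_assoc[symmetric]
          inner_matrix_vector_transpose[of x "transpose (Z r)"]
          inner_matrix_vector_transpose[of x "transpose (Y r)"] transpose_transpose ..
      then show "x \<bullet> (g r *v x) \<le> 0" using \<Sigma>_pos[OF r, of "Z r *v x"] Q_pos[OF r, of "Y r *v x"] by linarith
    qed (rule integrable_0)
    ultimately show ?thesis using QT[of x] by (simp add: YT ZT)
  qed
  have inv: "invertible (Y s)" if s: "s \<in> {0..T}" for s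
  proof -
    have "x = 0" if "Y s *v x = 0" for x
      using M_pos[OF s, of x] c that by (simp add: mult_le_0_iff)
    then have "\<exists>P. P ** Y s = mat 1" using matrix_left_invertible_ker by blast
    then show ?thesis unfolding invertible_def using matrix_left_right_inverse by blast
  qed
  define P where "P s = matrix_inv (Y s)" for s
  have PY: "P s ** Y s = mat 1" and YP: "Y s ** P s = mat 1" if "s \<in> {0..T}" for s
    unfolding P_def using matrix_inv_mult[OF inv[OF that]] by blast+
  obtain BY where BY: "BY > 0" "\<forall>x\<in>{0..T}. norm (Y x) \<le> BY"
    using has_ac_derivative_bounded_measurable[OF dY] unfolding bounded_measurable_on_def bounded_pos by auto
  obtain BZ where BZ: "BZ > 0" "\<forall>x\<in>{0..T}. norm (Z x) \<le> BZ"
    using has_ac_derivative_bounded_measurable[OF dZ] unfolding bounded_measurable_on_def bounded_pos by auto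
  have YPv: "Y s *v (P s *v y) = y" if "s \<in> {0..T}" for s y
    using YP[OF that] by (simp add: matrix_vector_mul_assoc)
  have P_bound: "norm (P s *v y) \<le> BZ / c * norm y" if s: "s \<in> {0..T}" for s y
  proof -
    let ?x = "P s *v y"
    have "c * (norm ?x)\<^sup>2 \<le> y \<bullet> (Z s *v ?x)" using M_pos[OF s, of ?x] YPv[OF s] by simp
    also have "\<dots> \<le> norm y * (norm (Z s) * norm ?x)"
      by (rule order_trans[OF norm_cauchy_schwarz]) (intro mult_left_mono norm_matrix_vector_mult_le norm_ge_zero)
    also have "\<dots> \<le> norm y * (BZ * norm ?x)" using BZ s by (intro mult_left_mono mult_right_mono) auto
    finally have "norm ?x * (c * norm ?x) \<le> norm ?x * (BZ * norm y)" by (simp add: power2_eq_square mult_ac)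
    then have "norm ?x = 0 \<or> c * norm ?x \<le> BZ * norm y"
      by (metis mult_le_cancel_left_pos norm_ge_zero order_le_less)
    then show ?thesis using c BZ(1) by (auto simp: field_simps)
  qed
  have P_norm: "norm (P s) \<le> real CARD('n) * (real CARD('n) * (BZ / c))" if "s \<in> {0..T}" for s
    by (rule norm_le_of_operator_bound[OF P_bound[OF that]])
  have dP: "has_ac_derivative T P (\<lambda>s. - (P s ** - (\<Sigma> s ** Z s) ** P s))"
    by (rule has_ac_derivative_matrix_inverse[OF dY PY YP P_norm])
  define V where "V s = Z s ** P s" for s
  show thesis
  proof
    show "has_ac_derivative T V (\<lambda>s. V s ** \<Sigma> s ** V s - Q s)"
    proof (rule has_ac_derivative_cong[OF has_ac_derivative_bilinear[OF bounded_bilinear_matrix_mult dZ dP]])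
      fix s assume s: "s \<in> {0..T}"
      have "Q s ** Y s ** P s = Q s" using YP[OF s] by (simp add: matrix_mul_assoc[symmetric])
      then show "- (Q s ** Y s) ** P s + Z s ** - (P s ** - (\<Sigma> s ** Z s) ** P s) = V s ** \<Sigma> s ** V s - Q s"
        unfolding V_def by (simp add: matrix_mult_minus matrix_mul_assoc)
    qed (simp add: V_def)
    have "P T = mat 1" using PY[of T] YT T by simp
    then show "V T = Q T" by (simp add: V_def ZT)
    show "transpose (V s) = V s" if s: "s \<in> {0..T}" for s
    proof -
      have "V s = transpose (Y s ** P s) ** Z s ** P s" unfolding V_def YP[OF s] by (simp add: transpose_mat)
      also have "\<dots> = transpose (P s) ** (transpose (Y s) ** Z s) ** P s"
        by (simp add: matrix_transpose_mul matrix_mul_assoc)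
      finally have V: "V s = transpose (P s) ** (transpose (Y s) ** Z s) ** P s" .
      show ?thesis unfolding V
        by (simp add: matrix_transpose_mul M_sym[OF s] matrix_mul_assoc)
    qed
    show "0 < c / BY\<^sup>2" using c BY by simp
    fix s x assume s: "s \<in> {0..T}"
    let ?w = "P s *v x"
    have "norm x \<le> BY * norm ?w"
      using norm_matrix_vector_mult_le[of "Y s" ?w] YPv[OF s, of x] BY s
      by (smt (verit) mult_right_mono norm_ge_zero)
    then have "(norm x)\<^sup>2 \<le> BY\<^sup>2 * (norm ?w)\<^sup>2" by (metis norm_ge_zero power_mono power_mult_distrib)
    then have "c / BY\<^sup>2 * (norm x)\<^sup>2 \<le> c * (norm ?w)\<^sup>2" using c BY by (simp add: field_simps)
    also have "\<dots> \<le> (Y s *v ?w) \<bullet> (Z s *v ?w)" by (rule M_pos[OF s])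
    also have "\<dots> = x \<bullet> (V s *v x)" by (simp add: YPv[OF s] V_def flip: matrix_vector_mul_assoc)
    finally show "c / BY\<^sup>2 * (norm x)\<^sup>2 \<le> x \<bullet> (V s *v x)" .
  qed
qed


lemma has_ac_derivative_imp_ac_terminal_solution:
  assumes "has_ac_derivative T y f" "y T = yT"
  shows "ac_terminal_solution T y f yT"
  unfolding ac_terminal_solution_def
proof (intro conjI ballI)
  have bf: "bounded_measurable_on {0..T} f" using assms(1) unfolding has_ac_derivative_def by blast
  show "set_integrable lebesgue {0..T} f"
    by (rule bounded_measurable_on_imp_absolutely_integrable[OF bf]) simp
  fix t assume t: "t \<in> {0..T}"
  have "f absolutely_integrable_on {t..T}"
    using t by (intro bounded_measurable_on_imp_absolutely_integrable[OF bf]) auto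
  then have "(LINT s:{t..T}|lebesgue. f s) = integral {t..T} f"
    by (rule set_lebesgue_integral_eq_integral)
  moreover have "y T - y t = integral {t..T} f" using assms(1) t unfolding has_ac_derivative_def by auto
  ultimately show "y t = yT - (LINT s:{t..T}|lebesgue. f s)"
    using assms(2) by (simp add: algebra_simps flip: \<open>y T - y t = integral {t..T} f\<close>)
qed

lemma ac_terminal_solution_integral:
  assumes "ac_terminal_solution T y f yT" and t: "t \<in> {0..T}"
  shows "f integrable_on {t..T}" "y t = yT - integral {t..T} f"
proof -
  have "f absolutely_integrable_on {0..T}" using assms unfolding ac_terminal_solution_def by blast
  then have "f absolutely_integrable_on {t..T}"
    by (rule set_integrable_subset) (use t in auto)
  note i = set_lebesgue_integral_eq_integral[OF this]
  show "f integrable_on {t..T}" by (rule i(1))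
  show "y t = yT - integral {t..T} f" using assms unfolding ac_terminal_solution_def i(2)[symmetric] by auto
qed

lemma ac_terminal_solution_continuous:
  assumes "ac_terminal_solution T y f yT"
  shows "continuous_on {0..T} y"
proof (cases "0 \<le> T")
  case True
  have "continuous_on {0..T} (\<lambda>t. yT - integral {t..T} f)"
    using ac_terminal_solution_integral(1)[OF assms, of 0] True
    by (intro continuous_intros indefinite_integral_continuous_1') auto
  then show ?thesis
    by (rule continuous_on_eq) (use ac_terminal_solution_integral(2)[OF assms] in auto)
qed simp

text \<open>Competing solutions are only known to be absolutely continuous, so that their right-hand sides are
compared along the two given solutions, where continuity supplies the Lipschitz constant.\<close>

lemma ac_terminal_solution_unique:
  assumes y: "ac_terminal_solution T y f yT" and y': "ac_terminal_solution T y' f' yT"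
    and L: "0 < L" and lip: "\<And>s. s \<in> {0..T} \<Longrightarrow> norm (f s - f' s) \<le> L * norm (y s - y' s)"
    and t: "t \<in> {0..T}"
  shows "y t = y' t"
proof -
  have c: "continuous_on {0..T} (\<lambda>s. norm (y s - y' s))"
    by (intro continuous_intros ac_terminal_solution_continuous[OF y] ac_terminal_solution_continuous[OF y'])
  have "norm (y t - y' t) = 0"
  proof (rule gronwall_terminal[OF L c _ _ t])
    fix t assume t: "t \<in> {0..T}"
    note i = ac_terminal_solution_integral[OF y t] and i' = ac_terminal_solution_integral[OF y' t]
    have "y t - y' t = - integral {t..T} (\<lambda>s. f s - f' s)"
      unfolding i(2) i'(2) Henstock_Kurzweil_Integration.integral_diff[OF i(1) i'(1)] by simp
    then have "norm (y t - y' t) = norm (integral {t..T} (\<lambda>s. f s - f' s))" by simp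
    also have "\<dots> \<le> integral {t..T} (\<lambda>s. L * norm (y s - y' s))"
    proof (rule integral_norm_bound_integral)
      show "(\<lambda>s. f s - f' s) integrable_on {t..T}" by (intro integrable_diff i i')
      show "(\<lambda>s. L * norm (y s - y' s)) integrable_on {t..T}"
        using t by (intro integrable_continuous_interval continuous_intros continuous_on_subset[OF c]) auto
      show "norm (f s - f' s) \<le> L * norm (y s - y' s)" if "s \<in> {t..T}" for s
        using lip that t by auto
    qed
    finally show "norm (y t - y' t) \<le> integral {t..T} (\<lambda>s. L * norm (y s - y' s))" .
  qed simp
  then show ?thesis by simp
qed

text \<open>The system is triangular: \<open>V\<close> is determined by its own equation, whose right-hand side is Lipschitz on
bounded sets, then \<open>b\<close> by a linear equation, then \<open>\<gamma>\<close> by an integral.\<close>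

lemma riccati_system_unique:
  fixes \<Sigma> Q :: "real \<Rightarrow> real^'n^'n"
  assumes \<Sigma>: "bounded_measurable_on {0..T} \<Sigma>"
    and 1: "riccati_system T \<Sigma> Q z V b \<gamma>" and 2: "riccati_system T \<Sigma> Q z V' b' \<gamma>'"
    and t: "t \<in> {0..T}"
  shows "V' t = V t \<and> b' t = b t \<and> \<gamma>' t = \<gamma> t"
proof -
  note s1 = 1[unfolded riccati_system_def] and s2 = 2[unfolded riccati_system_def]
  obtain B where B: "B > 0" "\<forall>x\<in>{0..T}. norm (\<Sigma> x) \<le> B"
    using \<Sigma> unfolding bounded_measurable_on_def bounded_pos by auto
  have "bounded_measurable_on {0..T} V" "bounded_measurable_on {0..T} V'"
    using s1 s2 ac_terminal_solution_continuous bounded_measurable_on_continuous by blast+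
  then obtain K K' where K: "K > 0" "\<forall>x\<in>{0..T}. norm (V x) \<le> K" "K' > 0" "\<forall>x\<in>{0..T}. norm (V' x) \<le> K'"
    unfolding bounded_measurable_on_def bounded_pos by auto
  note dl = bounded_bilinear.diff_left[OF bounded_bilinear_matrix_mult]
    and dr = bounded_bilinear.diff_right[OF bounded_bilinear_matrix_mult]
  have V: "V' t = V t" if t: "t \<in> {0..T}" for t
  proof (rule ac_terminal_solution_unique[OF _ _ _ _ t])
    show "0 < K' * B + B * K" using K B by (simp add: add_pos_pos)
    fix s assume s: "s \<in> {0..T}"
    have "V' s ** \<Sigma> s ** V' s - Q s - (V s ** \<Sigma> s ** V s - Q s)
       = (V' s ** \<Sigma> s) ** (V' s - V s) + (V' s - V s) ** (\<Sigma> s ** V s)"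
      by (simp add: dl dr matrix_mul_assoc)
    also have "norm \<dots> \<le> (K' * B) * norm (V' s - V s) + norm (V' s - V s) * (B * K)"
      by (intro norm_triangle_le add_mono order_trans[OF norm_matrix_mult_le] mult_mono)
        (use s B K in auto)
    finally show "norm (V' s ** \<Sigma> s ** V' s - Q s - (V s ** \<Sigma> s ** V s - Q s)) \<le> (K' * B + B * K) * norm (V' s - V s)"
      by (simp add: algebra_simps)
  qed (use s1 s2 in blast)+
  have b: "b' t = b t" if t: "t \<in> {0..T}" for t
  proof (rule ac_terminal_solution_unique[OF _ _ _ _ t])
    show "0 < K * B" using K B by simp
    fix s assume s: "s \<in> {0..T}"
    have "(V' s ** \<Sigma> s) *v b' s - z s - ((V s ** \<Sigma> s) *v b s - z s) = (V s ** \<Sigma> s) *v (b' s - b s)"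
      by (simp add: V[OF s] matrix_vector_mult_diff_distrib)
    also have "norm \<dots> \<le> (K * B) * norm (b' s - b s)"
      by (intro order_trans[OF norm_matrix_vector_mult_le] mult_right_mono
          order_trans[OF norm_matrix_mult_le] mult_mono) (use s B K in auto)
    finally show "norm ((V' s ** \<Sigma> s) *v b' s - z s - ((V s ** \<Sigma> s) *v b s - z s)) \<le> K * B * norm (b' s - b s)" .
  qed (use s1 s2 in blast)+
  have "2 * \<gamma>' t = 2 * \<gamma> t"
  proof (rule ac_terminal_solution_unique[OF _ _ _ _ t, where L = 1])
    fix s assume s: "s \<in> {0..T}"
    show "norm (b' s \<bullet> (\<Sigma> s *v b' s) - trace (V' s ** \<Sigma> s) - (b s \<bullet> (\<Sigma> s *v b s) - trace (V s ** \<Sigma> s)))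
        \<le> 1 * norm (2 * \<gamma>' s - 2 * \<gamma> s)" by (simp add: V[OF s] b[OF s])
  qed (use s1 s2 in auto)
  then show ?thesis using V[OF t] b[OF t] by simp
qed

lemma riccati_system_exists:
  fixes \<Sigma> Q :: "real \<Rightarrow> real^'n^'n" and z :: "real \<Rightarrow> real^'n"
  assumes T: "0 \<le> T" and \<Sigma>: "bounded_measurable_on {0..T} \<Sigma>" and Q: "bounded_measurable_on {0..T} Q"
    and z: "bounded_measurable_on {0..T} z"
    and \<Sigma>_sym: "\<And>s. s \<in> {0..T} \<Longrightarrow> transpose (\<Sigma> s) = \<Sigma> s"
    and \<Sigma>_pos: "\<And>s x. s \<in> {0..T} \<Longrightarrow> 0 \<le> x \<bullet> (\<Sigma> s *v x)"
    and Q_sym: "\<And>s. s \<in> {0..T} \<Longrightarrow> transpose (Q s) = Q s"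
    and Q_pos: "\<And>s x. s \<in> {0..T} \<Longrightarrow> 0 \<le> x \<bullet> (Q s *v x)"
    and c: "0 < c" and QT: "\<And>x. c * (norm x)\<^sup>2 \<le> x \<bullet> (Q T *v x)"
  obtains V b \<gamma> c' where
    "has_ac_derivative T V (\<lambda>s. V s ** \<Sigma> s ** V s - Q s)" "V T = Q T"
    "has_ac_derivative T b (\<lambda>s. (V s ** \<Sigma> s) *v b s - z s)" "b T = z T"
    "has_ac_derivative T \<gamma> (\<lambda>s. 1/2 * (b s \<bullet> (\<Sigma> s *v b s) - trace (V s ** \<Sigma> s)))" "\<gamma> T = 0"
    "\<And>s. s \<in> {0..T} \<Longrightarrow> transpose (V s) = V s"
    "0 < c'" "\<And>s x. s \<in> {0..T} \<Longrightarrow> c' * (norm x)\<^sup>2 \<le> x \<bullet> (V s *v x)"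
    "riccati_system T \<Sigma> Q z V b \<gamma>"
proof -
  obtain V c' where V: "has_ac_derivative T V (\<lambda>s. V s ** \<Sigma> s ** V s - Q s)" "V T = Q T"
    "\<And>s. s \<in> {0..T} \<Longrightarrow> transpose (V s) = V s"
    "0 < c'" "\<And>s x. s \<in> {0..T} \<Longrightarrow> c' * (norm x)\<^sup>2 \<le> x \<bullet> (V s *v x)"
    using riccati_matrix_solution_exists[OF T \<Sigma> Q \<Sigma>_sym \<Sigma>_pos Q_sym Q_pos c QT] by blast
  note bV = has_ac_derivative_bounded_measurable[OF V(1)]
  have bVS: "bounded_measurable_on {0..T} (\<lambda>s. V s ** \<Sigma> s)"
    by (intro bounded_measurable_on_matrix_mult bV \<Sigma>)
  then obtain L where L: "\<forall>s\<in>{0..T}. norm (V s ** \<Sigma> s) \<le> L"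
    unfolding bounded_measurable_on_def bounded_pos by auto
  obtain b where b: "has_ac_derivative T b (\<lambda>s. (V s ** \<Sigma> s) *v b s - z s)" "b T = z T"
  proof (rule lipschitz_terminal_ode_exists[OF T, of "\<lambda>s x. (V s ** \<Sigma> s) *v x - z s" L "z T"])
    fix s and x y :: "real^'n" assume s: "s \<in> {0..T}"
    show "norm ((V s ** \<Sigma> s) *v x - z s - ((V s ** \<Sigma> s) *v y - z s)) \<le> L * norm (x - y)"
      using order_trans[OF norm_matrix_vector_mult_le mult_right_mono[OF L[rule_format, OF s] norm_ge_zero]]
      by (simp add: matrix_vector_mult_diff_distrib[symmetric])
  next
    fix y :: "real \<Rightarrow> real^'n" assume "continuous_on {0..T} y"
    then have "bounded_measurable_on {0..T} y" by (rule bounded_measurable_on_continuous)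
    then show "bounded_measurable_on {0..T} (\<lambda>s. (V s ** \<Sigma> s) *v y s - z s)"
      by (intro bounded_measurable_on_diff bounded_measurable_on_matrix_vector_mult bVS z)
  qed
  note bb = has_ac_derivative_bounded_measurable[OF b(1)]
  define g where "g s = b s \<bullet> (\<Sigma> s *v b s) - trace (V s ** \<Sigma> s)" for s
  have bg: "bounded_measurable_on {0..T} g" unfolding g_def
    by (intro bounded_measurable_on_diff bounded_measurable_on_inner bounded_measurable_on_matrix_vector_mult
        bounded_measurable_on_linear[OF bounded_linear_trace] bVS bb \<Sigma>)
  define \<gamma> where "\<gamma> t = 0 - integral {t..T} (\<lambda>s. 1/2 * g s)" for t
  have d\<gamma>: "has_ac_derivative T \<gamma> (\<lambda>s. 1/2 * g s)"
    by (rule has_ac_derivative_terminal_integral[OF _ \<gamma>_def])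
      (rule bounded_measurable_on_linear[OF bounded_linear_mult_right bg])
  have \<gamma>T: "\<gamma> T = 0" unfolding \<gamma>_def by simp
  have d2: "has_ac_derivative T (\<lambda>s. 2 * \<gamma> s) g"
    using has_ac_derivative_linear[OF bounded_linear_mult_right[of 2] d\<gamma>] by simp
  have "riccati_system T \<Sigma> Q z V b \<gamma>"
    unfolding riccati_system_def
    using has_ac_derivative_imp_ac_terminal_solution[OF V(1,2)]
      has_ac_derivative_imp_ac_terminal_solution[OF b]
      has_ac_derivative_imp_ac_terminal_solution[OF d2] \<gamma>T unfolding g_def by simp
  then show thesis using that[OF V(1,2) b d\<gamma>[unfolded g_def] \<gamma>T V(3-5)] by blast
qed

section \<open>Independence and step functions\<close>

text \<open>Conditioning on \<open>X\<close> when \<open>Y\<close> is independent of it: Fubini on the joint law, which is a product.\<close>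

lemma (in prob_space) indep_var_expectation:
  fixes g :: "'s \<times> 's \<Rightarrow> real"
  assumes ind: "indep_var S X N Y" and g: "g \<in> borel_measurable (S \<Otimes>\<^sub>M N)"
    and bound: "\<And>x. \<bar>g x\<bar> \<le> C"
  shows "expectation (\<lambda>\<omega>. g (X \<omega>, Y \<omega>)) = expectation (\<lambda>\<omega>. expectation (\<lambda>\<omega>'. g (X \<omega>, Y \<omega>')))"
    and "(\<lambda>\<omega>. expectation (\<lambda>\<omega>'. g (X \<omega>, Y \<omega>'))) \<in> borel_measurable M"
proof -
  note * = ind[unfolded indep_var_distribution_eq]
  then have X [measurable]: "X \<in> measurable M S" and Y [measurable]: "Y \<in> measurable M N"
    and eq: "distr M S X \<Otimes>\<^sub>M distr M N Y = distr M (S \<Otimes>\<^sub>M N) (\<lambda>x. (X x, Y x))" by auto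
  interpret X: prob_space "distr M S X" by (rule prob_space_distr) simp
  interpret Y: prob_space "distr M N Y" by (rule prob_space_distr) simp
  interpret P: pair_prob_space "distr M S X" "distr M N Y" ..
  note g [measurable]
  have gi: "integrable (distr M S X \<Otimes>\<^sub>M distr M N Y) g"
    by (rule P.P.integrable_const_bound[where B=C]) (use bound in auto)
  have inner: "(\<lambda>x. expectation (\<lambda>\<omega>'. g (x, Y \<omega>'))) \<in> borel_measurable S"
    by measurable
  have "expectation (\<lambda>\<omega>. g (X \<omega>, Y \<omega>)) = integral\<^sup>L (distr M S X \<Otimes>\<^sub>M distr M N Y) g"
    unfolding eq by (subst integral_distr) auto
  also have "\<dots> = (\<integral>x. (\<integral>y. g (x, y) \<partial>distr M N Y) \<partial>distr M S X)"
    by (rule P.integral_fst'[OF gi, symmetric])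
  also have "\<dots> = (\<integral>x. expectation (\<lambda>\<omega>'. g (x, Y \<omega>')) \<partial>distr M S X)"
  proof (rule Bochner_Integration.integral_cong[OF refl])
    fix x assume "x \<in> space (distr M S X)"
    then have [measurable]: "x \<in> space S" by simp
    show "(\<integral>y. g (x, y) \<partial>distr M N Y) = expectation (\<lambda>\<omega>'. g (x, Y \<omega>'))"
      by (subst integral_distr) auto
  qed
  also have "\<dots> = expectation (\<lambda>\<omega>. expectation (\<lambda>\<omega>'. g (X \<omega>, Y \<omega>')))"
    by (subst integral_distr) (use inner in auto)
  finally show "expectation (\<lambda>\<omega>. g (X \<omega>, Y \<omega>)) = expectation (\<lambda>\<omega>. expectation (\<lambda>\<omega>'. g (X \<omega>, Y \<omega>')))" .
  show "(\<lambda>\<omega>. expectation (\<lambda>\<omega>'. g (X \<omega>, Y \<omega>'))) \<in> borel_measurable M"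
    using measurable_compose[OF X inner] .
qed

lemma borel_measurable_vec_nth [measurable (raw)]:
  "f \<in> borel_measurable M \<Longrightarrow> (\<lambda>x. (f x :: real^'n) $ i) \<in> borel_measurable M"
  by (rule borel_measurable_continuous_on[where f="\<lambda>x. x $ i"]) (auto intro!: continuous_intros)

lemma borel_measurable_matrix_vector_mult [measurable (raw)]:
  "f \<in> borel_measurable M \<Longrightarrow> (\<lambda>x. (A :: real^'n^'m) *v f x) \<in> borel_measurable M"
  by (rule borel_measurable_continuous_on[where f="\<lambda>x. A *v x"])
    (auto intro!: linear_continuous_on bounded_bilinear.bounded_linear_right[OF bounded_bilinear_matrix_vector_mult])

lemma is_partition_nonneg:
  assumes "is_partition s t n \<tau>" "0 \<le> s" "i \<le> n"
  shows "0 \<le> \<tau> i"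
  using assms(3)
proof (induction i)
  case (Suc i)
  then have "\<tau> i \<le> \<tau> (Suc i)" using assms(1) unfolding is_partition_def by auto
  then show ?case using Suc by simp
qed (use assms in \<open>simp add: is_partition_def\<close>)

lemma is_partition_mono:
  assumes "is_partition s t n \<tau>" "i \<le> j" "j \<le> n"
  shows "\<tau> i \<le> \<tau> j"
  using assms(2,3)
proof (induction j rule: dec_induct)
  case (step j)
  have "\<tau> j \<le> \<tau> (Suc j)" using assms(1) step(2,4) unfolding is_partition_def by auto
  moreover have "\<tau> i \<le> \<tau> j" using step by simp
  ultimately show ?case by simp
qed simp

text \<open>Elementary integrals on different partitions are compared through their step functions on the whole
line, which is possible since these vanish off the time interval.\<close>

lemma step_function_eq_0:
  assumes p: "is_partition s t n \<tau>" and r: "r \<notin> {s<..t}"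
  shows "step_function n \<tau> A r = 0"
proof -
  have "indicator {\<tau> i<..\<tau> (Suc i)} r = (0 :: real)" if "i < n" for i
    using is_partition_mono[OF p, of 0 i] is_partition_mono[OF p, of "Suc i" n] that r p
    unfolding is_partition_def by (auto simp: indicator_def)
  then show ?thesis unfolding step_function_def by simp
qed

lemma borel_measurable_step_function [measurable]:
  fixes A :: "nat \<Rightarrow> 'z::euclidean_space"
  shows "step_function n \<tau> A \<in> borel_measurable borel"
  unfolding step_function_def
  by (intro borel_measurable_sum borel_measurable_scaleR borel_measurable_indicator borel_measurable_const) simp

lemma indicator_product_integrable:
  fixes a b c d :: real
  shows "integrable lborel (\<lambda>r. indicator {a<..b} r * indicator {c<..d} r :: real)"
proof -
  have "(\<lambda>r. indicator {a<..b} r * indicator {c<..d} r) = (indicator {max a c<..min b d} :: real \<Rightarrow> real)"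
    by (auto simp: fun_eq_iff split: split_indicator)
  then show ?thesis by (cases "max a c \<le> min b d") auto
qed

lemma ennreal_norm_diff_sq_le:
  "ennreal ((norm (a - b))\<^sup>2) \<le> 2 * ennreal ((norm (a - c))\<^sup>2) + 2 * ennreal ((norm (b - c))\<^sup>2)"
  for a b c :: "'z::real_normed_vector"
proof -
  have "norm (a - b) \<le> norm (a - c) + norm (b - c)"
    using norm_triangle_ineq4[of "a - c" "b - c"] by simp
  then have "(norm (a - b))\<^sup>2 \<le> (norm (a - c) + norm (b - c))\<^sup>2" by (intro power_mono) auto
  also have "\<dots> \<le> 2 * (norm (a - c))\<^sup>2 + 2 * (norm (b - c))\<^sup>2"
    using sum_squares_bound[of "norm (a - c)" "norm (b - c)"] by (simp add: power2_sum)
  finally have "ennreal ((norm (a - b))\<^sup>2) \<le> ennreal (2 * (norm (a - c))\<^sup>2 + 2 * (norm (b - c))\<^sup>2)"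
    by (rule ennreal_leI)
  then show ?thesis by (simp add: ennreal_plus ennreal_mult)
qed

lemma partition_indicator_sum:
  assumes p: "is_partition s t n \<tau>" and "k \<le> n"
  shows "(\<Sum>i<k. indicator {\<tau> i<..\<tau> (Suc i)} r) = (indicator {s<..\<tau> k} r :: real)"
  using assms(2)
proof (induction k)
  case 0
  then show ?case using p by (simp add: is_partition_def)
next
  case (Suc k)
  have "s \<le> \<tau> k" "\<tau> k \<le> \<tau> (Suc k)"
    using is_partition_mono[OF p, of 0 k] is_partition_mono[OF p, of k "Suc k"] Suc.prems p
    by (auto simp: is_partition_def)
  then have "indicator {s<..\<tau> (Suc k)} r = (indicator {s<..\<tau> k} r + indicator {\<tau> k<..\<tau> (Suc k)} r :: real)"
    by (auto split: split_indicator)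
  then show ?case using Suc by simp
qed

lemma step_function_norm_le:
  fixes A :: "nat \<Rightarrow> 'z::real_normed_vector"
  assumes p: "is_partition s t n \<tau>" and A: "\<And>k. norm (A k) \<le> B"
  shows "norm (step_function n \<tau> A r) \<le> B"
proof -
  have B: "0 \<le> B" using A[of 0] norm_ge_zero order_trans by blast
  have "norm (step_function n \<tau> A r) \<le> (\<Sum>i<n. indicator {\<tau> i<..\<tau> (Suc i)} r * B)"
    unfolding step_function_def by (intro order_trans[OF norm_sum] sum_mono) (simp add: A mult_left_mono)
  also have "\<dots> = indicator {s<..\<tau> n} r * B"
    by (simp add: partition_indicator_sum[OF p] flip: sum_distrib_right)
  also have "\<dots> \<le> B" using B by (auto split: split_indicator)
  finally show ?thesis .
qed

section \<open>Brownian increments and the Ito isometry\<close>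

context brownian_motion begin

lemma increment_measurable: "0 \<le> s \<Longrightarrow> 0 \<le> t \<Longrightarrow> (\<lambda>\<omega>. W t \<omega> - W s \<omega>) \<in> borel_measurable M"
  using BM_measurable by (intro borel_measurable_diff) auto

lemma increment_moment:
  assumes "0 \<le> s" "s \<le> t"
  shows "integrable M (\<lambda>\<omega>. ((W t \<omega> - W s \<omega>) $ i) ^ k)"
    and "expectation (\<lambda>\<omega>. (W t \<omega> - W s \<omega>) $ i) = 0"
    and "expectation (\<lambda>\<omega>. ((W t \<omega> - W s \<omega>) $ i)\<^sup>2) = t - s"
    and "expectation (\<lambda>\<omega>. ((W t \<omega> - W s \<omega>) $ i) ^ 4) = 3 * (t - s)\<^sup>2"
proof -
  have "integrable M (\<lambda>\<omega>. ((W t \<omega> - W s \<omega>) $ i) ^ k) \<and>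
    expectation (\<lambda>\<omega>. (W t \<omega> - W s \<omega>) $ i) = 0 \<and>
    expectation (\<lambda>\<omega>. ((W t \<omega> - W s \<omega>) $ i)\<^sup>2) = t - s \<and>
    expectation (\<lambda>\<omega>. ((W t \<omega> - W s \<omega>) $ i) ^ 4) = 3 * (t - s)\<^sup>2"
  proof (cases "s = t")
    case False
    define v where "v = sqrt (t - s)"
    have v: "0 < v" and v2: "v\<^sup>2 = t - s" using False assms by (auto simp: v_def)
    have v4: "v ^ 4 = (t - s)\<^sup>2" using v2 power_mult[of v 2 2] by simp
    have d: "distributed M lborel (\<lambda>\<omega>. (W t \<omega> - W s \<omega>) $ i) (normal_density 0 v)"
      using BM_normal_components[of s t i] False assms by (simp add: v_def)
    have int: "integrable lborel (\<lambda>x. normal_density 0 v x * x ^ k)" for k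
    proof (cases "even k")
      case True
      then obtain j where "k = 2 * j" by auto
      then show ?thesis using normal_moment_even[OF v, of 0 j] by (auto simp: has_bochner_integral_iff)
    next
      case False
      then obtain j where "k = 2 * j + 1" using oddE by blast
      then show ?thesis using normal_moment_odd[OF v, of 0 j] by (auto simp: has_bochner_integral_iff)
    qed
    have E: "expectation (\<lambda>\<omega>. ((W t \<omega> - W s \<omega>) $ i) ^ k) = (\<integral>x. normal_density 0 v x * x ^ k \<partial>lborel)" for k
      by (rule distributed_integral[OF d, symmetric]) auto
    have "integrable M (\<lambda>\<omega>. ((W t \<omega> - W s \<omega>) $ i) ^ k)" for k
      using distributed_integrable[OF d, of "\<lambda>x. x ^ k"] int[of k] by auto
    moreover have "expectation (\<lambda>\<omega>. (W t \<omega> - W s \<omega>) $ i) = 0"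
      using E[of 1] integral_normal_moment_odd[OF v, of 0 0] by simp
    moreover have "expectation (\<lambda>\<omega>. ((W t \<omega> - W s \<omega>) $ i)\<^sup>2) = t - s"
      using E[of 2] integral_normal_moment_even[OF v, of 0 1] v2 by (simp add: fact_numeral)
    moreover have "expectation (\<lambda>\<omega>. ((W t \<omega> - W s \<omega>) $ i) ^ 4) = 3 * v ^ 4"
      unfolding E using integral_normal_moment_even[OF v, of 0 2]
      by (simp add: fact_numeral power_divide power_mult[symmetric])
    ultimately show ?thesis unfolding v4 by blast
  qed (simp add: power_0_left)
  then show "integrable M (\<lambda>\<omega>. ((W t \<omega> - W s \<omega>) $ i) ^ k)"
    and "expectation (\<lambda>\<omega>. (W t \<omega> - W s \<omega>) $ i) = 0"
    and "expectation (\<lambda>\<omega>. ((W t \<omega> - W s \<omega>) $ i)\<^sup>2) = t - s"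
    and "expectation (\<lambda>\<omega>. ((W t \<omega> - W s \<omega>) $ i) ^ 4) = 3 * (t - s)\<^sup>2" by blast+
qed

lemma increment_integrable:
  assumes "0 \<le> s" "s \<le> t"
  shows "integrable M (\<lambda>\<omega>. (W t \<omega> - W s \<omega>) $ i)"
  using increment_moment(1)[OF assms, of i 1] by simp

lemma increment_product_integrable:
  assumes "0 \<le> s" "s \<le> t" "0 \<le> r" "r \<le> u"
  shows "integrable M (\<lambda>\<omega>. (W t \<omega> - W s \<omega>) $ i * (W u \<omega> - W r \<omega>) $ j)"
proof (rule Bochner_Integration.integrable_bound)
  show "integrable M (\<lambda>\<omega>. ((W t \<omega> - W s \<omega>) $ i)\<^sup>2 + ((W u \<omega> - W r \<omega>) $ j)\<^sup>2)"
    using increment_moment(1) assms by (intro Bochner_Integration.integrable_add) auto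
  show "(\<lambda>\<omega>. (W t \<omega> - W s \<omega>) $ i * (W u \<omega> - W r \<omega>) $ j) \<in> borel_measurable M"
    using increment_measurable[of s t] increment_measurable[of r u] assms
    by (intro borel_measurable_times borel_measurable_vec_nth) auto
  have "\<bar>a * b\<bar> \<le> a\<^sup>2 + b\<^sup>2" for a b :: real
    using sum_squares_bound[of "\<bar>a\<bar>" "\<bar>b\<bar>"] mult_nonneg_nonneg[OF abs_ge_zero[of a] abs_ge_zero[of b]]
    unfolding abs_mult power2_abs mult.assoc by linarith
  then show "AE \<omega> in M. norm ((W t \<omega> - W s \<omega>) $ i * (W u \<omega> - W r \<omega>) $ j)
      \<le> norm (((W t \<omega> - W s \<omega>) $ i)\<^sup>2 + ((W u \<omega> - W r \<omega>) $ j)\<^sup>2)" by simp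
qed

lemma increment_covariance:
  assumes "0 \<le> s" "s \<le> t"
  shows "expectation (\<lambda>\<omega>. (W t \<omega> - W s \<omega>) $ i * (W t \<omega> - W s \<omega>) $ j) = (if i = j then t - s else 0)"
proof (cases "i = j \<or> s = t")
  case True
  then show ?thesis using increment_moment(3)[OF assms, of i] by (auto simp: power2_eq_square)
next
  case False
  have "indep_vars (\<lambda>_. borel) (\<lambda>i \<omega>. (W t \<omega> - W s \<omega>) $ i) {i, j}"
    by (rule indep_vars_subset[OF BM_indep_components]) (use False assms in auto)
  from indep_vars_lebesgue_integral[OF _ this] increment_integrable[OF assms]
  have "expectation (\<lambda>\<omega>. \<Prod>i\<in>{i,j}. (W t \<omega> - W s \<omega>) $ i) = (\<Prod>i\<in>{i,j}. expectation (\<lambda>\<omega>. (W t \<omega> - W s \<omega>) $ i))"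
    by blast
  then show ?thesis using False increment_moment(2)[OF assms] by simp
qed

lemma increment_product_disjoint:
  assumes "0 \<le> r" "r \<le> s" "s \<le> t"
  shows "expectation (\<lambda>\<omega>. (W s \<omega> - W r \<omega>) $ i * (W t \<omega> - W s \<omega>) $ j) = 0"
proof -
  \<comment> \<open>The two adjacent intervals as a partition with two cells.\<close>
  define \<tau> where "\<tau> k = (if k = 0 then r else if k = 1 then s else t)" for k :: nat
  have "indep_vars (\<lambda>_. borel) (\<lambda>i \<omega>. W (\<tau> (Suc i)) \<omega> - W (\<tau> i) \<omega>) {..<2}"
    by (rule BM_indep_increments) (use assms in \<open>auto simp: \<tau>_def\<close>)
  then have "indep_vars (\<lambda>_. borel) (\<lambda>k \<omega>. (W (\<tau> (Suc k)) \<omega> - W (\<tau> k) \<omega>) $ (if k = 0 then i else j)) {..<2}"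
    by (rule indep_vars_compose2[where Y="\<lambda>k x. x $ (if k = 0 then i else j)"]) measurable
  from indep_vars_lebesgue_integral[OF _ this]
  have "expectation (\<lambda>\<omega>. \<Prod>k<2. (W (\<tau> (Suc k)) \<omega> - W (\<tau> k) \<omega>) $ (if k = 0 then i else j))
      = (\<Prod>k<2. expectation (\<lambda>\<omega>. (W (\<tau> (Suc k)) \<omega> - W (\<tau> k) \<omega>) $ (if k = 0 then i else j)))"
    using increment_integrable assms by (auto simp: \<tau>_def)
  then show ?thesis
    using increment_moment(2)[of r s i] assms by (simp add: numeral_2_eq_2 \<tau>_def)
qed

lemma covariance:
  assumes "0 \<le> s" "0 \<le> t"
  shows "expectation (\<lambda>\<omega>. (W s \<omega> - W 0 \<omega>) $ i * (W t \<omega> - W 0 \<omega>) $ j) = (if i = j then min s t else 0)"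
proof -
  have *: "expectation (\<lambda>\<omega>. (W s \<omega> - W 0 \<omega>) $ i * (W t \<omega> - W 0 \<omega>) $ j) = (if i = j then s else 0)"
    if "0 \<le> s" "s \<le> t" for s t i j
  proof -
    have "(W s \<omega> - W 0 \<omega>) $ i * (W t \<omega> - W 0 \<omega>) $ j =
        (W s \<omega> - W 0 \<omega>) $ i * (W s \<omega> - W 0 \<omega>) $ j + (W s \<omega> - W 0 \<omega>) $ i * (W t \<omega> - W s \<omega>) $ j" for \<omega>
      by (simp add: algebra_simps)
    then show ?thesis
      using that increment_product_integrable[of 0 s 0 s i j] increment_product_integrable[of 0 s s t i j]
        increment_covariance[of 0 s i j] increment_product_disjoint[of 0 s t i j] by simp
  qed
  show ?thesis
  proof (cases "s \<le> t")
    case True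
    then show ?thesis using *[of s t i j] assms by (simp add: min_def)
  next
    case False
    then show ?thesis using *[of t s j i] assms by (auto simp: min_def mult.commute)
  qed
qed

text \<open>The covariance \<open>min s t\<close> of the path at two times makes the covariance of two increments the length of the
overlap of their time intervals. In this form no ordering of the four endpoints is required.\<close>

lemma increment_product_expectation:
  assumes "0 \<le> a" "a \<le> b" "0 \<le> c" "c \<le> d"
  shows "expectation (\<lambda>\<omega>. (W b \<omega> - W a \<omega>) $ i * (W d \<omega> - W c \<omega>) $ j)
    = (if i = j then (\<integral>r. indicator {a<..b} r * indicator {c<..d} r \<partial>lborel) else 0)"
proof -
  let ?U = "\<lambda>t \<omega>. W t \<omega> - W 0 \<omega>"
  have "(W b \<omega> - W a \<omega>) $ i * (W d \<omega> - W c \<omega>) $ j =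
     (?U b \<omega> $ i * ?U d \<omega> $ j - ?U b \<omega> $ i * ?U c \<omega> $ j) - (?U a \<omega> $ i * ?U d \<omega> $ j - ?U a \<omega> $ i * ?U c \<omega> $ j)" for \<omega>
    by (simp add: algebra_simps)
  then have "expectation (\<lambda>\<omega>. (W b \<omega> - W a \<omega>) $ i * (W d \<omega> - W c \<omega>) $ j)
     = (if i = j then min b d - min b c - (min a d - min a c) else 0)"
    using assms increment_product_integrable[of 0 _ 0 _ i j] by (simp add: covariance[simplified])
  moreover have "(\<integral>r. indicator {a<..b} r * indicator {c<..d} r \<partial>lborel) = min b d - min b c - (min a d - min a c)"
  proof -
    have "(\<lambda>r. indicator {a<..b} r * indicator {c<..d} r) = (indicator {max a c<..min b d} :: real \<Rightarrow> real)"
      by (auto simp: fun_eq_iff split: split_indicator)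
    then have "(\<integral>r. indicator {a<..b} r * indicator {c<..d} r \<partial>lborel) = measure lborel {max a c<..min b d}"
      by simp
    also have "\<dots> = max 0 (min b d - max a c)"
      by (cases "max a c \<le> min b d") auto
    also have "\<dots> = min b d - min b c - (min a d - min a c)"
      using assms by linarith
    finally show ?thesis .
  qed
  ultimately show ?thesis by simp
qed


lemma increment_image_inner:
  fixes A B :: "real^'n^'n"
  assumes "0 \<le> a" "a \<le> b" "0 \<le> c" "c \<le> d"
  shows "integrable M (\<lambda>\<omega>. (A *v (W b \<omega> - W a \<omega>)) \<bullet> (B *v (W d \<omega> - W c \<omega>)))"
    and "expectation (\<lambda>\<omega>. (A *v (W b \<omega> - W a \<omega>)) \<bullet> (B *v (W d \<omega> - W c \<omega>)))
      = (A \<bullet> B) * (\<integral>r. indicator {a<..b} r * indicator {c<..d} r \<partial>lborel)"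
proof -
  let ?k = "\<integral>r. indicator {a<..b} r * indicator {c<..d} r \<partial>lborel :: real"
  have e: "(A *v (W b \<omega> - W a \<omega>)) \<bullet> (B *v (W d \<omega> - W c \<omega>)) =
     (\<Sum>l\<in>UNIV. \<Sum>i\<in>UNIV. \<Sum>j\<in>UNIV. (A $ l $ i * B $ l $ j) * ((W b \<omega> - W a \<omega>) $ i * (W d \<omega> - W c \<omega>) $ j))" for \<omega>
    unfolding inner_vec_def inner_real_def matrix_vector_mult_def vec_lambda_beta sum_product
    by (intro sum.cong refl) (simp only: mult_ac)
  note int = integrable_mult_right[OF increment_product_integrable[OF assms]]
  show "integrable M (\<lambda>\<omega>. (A *v (W b \<omega> - W a \<omega>)) \<bullet> (B *v (W d \<omega> - W c \<omega>)))"
    unfolding e by (intro Bochner_Integration.integrable_sum int)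
  have "expectation (\<lambda>\<omega>. (A *v (W b \<omega> - W a \<omega>)) \<bullet> (B *v (W d \<omega> - W c \<omega>)))
     = (\<Sum>l\<in>UNIV. \<Sum>i\<in>UNIV. \<Sum>j\<in>UNIV. (A $ l $ i * B $ l $ j) * (if i = j then ?k else 0))"
    unfolding e
    by (simp only: Bochner_Integration.integral_sum Bochner_Integration.integrable_sum int
        integral_mult_right_zero increment_product_expectation[OF assms])
  also have "\<dots> = (A \<bullet> B) * ?k"
    by (simp add: inner_vec_def sum_distrib_right if_distrib[of "\<lambda>x. _ * x"] cong: if_cong)
  finally show "expectation (\<lambda>\<omega>. (A *v (W b \<omega> - W a \<omega>)) \<bullet> (B *v (W d \<omega> - W c \<omega>))) = (A \<bullet> B) * ?k" .
qed

text \<open>The Ito isometry in polarised form. Both sides expand over all pairs of intervals with the same Gram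
matrix of overlaps, so that the two partitions need no common refinement.\<close>

lemma elementary_integral_inner:
  fixes A B :: "nat \<Rightarrow> real^'n^'n"
  assumes p: "is_partition s t n \<tau>" "0 \<le> s" and q: "is_partition s' t' m \<upsilon>" "0 \<le> s'"
  shows "integrable M (\<lambda>\<omega>. elementary_integral W n \<tau> A \<omega> \<bullet> elementary_integral W m \<upsilon> B \<omega>)"
    and "integrable lborel (\<lambda>r. step_function n \<tau> A r \<bullet> step_function m \<upsilon> B r)"
    and "expectation (\<lambda>\<omega>. elementary_integral W n \<tau> A \<omega> \<bullet> elementary_integral W m \<upsilon> B \<omega>)
      = (\<integral>r. step_function n \<tau> A r \<bullet> step_function m \<upsilon> B r \<partial>lborel)"
proof -
  have e1: "elementary_integral W n \<tau> A \<omega> \<bullet> elementary_integral W m \<upsilon> B \<omega> =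
    (\<Sum>i<n. \<Sum>j<m. (A i *v (W (\<tau> (Suc i)) \<omega> - W (\<tau> i) \<omega>)) \<bullet> (B j *v (W (\<upsilon> (Suc j)) \<omega> - W (\<upsilon> j) \<omega>)))" for \<omega>
    unfolding elementary_integral_def inner_sum_left inner_sum_right by (rule sum.swap)
  have e2: "step_function n \<tau> A r \<bullet> step_function m \<upsilon> B r =
    (\<Sum>i<n. \<Sum>j<m. (A i \<bullet> B j) * (indicator {\<tau> i<..\<tau> (Suc i)} r * indicator {\<upsilon> j<..\<upsilon> (Suc j)} r))" for r
    unfolding step_function_def inner_sum_left inner_sum_right
    by (subst sum.swap, intro sum.cong refl) (simp only: inner_scaleR_left inner_scaleR_right mult_ac)
  have P: "0 \<le> \<tau> i \<and> \<tau> i \<le> \<tau> (Suc i)" if "i < n" for i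
    using is_partition_nonneg[OF p, of i] p that unfolding is_partition_def by auto
  have Q: "0 \<le> \<upsilon> i \<and> \<upsilon> i \<le> \<upsilon> (Suc i)" if "i < m" for i
    using is_partition_nonneg[OF q, of i] q that unfolding is_partition_def by auto
  show "integrable M (\<lambda>\<omega>. elementary_integral W n \<tau> A \<omega> \<bullet> elementary_integral W m \<upsilon> B \<omega>)"
    unfolding e1 using P Q by (intro Bochner_Integration.integrable_sum increment_image_inner(1)) auto
  show "integrable lborel (\<lambda>r. step_function n \<tau> A r \<bullet> step_function m \<upsilon> B r)"
    unfolding e2 by (intro Bochner_Integration.integrable_sum integrable_mult_right indicator_product_integrable)
  have "expectation (\<lambda>\<omega>. elementary_integral W n \<tau> A \<omega> \<bullet> elementary_integral W m \<upsilon> B \<omega>)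
    = (\<Sum>i<n. \<Sum>j<m. (A i \<bullet> B j) * (\<integral>r. indicator {\<tau> i<..\<tau> (Suc i)} r * indicator {\<upsilon> j<..\<upsilon> (Suc j)} r \<partial>lborel))"
    unfolding e1 using P Q
    by (subst Bochner_Integration.integral_sum, intro Bochner_Integration.integrable_sum increment_image_inner(1); simp)
      (intro sum.cong refl, subst Bochner_Integration.integral_sum, auto intro!: increment_image_inner sum.cong)
  also have "\<dots> = (\<integral>r. step_function n \<tau> A r \<bullet> step_function m \<upsilon> B r \<partial>lborel)"
    unfolding e2
    by (simp only: Bochner_Integration.integral_sum Bochner_Integration.integrable_sum integrable_mult_right indicator_product_integrable integral_mult_right_zero)
  finally show "expectation (\<lambda>\<omega>. elementary_integral W n \<tau> A \<omega> \<bullet> elementary_integral W m \<upsilon> B \<omega>)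
      = (\<integral>r. step_function n \<tau> A r \<bullet> step_function m \<upsilon> B r \<partial>lborel)" .
qed

lemma elementary_integral_isometry:
  fixes A B :: "nat \<Rightarrow> real^'n^'n"
  assumes p: "is_partition s t n \<tau>" "0 \<le> s" and q: "is_partition s' t' m \<upsilon>" "0 \<le> s'"
  shows "(\<integral>\<^sup>+\<omega>. ennreal ((norm (elementary_integral W n \<tau> A \<omega> - elementary_integral W m \<upsilon> B \<omega>))\<^sup>2) \<partial>M)
    = (\<integral>\<^sup>+r. ennreal ((norm (step_function n \<tau> A r - step_function m \<upsilon> B r))\<^sup>2) \<partial>lborel)"
proof -
  have sq: "(norm (x - y))\<^sup>2 = x \<bullet> x - 2 * (x \<bullet> y) + y \<bullet> y" for x y :: "'z::real_inner"
    unfolding power2_norm_eq_inner by (simp add: inner_diff inner_commute)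
  note i = elementary_integral_inner(1)[OF p p] elementary_integral_inner(1)[OF p q] elementary_integral_inner(1)[OF q q]
  note j = elementary_integral_inner(2)[OF p p] elementary_integral_inner(2)[OF p q] elementary_integral_inner(2)[OF q q]
  note k = elementary_integral_inner(3)[OF p p] elementary_integral_inner(3)[OF p q] elementary_integral_inner(3)[OF q q]
  have 1: "integrable M (\<lambda>\<omega>. (norm (elementary_integral W n \<tau> A \<omega> - elementary_integral W m \<upsilon> B \<omega>))\<^sup>2)"
    unfolding sq by (intro Bochner_Integration.integrable_add Bochner_Integration.integrable_diff integrable_mult_right i)
  have 2: "integrable lborel (\<lambda>r. (norm (step_function n \<tau> A r - step_function m \<upsilon> B r))\<^sup>2)"
    unfolding sq by (intro Bochner_Integration.integrable_add Bochner_Integration.integrable_diff integrable_mult_right j)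
  have "expectation (\<lambda>\<omega>. (norm (elementary_integral W n \<tau> A \<omega> - elementary_integral W m \<upsilon> B \<omega>))\<^sup>2)
      = (\<integral>r. (norm (step_function n \<tau> A r - step_function m \<upsilon> B r))\<^sup>2 \<partial>lborel)"
    unfolding sq using i j k by simp
  then show ?thesis
    using nn_integral_eq_integral[OF 1] nn_integral_eq_integral[OF 2] by simp
qed

text \<open>The third moment is obtained from the second and the fourth by
\<open>2 * sqrt h * u ^ 3 \<le> h * u\<^sup>2 + u ^ 4\<close>.\<close>

lemma increment_norm_moments:
  assumes "0 \<le> s" "s \<le> t"
  shows "integrable M (\<lambda>\<omega>. norm (W t \<omega> - W s \<omega>) ^ 3)"
    and "expectation (\<lambda>\<omega>. norm (W t \<omega> - W s \<omega>) ^ 3) \<le> 2 * (real CARD('n))\<^sup>2 * (t - s) * sqrt (t - s)"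
proof -
  let ?D = "\<lambda>\<omega>. W t \<omega> - W s \<omega>" and ?h = "t - s" and ?d = "real CARD('n)"
  have nsq: "(norm (x :: real^'n))\<^sup>2 = (\<Sum>i\<in>UNIV. (x $ i)\<^sup>2)" for x
    unfolding power2_norm_eq_inner inner_vec_def by (simp add: power2_eq_square)
  have sq: "(norm (?D \<omega>))\<^sup>2 = (\<Sum>i\<in>UNIV. (?D \<omega> $ i)\<^sup>2)" for \<omega> by (rule nsq)
  have n4: "norm (?D \<omega>) ^ 4 \<le> ?d * (\<Sum>i\<in>UNIV. (?D \<omega> $ i) ^ 4)" for \<omega>
  proof -
    have "norm (?D \<omega>) ^ 4 = ((norm (?D \<omega>))\<^sup>2)\<^sup>2" by simp
    also have "\<dots> \<le> (\<Sum>i\<in>UNIV. ((?D \<omega> $ i)\<^sup>2)\<^sup>2) * card (UNIV :: 'n set)"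
      unfolding sq using Cauchy_Schwarz_ineq_sum[of "\<lambda>i. (?D \<omega> $ i)\<^sup>2" "\<lambda>_. 1" UNIV] by simp
    finally show ?thesis by (simp add: mult.commute)
  qed
  have meas: "(\<lambda>\<omega>. norm (?D \<omega>) ^ k) \<in> borel_measurable M" for k
    using increment_measurable[of s t] assms by (intro borel_measurable_power borel_measurable_norm) auto
  have i2: "integrable M (\<lambda>\<omega>. (norm (?D \<omega>))\<^sup>2)"
    unfolding sq by (intro Bochner_Integration.integrable_sum increment_moment(1) assms)
  have i4': "integrable M (\<lambda>\<omega>. ?d * (\<Sum>i\<in>UNIV. (?D \<omega> $ i) ^ 4))"
    by (intro integrable_mult_right Bochner_Integration.integrable_sum increment_moment(1) assms)
  have i4: "integrable M (\<lambda>\<omega>. norm (?D \<omega>) ^ 4)"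
    by (rule Bochner_Integration.integrable_bound[OF i4' meas]) (use n4 in \<open>auto intro: order_trans[OF _ abs_ge_self]\<close>)
  have le: "2 * (sqrt ?h * norm (?D \<omega>) ^ 3) \<le> ?h * (norm (?D \<omega>))\<^sup>2 + norm (?D \<omega>) ^ 4" for \<omega>
  proof -
    have "0 \<le> (sqrt ?h * norm (?D \<omega>) - (norm (?D \<omega>))\<^sup>2)\<^sup>2" by simp
    also have "\<dots> = (sqrt ?h)\<^sup>2 * (norm (?D \<omega>))\<^sup>2 + norm (?D \<omega>) ^ 4 - 2 * (sqrt ?h * norm (?D \<omega>) ^ 3)"
      by (simp add: power2_eq_square algebra_simps power3_eq_cube power4_eq_xxxx)
    finally show ?thesis using assms by simp
  qed
  have E2: "expectation (\<lambda>\<omega>. (norm (?D \<omega>))\<^sup>2) = ?d * ?h"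
    unfolding sq by (subst Bochner_Integration.integral_sum) (auto simp only: increment_moment[OF assms] sum_constant)
  have E4: "expectation (\<lambda>\<omega>. norm (?D \<omega>) ^ 4) \<le> ?d * (?d * (3 * ?h\<^sup>2))"
  proof -
    have "expectation (\<lambda>\<omega>. norm (?D \<omega>) ^ 4) \<le> expectation (\<lambda>\<omega>. ?d * (\<Sum>i\<in>UNIV. (?D \<omega> $ i) ^ 4))"
      by (rule integral_mono[OF i4 i4' n4])
    also have "\<dots> = ?d * (?d * (3 * ?h\<^sup>2))"
      unfolding integral_mult_right_zero
      by (subst Bochner_Integration.integral_sum) (auto simp only: increment_moment[OF assms] sum_constant)
    finally show ?thesis .
  qed
  show i3: "integrable M (\<lambda>\<omega>. norm (?D \<omega>) ^ 3)"
  proof (rule Bochner_Integration.integrable_bound[OF Bochner_Integration.integrable_add[OF i2 i4] meas])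
    have "x ^ 3 \<le> x\<^sup>2 + x ^ 4" if "0 \<le> x" for x :: real
    proof -
      have "0 \<le> x\<^sup>2 * (x - 1)\<^sup>2" by simp
      also have "\<dots> = x\<^sup>2 + x ^ 4 - 2 * x ^ 3" by (simp add: power2_eq_square algebra_simps power3_eq_cube power4_eq_xxxx)
      finally show ?thesis using zero_le_power[OF that, of 3] by linarith
    qed
    then show "AE \<omega> in M. norm (norm (?D \<omega>) ^ 3) \<le> norm ((norm (?D \<omega>))\<^sup>2 + norm (?D \<omega>) ^ 4)"
      by simp
  qed
  show "expectation (\<lambda>\<omega>. norm (?D \<omega>) ^ 3) \<le> 2 * ?d\<^sup>2 * ?h * sqrt ?h"
  proof (cases "s = t")
    case False
    then have h: "0 < ?h" using assms by simp
    have "2 * (sqrt ?h * expectation (\<lambda>\<omega>. norm (?D \<omega>) ^ 3)) = expectation (\<lambda>\<omega>. 2 * (sqrt ?h * norm (?D \<omega>) ^ 3))"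
      by simp
    also have "\<dots> \<le> expectation (\<lambda>\<omega>. ?h * (norm (?D \<omega>))\<^sup>2 + norm (?D \<omega>) ^ 4)"
      by (rule integral_mono[OF _ _ le]) (intro integrable_mult_right Bochner_Integration.integrable_add i2 i3 i4)+
    also have "\<dots> = ?h * (?d * ?h) + expectation (\<lambda>\<omega>. norm (?D \<omega>) ^ 4)"
      using i2 i4 E2 by simp
    also have "\<dots> \<le> ?h * (?d * ?h) + ?d * (?d * (3 * ?h\<^sup>2))" using E4 by simp
    also have "\<dots> \<le> 4 * (?d\<^sup>2 * ?h\<^sup>2)"
    proof -
      have "?d \<le> ?d * ?d" using zero_less_card_finite[where 'a='n] by simp
      then have "?d * ?h\<^sup>2 \<le> (?d * ?d) * ?h\<^sup>2" by (intro mult_right_mono) auto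
      then show ?thesis by (simp add: power2_eq_square algebra_simps)
    qed
    also have "?h\<^sup>2 = sqrt ?h * (sqrt ?h * ?h)" using h by (simp add: power2_eq_square flip: mult.assoc)
    finally have "2 * (sqrt ?h * expectation (\<lambda>\<omega>. norm (?D \<omega>) ^ 3)) \<le> 4 * (?d\<^sup>2 * (sqrt ?h * (sqrt ?h * ?h)))" .
    moreover have "sqrt ?h * (2 * ?d\<^sup>2 * ?h * sqrt ?h) = 2 * (?d\<^sup>2 * (sqrt ?h * (sqrt ?h * ?h)))"
      by (simp only: mult_ac)
    ultimately have "sqrt ?h * expectation (\<lambda>\<omega>. norm (?D \<omega>) ^ 3) \<le> sqrt ?h * (2 * ?d\<^sup>2 * ?h * sqrt ?h)"
      by linarith
    then show ?thesis using h by (simp only: mult_le_cancel_left_pos real_sqrt_gt_0_iff)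
  qed simp
qed


lemma elementary_integral_measurable:
  assumes "is_partition s t n \<tau>" "0 \<le> s"
  shows "elementary_integral W n \<tau> A \<in> borel_measurable M"
  unfolding elementary_integral_def
  by (intro borel_measurable_sum borel_measurable_matrix_vector_mult increment_measurable
      is_partition_nonneg[OF assms]) auto

text \<open>The definition of the stochastic integral supplies some approximating sequence of step functions; by
the isometry, every step function that is close to \<open>\<sigma>\<close> then has an elementary integral close to the
stochastic integral. This frees the choice of the partition.\<close>

lemma stochastic_integral_elementary_approx:
  fixes A :: "nat \<Rightarrow> real^'n^'n"
  assumes Y: "has_stochastic_integral M W \<sigma> s t Y" and s: "0 \<le> s"
    and \<sigma>: "\<sigma> \<in> borel_measurable (lebesgue_on {s..t})" and p: "is_partition s t n \<tau>"
  shows "(\<integral>\<^sup>+\<omega>. ennreal ((norm (elementary_integral W n \<tau> A \<omega> - Y \<omega>))\<^sup>2) \<partial>M)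
    \<le> 4 * (\<integral>\<^sup>+r\<in>{s..t}. ennreal ((norm (step_function n \<tau> A r - \<sigma> r))\<^sup>2) \<partial>lebesgue)"
proof -
  obtain N \<upsilon> B where q: "\<And>k. is_partition s t (N k) (\<upsilon> k)"
    and l1: "(\<lambda>k. \<integral>\<^sup>+ r\<in>{s..t}. ennreal ((norm (step_function (N k) (\<upsilon> k) (B k) r - \<sigma> r))\<^sup>2) \<partial>lebesgue) \<longlonglongrightarrow> 0"
    and l2: "(\<lambda>k. \<integral>\<^sup>+ \<omega>. ennreal ((norm (elementary_integral W (N k) (\<upsilon> k) (B k) \<omega> - Y \<omega>))\<^sup>2) \<partial>M) \<longlonglongrightarrow> 0"
    using Y unfolding has_stochastic_integral_def by blast
  have mY [measurable]: "Y \<in> borel_measurable M" using Y unfolding has_stochastic_integral_def by blast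
  have mZ [measurable]: "elementary_integral W n \<tau> A \<in> borel_measurable M"
    by (rule elementary_integral_measurable[OF p s])
  have mZ' [measurable]: "elementary_integral W (N k) (\<upsilon> k) (B k) \<in> borel_measurable M" for k
    by (rule elementary_integral_measurable[OF q s])
  have m\<sigma>: "(\<lambda>r. ennreal ((norm (step_function n \<tau> A r - \<sigma> r))\<^sup>2) * indicator {s..t} r) \<in> borel_measurable lebesgue" for n \<tau> A
  proof -
    have "(\<lambda>r. indicator {s..t} r *\<^sub>R \<sigma> r) \<in> borel_measurable lebesgue"
      using \<sigma> by (simp add: borel_measurable_restrict_space_iff)
    moreover have "step_function n \<tau> A \<in> borel_measurable lebesgue"
      by (rule measurable_completion) (simp add: borel_measurable_step_function)
    ultimately have "(\<lambda>r. ennreal ((norm (step_function n \<tau> A r - indicator {s..t} r *\<^sub>R \<sigma> r))\<^sup>2) * indicator {s..t} r) \<in> borel_measurable lebesgue"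
      by (intro borel_measurable_times_ennreal measurable_compose[OF _ measurable_ennreal] borel_measurable_power
          borel_measurable_norm borel_measurable_diff borel_measurable_indicator) auto
    also have "(\<lambda>r. ennreal ((norm (step_function n \<tau> A r - indicator {s..t} r *\<^sub>R \<sigma> r))\<^sup>2) * indicator {s..t} r)
        = (\<lambda>r. ennreal ((norm (step_function n \<tau> A r - \<sigma> r))\<^sup>2) * indicator {s..t} r)"
      by (auto simp: fun_eq_iff split: split_indicator)
    finally show ?thesis .
  qed
  let ?e = "\<integral>\<^sup>+r\<in>{s..t}. ennreal ((norm (step_function n \<tau> A r - \<sigma> r))\<^sup>2) \<partial>lebesgue"
  let ?e1 = "\<lambda>k. \<integral>\<^sup>+ r\<in>{s..t}. ennreal ((norm (step_function (N k) (\<upsilon> k) (B k) r - \<sigma> r))\<^sup>2) \<partial>lebesgue"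
  let ?e2 = "\<lambda>k. \<integral>\<^sup>+ \<omega>. ennreal ((norm (elementary_integral W (N k) (\<upsilon> k) (B k) \<omega> - Y \<omega>))\<^sup>2) \<partial>M"
  have "(\<integral>\<^sup>+\<omega>. ennreal ((norm (elementary_integral W n \<tau> A \<omega> - Y \<omega>))\<^sup>2) \<partial>M) \<le> 2 * (2 * ?e + 2 * ?e1 k) + 2 * ?e2 k" for k
  proof -
    have "(\<integral>\<^sup>+\<omega>. ennreal ((norm (elementary_integral W n \<tau> A \<omega> - Y \<omega>))\<^sup>2) \<partial>M)
       \<le> (\<integral>\<^sup>+\<omega>. 2 * ennreal ((norm (elementary_integral W n \<tau> A \<omega> - elementary_integral W (N k) (\<upsilon> k) (B k) \<omega>))\<^sup>2)
           + 2 * ennreal ((norm (elementary_integral W (N k) (\<upsilon> k) (B k) \<omega> - Y \<omega>))\<^sup>2) \<partial>M)"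
      by (intro nn_integral_mono) (metis ennreal_norm_diff_sq_le norm_minus_commute)
    also have "\<dots> = 2 * (\<integral>\<^sup>+\<omega>. ennreal ((norm (elementary_integral W n \<tau> A \<omega> - elementary_integral W (N k) (\<upsilon> k) (B k) \<omega>))\<^sup>2) \<partial>M)
           + 2 * ?e2 k"
      by (subst nn_integral_add, measurable) (simp add: nn_integral_cmult)
    also have "(\<integral>\<^sup>+\<omega>. ennreal ((norm (elementary_integral W n \<tau> A \<omega> - elementary_integral W (N k) (\<upsilon> k) (B k) \<omega>))\<^sup>2) \<partial>M)
        = (\<integral>\<^sup>+r. ennreal ((norm (step_function n \<tau> A r - step_function (N k) (\<upsilon> k) (B k) r))\<^sup>2) \<partial>lebesgue)"
      unfolding elementary_integral_isometry[OF p s q s] nn_integral_completion ..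
    also have "\<dots> \<le> (\<integral>\<^sup>+r. 2 * (ennreal ((norm (step_function n \<tau> A r - \<sigma> r))\<^sup>2) * indicator {s..t} r)
         + 2 * (ennreal ((norm (step_function (N k) (\<upsilon> k) (B k) r - \<sigma> r))\<^sup>2) * indicator {s..t} r) \<partial>lebesgue)"
    proof (rule nn_integral_mono)
      fix r
      show "ennreal ((norm (step_function n \<tau> A r - step_function (N k) (\<upsilon> k) (B k) r))\<^sup>2)
        \<le> 2 * (ennreal ((norm (step_function n \<tau> A r - \<sigma> r))\<^sup>2) * indicator {s..t} r)
         + 2 * (ennreal ((norm (step_function (N k) (\<upsilon> k) (B k) r - \<sigma> r))\<^sup>2) * indicator {s..t} r)"
      proof (cases "r \<in> {s..t}")
        case True
        then show ?thesis using ennreal_norm_diff_sq_le by simp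
      next
        case False
        then show ?thesis using step_function_eq_0[OF p, of r A] step_function_eq_0[OF q[of k], of r "B k"] by simp
      qed
    qed
    also have "\<dots> = 2 * ?e + 2 * ?e1 k"
      using m\<sigma> by (simp add: nn_integral_add nn_integral_cmult)
    finally show ?thesis by (simp add: add_mono mult_left_mono)
  qed
  moreover have "(\<lambda>k. 2 * (2 * ?e + 2 * ?e1 k) + 2 * ?e2 k) \<longlonglongrightarrow> 2 * (2 * ?e + 2 * 0) + 2 * 0"
    by (intro tendsto_intros l1 l2) auto
  ultimately have "(\<integral>\<^sup>+\<omega>. ennreal ((norm (elementary_integral W n \<tau> A \<omega> - Y \<omega>))\<^sup>2) \<partial>M) \<le> 2 * (2 * ?e + 2 * 0) + 2 * 0"
    by (intro LIMSEQ_le_const) auto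
  also have "\<dots> = 4 * ?e" by (simp add: mult.assoc[symmetric])
  finally show ?thesis .
qed

lemma past_future_indep:
  assumes \<tau>: "is_partition s t n \<tau>" "0 \<le> s" and k: "k < n"
  shows "indep_var (PiM {..<k} (\<lambda>_. borel)) (\<lambda>\<omega>. \<lambda>i\<in>{..<k}. W (\<tau> (Suc i)) \<omega> - W (\<tau> i) \<omega>)
    (PiM {k} (\<lambda>_. borel)) (\<lambda>\<omega>. \<lambda>i\<in>{k}. W (\<tau> (Suc i)) \<omega> - W (\<tau> i) \<omega>)"
proof (rule indep_var_restrict)
  show "indep_vars (\<lambda>_. borel) (\<lambda>i \<omega>. W (\<tau> (Suc i)) \<omega> - W (\<tau> i) \<omega>) {..<n}"
    by (rule BM_indep_increments) (use \<tau> in \<open>auto simp: is_partition_def\<close>)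
qed (use k in auto)

end

section \<open>Uniform grids\<close>

text \<open>Along this grid the increments of Brownian motion are independent and identically distributed. The
index \<open>n\<close> counts cells, so that \<open>grid t T n n = T\<close> unless \<open>n = 0\<close>.\<close>

definition grid :: "real \<Rightarrow> real \<Rightarrow> nat \<Rightarrow> nat \<Rightarrow> real" where
  "grid t T n k = t + real k * ((T - t) / real n)"

lemma grid_0 [simp]: "grid t T n 0 = t" by (simp add: grid_def)

lemma grid_end: "0 < n \<Longrightarrow> grid t T n n = T" by (simp add: grid_def)

lemma grid_Suc: "grid t T n (Suc k) = grid t T n k + (T - t) / real n"
  by (simp add: grid_def distrib_right add_divide_distrib)

lemma grid_mono: "t \<le> T \<Longrightarrow> i \<le> j \<Longrightarrow> grid t T n i \<le> grid t T n j"
  unfolding grid_def by (intro add_left_mono mult_right_mono) auto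

lemma grid_ge: "t \<le> T \<Longrightarrow> t \<le> grid t T n k"
  using grid_mono[of t T 0 k n] by simp

lemma grid_le: "t \<le> T \<Longrightarrow> k \<le> n \<Longrightarrow> 0 < n \<Longrightarrow> grid t T n k \<le> T"
  using grid_mono[of t T k n n] by (simp add: grid_end)

lemma grid_partition: "t \<le> T \<Longrightarrow> is_partition t (grid t T n k) k (grid t T n)"
  unfolding is_partition_def by (auto intro: grid_mono)

abbreviation cell :: "real \<Rightarrow> real \<Rightarrow> nat \<Rightarrow> nat \<Rightarrow> real set" where
  "cell t T n k \<equiv> {grid t T n k..grid t T n (Suc k)}"

lemma cell_subset:
  assumes "t \<le> T" "k < n" shows "cell t T n k \<subseteq> {t..T}"
  using grid_ge[OF assms(1), of n k] grid_le[OF assms(1), of "Suc k" n] assms by auto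

lemma sum_cell_integrals:
  fixes f :: "real \<Rightarrow> 'a::banach"
  assumes f: "f integrable_on {t..T}" and t: "t \<le> T" and k: "k \<le> n" "0 < n"
  shows "(\<Sum>i<k. integral (cell t T n i) f) = integral {t..grid t T n k} f"
  using k(1)
proof (induction k)
  case (Suc k)
  have "f integrable_on {t..grid t T n (Suc k)}"
    by (rule integrable_subinterval_real[OF f]) (use grid_le[OF t Suc(2) k(2)] in auto)
  then have "integral {t..grid t T n k} f + integral (cell t T n k) f = integral {t..grid t T n (Suc k)} f"
    by (intro Henstock_Kurzweil_Integration.integral_combine) (auto intro: grid_ge grid_mono t)
  then show ?case using Suc by simp
qed simp

text \<open>A measurable function is an almost everywhere limit of continuous functions; projecting these onto
the ball of radius \<open>B\<close> keeps them continuous and makes them dominated.\<close>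

lemma bounded_measurable_L1_approx_continuous:
  fixes f :: "real \<Rightarrow> 'a::euclidean_space"
  assumes f: "bounded_measurable_on {t..T} f" and B: "\<And>s. s \<in> {t..T} \<Longrightarrow> norm (f s) \<le> B" "0 \<le> B"
    and e: "0 < e"
  obtains g where "continuous_on UNIV g" "\<And>s. norm (g s) \<le> B" "integral {t..T} (\<lambda>s. norm (g s - f s)) < e"
proof -
  have "f measurable_on {t..T}"
    using f unfolding bounded_measurable_on_def by (subst measurable_on_iff_borel_measurable) auto
  then obtain N g where N: "negligible N" and g: "\<And>n. continuous_on UNIV (g n)"
    and lim: "\<And>x. x \<notin> N \<Longrightarrow> (\<lambda>n. g n x) \<longlonglongrightarrow> (if x \<in> {t..T} then f x else 0)"
    unfolding measurable_on_def by blast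
  let ?p = "closest_point (cball (0::'a) B)"
  have ne: "cball (0::'a) B \<noteq> {}" using B(2) by simp
  have pc: "continuous_on X ?p" for X
    by (rule continuous_on_closest_point) (use ne in auto)
  \<comment> \<open>The projection fixes the values of \<open>f\<close>, so that it does not disturb the limit.\<close>
  define h where "h n x = ?p (g n x)" for n x
  have hc: "continuous_on UNIV (h n)" for n
    unfolding h_def by (rule continuous_on_compose2[OF pc[of UNIV] g]) auto
  have hB: "norm (h n x) \<le> B" for n x
    unfolding h_def using closest_point_in_set[of "cball (0::'a) B" "g n x"] ne by simp
  have hlim: "(\<lambda>n. h n x) \<longlonglongrightarrow> f x" if "x \<in> {t..T}" "x \<notin> N" for x
  proof -
    have "(\<lambda>n. ?p (g n x)) \<longlonglongrightarrow> ?p (f x)"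
      using lim[OF that(2)] that(1) by (intro continuous_on_tendsto_compose[OF pc[of UNIV]]) auto
    moreover have "?p (f x) = f x" using B(1)[OF that(1)] by (intro closest_point_self) simp
    ultimately show ?thesis by (simp add: h_def)
  qed
  \<comment> \<open>Setting the error to zero on the null set turns convergence almost everywhere into convergence everywhere.\<close>
  define d where "d n x = (if x \<in> N then 0 else norm (h n x - f x))" for n x
  have bm: "bounded_measurable_on {t..T} (\<lambda>x. norm (h n x - f x))" for n
    by (intro bounded_measurable_on_norm bounded_measurable_on_diff f bounded_measurable_on_continuous
        continuous_on_subset[OF hc]) auto
  have hi: "(\<lambda>x. norm (h n x - f x)) integrable_on {t..T}" for n
    using bounded_measurable_on_imp_integrable[OF bm] by simp
  have di: "d n integrable_on {t..T}" for n
    by (rule integrable_spike[OF hi N]) (simp add: d_def)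
  have de: "integral {t..T} (d n) = integral {t..T} (\<lambda>x. norm (h n x - f x))" for n
    by (rule integral_spike[OF N]) (simp add: d_def)
  have "(\<lambda>n. integral {t..T} (d n)) \<longlonglongrightarrow> integral {t..T} (\<lambda>_. 0)"
  proof (rule dominated_convergence(2)[OF di, where h = "\<lambda>_. 2 * B"])
    show "norm (d n x) \<le> 2 * B" if "x \<in> {t..T}" for n x
      unfolding d_def using norm_triangle_ineq4[of "h n x" "f x"] hB[of n x] B(1)[OF that] B(2) by simp
    show "(\<lambda>n. d n x) \<longlonglongrightarrow> 0" if "x \<in> {t..T}" for x
    proof (cases "x \<in> N")
      case False
      then show ?thesis using hlim[OF that False] unfolding d_def
        by (simp add: tendsto_norm_zero LIM_zero)
    qed (simp add: d_def)
  qed auto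
  then have "(\<lambda>n. integral {t..T} (\<lambda>x. norm (h n x - f x))) \<longlonglongrightarrow> 0" by (simp add: de)
  then obtain n where "integral {t..T} (\<lambda>x. norm (h n x - f x)) < e"
    using order_tendstoD(2)[OF _ e] by (metis (mono_tags, lifting) eventually_sequentially order_refl)
  then show thesis using that[OF hc[of n] hB] by blast
qed

lemma eventually_grid_fine:
  assumes "0 < d"
  shows "\<forall>\<^sub>F n in sequentially. (T - t) / real n < d"
proof -
  have "(\<lambda>n. (T - t) / real n) \<longlonglongrightarrow> 0" by (rule lim_const_over_n)
  then show ?thesis by (rule order_tendstoD(2)) (rule assms)
qed

text \<open>Sampling a continuous approximation at the grid points gives matrices that share the bound of \<open>f\<close>,
on every sufficiently fine uniform grid.\<close>

lemma step_approximation_L1: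
  fixes f :: "real \<Rightarrow> 'a::euclidean_space"
  assumes f: "bounded_measurable_on {t..T} f" and B: "\<And>s. s \<in> {t..T} \<Longrightarrow> norm (f s) \<le> B" "0 \<le> B"
    and t: "t < T" and e: "0 < e"
  shows "\<forall>\<^sub>F n in sequentially. \<exists>A. (\<forall>k. norm (A k) \<le> B) \<and>
    (\<Sum>k<n. integral (cell t T n k) (\<lambda>r. norm (A k - f r))) \<le> e"
proof -
  obtain g where g: "continuous_on UNIV g" "\<And>s. norm (g s) \<le> B"
    and gi: "integral {t..T} (\<lambda>s. norm (g s - f s)) < e / 2"
    using bounded_measurable_L1_approx_continuous[OF f B, of "e / 2"] e by auto
  define e' where "e' = e / 2 * inverse (T - t)"
  have e': "0 < e'" using e t by (simp add: e'_def)
  have "uniformly_continuous_on {t..T} g"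
    by (rule compact_uniformly_continuous[OF continuous_on_subset[OF g(1)]]) auto
  then obtain d where d: "0 < d" "\<And>x y. x \<in> {t..T} \<Longrightarrow> y \<in> {t..T} \<Longrightarrow> dist y x < d \<Longrightarrow> dist (g y) (g x) < e'"
    using e' unfolding uniformly_continuous_on_def by metis
  show ?thesis
    using eventually_grid_fine[OF d(1), of T t] eventually_gt_at_top[of 0]
  proof eventually_elim
    case (elim n)
    define A where "A k = g (grid t T n k)" for k
    have bmd: "bounded_measurable_on {t..T} (\<lambda>s. norm (g s - f s))"
      by (intro bounded_measurable_on_norm bounded_measurable_on_diff f bounded_measurable_on_continuous
        continuous_on_subset[OF g(1)]) auto
    have int: "(\<lambda>s. e' + norm (g s - f s)) integrable_on {t..T}"
      by (intro integrable_add integrable_const_ivl bounded_measurable_on_imp_integrable[OF bmd]) simp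
    have "(\<Sum>k<n. integral (cell t T n k) (\<lambda>r. norm (A k - f r)))
        \<le> (\<Sum>k<n. integral (cell t T n k) (\<lambda>s. e' + norm (g s - f s)))"
    proof (intro sum_mono integral_le)
      fix k assume "k \<in> {..<n}"
      then have k: "k < n" by simp
      have sub: "cell t T n k \<subseteq> {t..T}" using cell_subset[of t T k n] t k by simp
      have "bounded_measurable_on {t..T} (\<lambda>r. norm (A k - f r))"
        by (intro bounded_measurable_on_norm bounded_measurable_on_diff f) simp
      then show "(\<lambda>r. norm (A k - f r)) integrable_on cell t T n k"
        by (rule bounded_measurable_on_imp_integrable[OF _ sub])
      show "(\<lambda>s. e' + norm (g s - f s)) integrable_on cell t T n k"
        by (rule integrable_subinterval_real[OF int sub])
      fix r assume r: "r \<in> cell t T n k"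
      then have "dist r (grid t T n k) < d" using elim(1) grid_Suc[of t T n k] by (auto simp: dist_real_def)
      moreover have "r \<in> {t..T}" "grid t T n k \<in> {t..T}"
        using r sub grid_mono[of t T k "Suc k" n] t by auto
      ultimately have "dist (g r) (g (grid t T n k)) < e'" using d(2) by blast
      then show "norm (A k - f r) \<le> e' + norm (g r - f r)"
        unfolding A_def dist_norm using norm_triangle_ineq[of "g (grid t T n k) - g r" "g r - f r"]
        by (simp add: norm_minus_commute)
    qed
    also have "\<dots> = integral {t..T} (\<lambda>s. e' + norm (g s - f s))"
      using sum_cell_integrals[OF int, of n n] t elim(2) by (simp add: grid_end)
    also have "\<dots> = e' * (T - t) + integral {t..T} (\<lambda>s. norm (g s - f s))"
      using t bounded_measurable_on_imp_integrable[OF bmd, of t T]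
      by (subst Henstock_Kurzweil_Integration.integral_add) auto
    also have "\<dots> \<le> e"
    proof -
      have "e' * (T - t) = e / 2" unfolding e'_def mult.assoc by (subst left_inverse) (use t in auto)
      then show ?thesis using gi by linarith
    qed
    finally show ?case by (intro exI[of _ A]) (simp add: A_def g(2))
  qed
qed

text \<open>Both functions are bounded by \<open>B\<close>, so that the square of their distance is at most \<open>2 * B\<close> times the
distance: an \<open>L\<^sup>1\<close> approximation is an \<open>L\<^sup>2\<close> approximation.\<close>

lemma nn_integral_step_function_le:
  fixes f :: "real \<Rightarrow> 'a::euclidean_space"
  assumes f: "bounded_measurable_on {t..T} f" and B: "\<And>s. s \<in> {t..T} \<Longrightarrow> norm (f s) \<le> B"
    and A: "\<And>k. norm (A k) \<le> B" and t: "t \<le> T" and k: "k \<le> n" "0 < n"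
  shows "(\<integral>\<^sup>+r\<in>{t..grid t T n k}. ennreal ((norm (step_function k (grid t T n) A r - f r))\<^sup>2) \<partial>lebesgue)
    \<le> ennreal (2 * B * (\<Sum>i<n. integral (cell t T n i) (\<lambda>r. norm (A i - f r))))"
proof -
  have B0: "0 \<le> B" using A[of 0] norm_ge_zero order_trans by blast
  have st: "step_function k (grid t T n) A r = A i"
    if i: "i < k" and r: "r \<in> {grid t T n i<..grid t T n (Suc i)}" for i r
  proof -
    have "indicator {grid t T n j<..grid t T n (Suc j)} r *\<^sub>R A j = (if j = i then A i else 0)" if "j < k" for j
    proof (cases j i rule: linorder_cases)
      case less
      then show ?thesis using grid_mono[OF t, of "Suc j" i n] r by (auto simp: indicator_def)
    next
      case greater
      then show ?thesis using grid_mono[OF t, of "Suc i" j n] r by (auto simp: indicator_def)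
    qed (use r in simp)
    then show ?thesis unfolding step_function_def using i by simp
  qed
  have ci: "(\<integral>\<^sup>+r\<in>cell t T n i. ennreal (2 * B * norm (A i - f r)) \<partial>lebesgue)
      = ennreal (2 * B * integral (cell t T n i) (\<lambda>r. norm (A i - f r)))" if "i < n" for i
  proof -
    have bm: "bounded_measurable_on {t..T} (\<lambda>r. 2 * B * norm (A i - f r))"
      by (intro bounded_measurable_on_linear[OF bounded_linear_mult_right] bounded_measurable_on_norm bounded_measurable_on_diff f) simp
    note ai = bounded_measurable_on_imp_absolutely_integrable[OF bm cell_subset[OF t that]]
    have "(\<integral>\<^sup>+r\<in>cell t T n i. ennreal (2 * B * norm (A i - f r)) \<partial>lebesgue)
      = (\<integral>\<^sup>+r. ennreal (indicator (cell t T n i) r *\<^sub>R (2 * B * norm (A i - f r))) \<partial>lebesgue)"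
      by (intro nn_integral_cong) (auto split: split_indicator)
    also have "\<dots> = ennreal (LINT r:cell t T n i|lebesgue. 2 * B * norm (A i - f r))"
      unfolding set_lebesgue_integral_def
      by (rule nn_integral_eq_integral) (use ai B0 in \<open>auto simp: set_integrable_def\<close>)
    also have "\<dots> = ennreal (2 * B * integral (cell t T n i) (\<lambda>r. norm (A i - f r)))"
      by (subst set_lebesgue_integral_eq_integral(2)[OF ai]) simp
    finally show ?thesis .
  qed
  have meas: "(\<lambda>r. ennreal (2 * B * norm (A i - f r)) * indicator (cell t T n i) r) \<in> borel_measurable lebesgue" if "i < n" for i
  proof -
    have bm: "bounded_measurable_on {t..T} (\<lambda>r. 2 * B * norm (A i - f r))"
      by (intro bounded_measurable_on_linear[OF bounded_linear_mult_right] bounded_measurable_on_norm bounded_measurable_on_diff f) simp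
    note ai = bounded_measurable_on_imp_absolutely_integrable[OF bm cell_subset[OF t that]]
    then have "(\<lambda>r. indicator (cell t T n i) r *\<^sub>R (2 * B * norm (A i - f r))) \<in> borel_measurable lebesgue"
      unfolding set_integrable_def by auto
    then have "(\<lambda>r. ennreal (indicator (cell t T n i) r *\<^sub>R (2 * B * norm (A i - f r)))) \<in> borel_measurable lebesgue"
      by (rule measurable_compose[OF _ measurable_ennreal])
    also have "(\<lambda>r. ennreal (indicator (cell t T n i) r *\<^sub>R (2 * B * norm (A i - f r))))
        = (\<lambda>r. ennreal (2 * B * norm (A i - f r)) * indicator (cell t T n i) r)"
      by (auto simp: fun_eq_iff split: split_indicator)
    finally show ?thesis .
  qed
  have "(\<integral>\<^sup>+r\<in>{t..grid t T n k}. ennreal ((norm (step_function k (grid t T n) A r - f r))\<^sup>2) \<partial>lebesgue)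
     \<le> (\<integral>\<^sup>+r. (\<Sum>i<k. ennreal (2 * B * norm (A i - f r)) * indicator (cell t T n i) r) \<partial>lebesgue)"
  proof (rule nn_integral_mono_AE)
    have "AE r in lebesgue. r \<noteq> t"
      by (rule AE_completion) (rule AE_lborel_singleton)
    then show "AE r in lebesgue. ennreal ((norm (step_function k (grid t T n) A r - f r))\<^sup>2) * indicator {t..grid t T n k} r
       \<le> (\<Sum>i<k. ennreal (2 * B * norm (A i - f r)) * indicator (cell t T n i) r)"
    proof eventually_elim
      case (elim r)
      show ?case
      proof (cases "r \<in> {t<..grid t T n k}")
        case True
        then obtain i where i: "i < k" "r \<in> {grid t T n i<..grid t T n (Suc i)}"
          using partition_indicator_sum[OF grid_partition[OF t] order_refl, where r = r] by (metis (no_types, lifting) indicator_simps(1) indicator_simps(2) lessThan_iff sum.neutral zero_neq_one)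
        have rT: "r \<in> {t..T}" using True grid_le[OF t k] by auto
        have "norm (A i - f r) \<le> 2 * B"
          using norm_triangle_ineq4[of "A i" "f r"] A[of i] B[OF rT] by linarith
        then have "(norm (A i - f r))\<^sup>2 \<le> 2 * B * norm (A i - f r)"
          unfolding power2_eq_square by (intro mult_right_mono) auto
        then have "ennreal ((norm (step_function k (grid t T n) A r - f r))\<^sup>2) * indicator {t..grid t T n k} r
           \<le> ennreal (2 * B * norm (A i - f r)) * indicator (cell t T n i) r"
          using st[OF i] i(2) True by (auto intro!: ennreal_leI)
        also have "\<dots> \<le> (\<Sum>i<k. ennreal (2 * B * norm (A i - f r)) * indicator (cell t T n i) r)"
          by (rule member_le_sum) (use i in auto)
        finally show ?thesis .
      qed (use elim in auto)
    qed
  qed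
  also have "\<dots> = (\<Sum>i<k. ennreal (2 * B * integral (cell t T n i) (\<lambda>r. norm (A i - f r))))"
    using k by (subst nn_integral_sum) (auto intro!: meas sum.cong ci)
  also have "\<dots> = ennreal (\<Sum>i<k. 2 * B * integral (cell t T n i) (\<lambda>r. norm (A i - f r)))"
    using B0 by (subst sum_ennreal) (auto intro!: mult_nonneg_nonneg integral_norm_nonneg)
  also have "\<dots> \<le> ennreal (\<Sum>i<n. 2 * B * integral (cell t T n i) (\<lambda>r. norm (A i - f r)))"
    using B0 k by (intro ennreal_leI sum_mono2) (auto intro!: mult_nonneg_nonneg integral_norm_nonneg)
  finally show ?thesis by (simp add: sum_distrib_left)
qed


text \<open>The cost of staying at \<open>x\<close> during one cell. The coefficients are integrated over the cell and not
sampled, because values of a measurable function at grid points carry no information.\<close>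

definition stage_cost ::
    "(real \<Rightarrow> real^'n^'n) \<Rightarrow> (real \<Rightarrow> real^'n) \<Rightarrow> real \<Rightarrow> real \<Rightarrow> nat \<Rightarrow> nat \<Rightarrow> real^'n \<Rightarrow> real" where
  "stage_cost Q z t T n k x =
     1/2 * (x \<bullet> (integral (cell t T n k) Q *v x)) + integral (cell t T n k) z \<bullet> x"

lemma quadratic_form_integral:
  fixes Q :: "real \<Rightarrow> real^'n^'n"
  assumes "Q integrable_on S"
  shows "(\<lambda>r. x \<bullet> (Q r *v y)) integrable_on S" "integral S (\<lambda>r. x \<bullet> (Q r *v y)) = x \<bullet> (integral S Q *v y)"
proof -
  have bl: "bounded_linear (\<lambda>M. x \<bullet> (M *v y))"
    by (rule bounded_linear_compose[OF bounded_linear_inner_right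
        bounded_bilinear.bounded_linear_left[OF bounded_bilinear_matrix_vector_mult]])
  show "(\<lambda>r. x \<bullet> (Q r *v y)) integrable_on S" "integral S (\<lambda>r. x \<bullet> (Q r *v y)) = x \<bullet> (integral S Q *v y)"
    using integrable_linear[OF assms bl] integral_linear[OF assms bl] by (simp_all add: o_def)
qed

lemma linear_form_integral:
  assumes "z integrable_on S"
  shows "(\<lambda>r. z r \<bullet> x) integrable_on S" "integral S (\<lambda>r. z r \<bullet> x) = integral S z \<bullet> x"
  using integrable_linear[OF assms bounded_linear_inner_left[of x]] integral_linear[OF assms bounded_linear_inner_left[of x]]
  by (simp_all add: o_def)

lemma stage_cost_eq_integral:
  assumes Q: "bounded_measurable_on {t..T} Q" and z: "bounded_measurable_on {t..T} z" and "t \<le> T" "k < n"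
  shows "(\<lambda>r. 1/2 * (x \<bullet> (Q r *v x)) + z r \<bullet> x) integrable_on cell t T n k"
    and "stage_cost Q z t T n k x = integral (cell t T n k) (\<lambda>r. 1/2 * (x \<bullet> (Q r *v x)) + z r \<bullet> x)"
proof -
  note sub = cell_subset[OF assms(3,4)]
  note q = quadratic_form_integral[OF bounded_measurable_on_imp_integrable[OF Q sub], of x x]
  note l = linear_form_integral[OF bounded_measurable_on_imp_integrable[OF z sub], of x]
  have q': "(\<lambda>r. 1/2 * (x \<bullet> (Q r *v x))) integrable_on cell t T n k"
    by (rule integrable_on_mult_right[OF q(1)])
  show "(\<lambda>r. 1/2 * (x \<bullet> (Q r *v x)) + z r \<bullet> x) integrable_on cell t T n k"
    by (rule integrable_add[OF q' l(1)])
  show "stage_cost Q z t T n k x = integral (cell t T n k) (\<lambda>r. 1/2 * (x \<bullet> (Q r *v x)) + z r \<bullet> x)"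
    unfolding stage_cost_def Henstock_Kurzweil_Integration.integral_add[OF q' l(1)] l(2)
    by (simp add: q(2))
qed

lemma abs_half_sum_le:
  fixes a a1 a2 b p q m :: real
  assumes "a = a1 + a2" "\<bar>a1\<bar> \<le> p" "\<bar>a2\<bar> \<le> q" "\<bar>b\<bar> \<le> m"
  shows "\<bar>1/2 * a + b\<bar> \<le> 1/2 * (p + q) + m"
proof -
  have "\<bar>a\<bar> \<le> p + q" using abs_triangle_ineq[of a1 a2] assms by linarith
  then have "\<bar>1/2 * a\<bar> \<le> 1/2 * (p + q)" by (simp add: abs_mult)
  then show ?thesis using abs_triangle_ineq[of "1/2 * a" b] assms(4) by linarith
qed

lemma quadratic_form_diff_le:
  fixes Q :: "real^'n^'n"
  assumes "norm Q \<le> B" "norm z \<le> B"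
  shows "\<bar>(1/2 * (x \<bullet> (Q *v x)) + z \<bullet> x) - (1/2 * (y \<bullet> (Q *v y)) + z \<bullet> y)\<bar>
    \<le> B * (1 + norm x + norm y) * norm (x - y)"
proof -
  have B: "0 \<le> B" using assms(1) norm_ge_zero order_trans by blast
  have "x \<bullet> (Q *v x) - y \<bullet> (Q *v y) = (x - y) \<bullet> (Q *v x) + y \<bullet> (Q *v (x - y))"
    by (simp add: inner_diff_left inner_diff_right matrix_vector_mult_diff_distrib)
  moreover have "\<bar>(x - y) \<bullet> (Q *v x)\<bar> \<le> norm (x - y) * (B * norm x)"
    using assms B by (intro order_trans[OF Cauchy_Schwarz_ineq2] mult_left_mono
      order_trans[OF norm_matrix_vector_mult_le] mult_right_mono) auto
  moreover have "\<bar>y \<bullet> (Q *v (x - y))\<bar> \<le> norm y * (B * norm (x - y))"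
    using assms B by (intro order_trans[OF Cauchy_Schwarz_ineq2] mult_left_mono
      order_trans[OF norm_matrix_vector_mult_le] mult_right_mono) auto
  moreover have "\<bar>z \<bullet> x - z \<bullet> y\<bar> \<le> B * norm (x - y)"
    unfolding inner_diff_right[symmetric]
    by (rule order_trans[OF Cauchy_Schwarz_ineq2]) (intro mult_right_mono assms norm_ge_zero)
  moreover have "(1/2 * (x \<bullet> (Q *v x)) + z \<bullet> x) - (1/2 * (y \<bullet> (Q *v y)) + z \<bullet> y)
      = 1/2 * (x \<bullet> (Q *v x) - y \<bullet> (Q *v y)) + (z \<bullet> x - z \<bullet> y)" by (simp add: algebra_simps)
  ultimately have "\<bar>(1/2 * (x \<bullet> (Q *v x)) + z \<bullet> x) - (1/2 * (y \<bullet> (Q *v y)) + z \<bullet> y)\<bar>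
      \<le> 1/2 * (norm (x - y) * (B * norm x) + norm y * (B * norm (x - y))) + B * norm (x - y)"
    using abs_half_sum_le by metis
  also have "\<dots> \<le> (norm (x - y) * (B * norm x) + norm y * (B * norm (x - y))) + B * norm (x - y)"
    using B by simp
  also have "\<dots> = B * (1 + norm x + norm y) * norm (x - y)" by (simp add: algebra_simps)
  finally show ?thesis .
qed

text \<open>Only the path, which is uniformly continuous, is replaced by its value at the left end of a cell.\<close>

lemma stage_cost_sum_tendsto:
  fixes x :: "real \<Rightarrow> real^'n"
  assumes Q: "bounded_measurable_on {t..T} Q" and z: "bounded_measurable_on {t..T} z" and t: "t < T"
    and x: "continuous_on {t..T} x"
  shows "(\<lambda>n. \<Sum>k<n. stage_cost Q z t T n k (x (grid t T n k)))
    \<longlonglongrightarrow> (LINT s:{t..T}|lebesgue. 1/2 * (x s \<bullet> (Q s *v x s)) + z s \<bullet> x s)"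
proof -
  have bx: "bounded_measurable_on {t..T} x" by (rule bounded_measurable_on_continuous[OF x])
  let ?l = "\<lambda>s y. 1/2 * (y \<bullet> (Q s *v y)) + z s \<bullet> y"
  have bl: "bounded_measurable_on {t..T} (\<lambda>s. ?l s (x s))"
    by (intro bounded_measurable_on_add bounded_measurable_on_linear[OF bounded_linear_mult_right]
        bounded_measurable_on_inner bounded_measurable_on_matrix_vector_mult bx Q z)
  have il: "(\<lambda>s. ?l s (x s)) integrable_on {t..T}" by (rule bounded_measurable_on_imp_integrable[OF bl]) simp
  have L: "(LINT s:{t..T}|lebesgue. ?l s (x s)) = integral {t..T} (\<lambda>s. ?l s (x s))"
    by (rule set_lebesgue_integral_eq_integral(2)[OF bounded_measurable_on_imp_absolutely_integrable[OF bl]]) simp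
  obtain B1 where B1: "0 < B1" "\<forall>s\<in>{t..T}. norm (Q s) \<le> B1"
    using Q unfolding bounded_measurable_on_def bounded_pos by auto
  obtain B2 where B2: "0 < B2" "\<forall>s\<in>{t..T}. norm (z s) \<le> B2"
    using z unfolding bounded_measurable_on_def bounded_pos by auto
  define B where "B = max B1 B2"
  have B: "0 < B" "\<And>s. s \<in> {t..T} \<Longrightarrow> norm (Q s) \<le> B" "\<And>s. s \<in> {t..T} \<Longrightarrow> norm (z s) \<le> B"
    using B1 B2 unfolding B_def by fastforce+
  obtain R where R: "0 < R" "\<forall>s\<in>{t..T}. norm (x s) \<le> R"
    using bx unfolding bounded_measurable_on_def bounded_pos by auto
  define C where "C = B * (1 + R + R)"
  have C: "0 < C" unfolding C_def using B R by simp
  show ?thesis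
    unfolding L
  proof (rule tendstoI)
    fix e :: real assume e: "0 < e"
    define e' where "e' = e / 2 * inverse (C * (T - t))"
    have e': "0 < e'" using e C t by (simp add: e'_def)
    have "uniformly_continuous_on {t..T} x" by (rule compact_uniformly_continuous[OF x]) simp
    then obtain d where d: "0 < d" "\<And>r s. r \<in> {t..T} \<Longrightarrow> s \<in> {t..T} \<Longrightarrow> dist s r < d \<Longrightarrow> dist (x s) (x r) < e'"
      using e' unfolding uniformly_continuous_on_def by metis
    show "\<forall>\<^sub>F n in sequentially. dist (\<Sum>k<n. stage_cost Q z t T n k (x (grid t T n k))) (integral {t..T} (\<lambda>s. ?l s (x s))) < e"
      using eventually_grid_fine[OF d(1), of T t] eventually_gt_at_top[of 0]
    proof eventually_elim
      case (elim n)
      have "integral {t..T} (\<lambda>s. ?l s (x s)) = (\<Sum>k<n. integral (cell t T n k) (\<lambda>s. ?l s (x s)))"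
        using sum_cell_integrals[OF il, of n n] t elim(2) by (simp add: grid_end)
      then have "dist (\<Sum>k<n. stage_cost Q z t T n k (x (grid t T n k))) (integral {t..T} (\<lambda>s. ?l s (x s)))
        = norm (\<Sum>k<n. stage_cost Q z t T n k (x (grid t T n k)) - integral (cell t T n k) (\<lambda>s. ?l s (x s)))"
        by (simp add: dist_norm sum_subtractf)
      also have "\<dots> \<le> (\<Sum>k<n. C * e' * ((T - t) / real n))"
      proof (intro order_trans[OF norm_sum] sum_mono)
        fix k assume "k \<in> {..<n}"
        then have k: "k < n" by simp
        have tT: "t \<le> T" using t by simp
        note sub = cell_subset[OF tT k]
        let ?y = "x (grid t T n k)"
        have gk: "grid t T n k \<in> {t..T}" using sub grid_mono[OF tT, of k "Suc k" n] by auto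
        have i1: "(\<lambda>s. ?l s ?y) integrable_on cell t T n k"
          by (rule stage_cost_eq_integral[OF Q z tT k])
        have i2: "(\<lambda>s. ?l s (x s)) integrable_on cell t T n k" by (rule integrable_subinterval_real[OF il sub])
        have "norm (stage_cost Q z t T n k ?y - integral (cell t T n k) (\<lambda>s. ?l s (x s)))
          = norm (integral (cell t T n k) (\<lambda>s. ?l s ?y - ?l s (x s)))"
          unfolding stage_cost_eq_integral(2)[OF Q z tT k] Henstock_Kurzweil_Integration.integral_diff[OF i1 i2] ..
        also have "\<dots> \<le> integral (cell t T n k) (\<lambda>_. C * e')"
        proof (rule integral_norm_bound_integral)
          show "(\<lambda>s. ?l s ?y - ?l s (x s)) integrable_on cell t T n k" by (rule integrable_diff[OF i1 i2])
          fix s assume s: "s \<in> cell t T n k"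
          then have sT: "s \<in> {t..T}" using sub by blast
          have "dist s (grid t T n k) < d" using s elim(1) grid_Suc[of t T n k] by (auto simp: dist_real_def)
          then have dx: "norm (?y - x s) \<le> e'" using d(2)[OF gk sT] by (simp add: dist_norm norm_minus_commute)
          have "norm (?l s ?y - ?l s (x s)) \<le> B * (1 + norm ?y + norm (x s)) * norm (?y - x s)"
            using quadratic_form_diff_le[OF B(2,3)[OF sT], of ?y "x s"] by simp
          also have "\<dots> \<le> C * e'"
            unfolding C_def using R(1) R(2)[rule_format, OF gk] R(2)[rule_format, OF sT] B(1) dx
            by (intro mult_mono) auto
          finally show "norm (?l s ?y - ?l s (x s)) \<le> C * e'" .
        qed (rule integrable_const_ivl)
        also have "\<dots> = C * e' * ((T - t) / real n)" using grid_mono[OF tT, of k "Suc k" n] by (simp add: grid_Suc)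
        finally show "norm (stage_cost Q z t T n k ?y - integral (cell t T n k) (\<lambda>s. ?l s (x s))) \<le> C * e' * ((T - t) / real n)" .
      qed
      also have "\<dots> = e' * (C * (T - t))" using elim(2) by simp
      also have "\<dots> = e / 2" unfolding e'_def mult.assoc by (subst left_inverse) (use t C in auto)
      also have "\<dots> < e" using e by simp
      finally show ?case .
    qed
  qed
qed

section \<open>Gaussian exponentials along Brownian increments\<close>

definition gauss_exp :: "real^'n^'n \<Rightarrow> real^'n \<Rightarrow> real \<Rightarrow> real^'n \<Rightarrow> real" where
  "gauss_exp V b \<gamma> x = exp (- 1/2 * (x \<bullet> (V *v x)) - b \<bullet> x - \<gamma>)"

text \<open>Coercivity of \<open>V\<close> dominates the linear term; the polynomial is absorbed by
\<open>u ^ 4 \<le> 256 * exp u\<close>. This is what makes all error terms below uniform in the starting point, since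
they are polynomials of degree at most four times such an exponential.\<close>

lemma gauss_exp_decay:
  fixes V :: "real^'n^'n"
  assumes c: "0 < c" and B: "0 \<le> B" and b: "norm b \<le> B" and \<gamma>: "\<bar>\<gamma>\<bar> \<le> B"
    and V: "c * (norm x)\<^sup>2 \<le> x \<bullet> (V *v x)"
  shows "(1 + norm x) ^ 4 * gauss_exp V b \<gamma> x \<le> 256 * exp (1 + B + (B + 1)\<^sup>2 / (2 * c))"
proof -
  let ?r = "norm x"
  have "1 + (1 + ?r) / 4 \<le> exp ((1 + ?r) / 4)" by (rule exp_ge_add_one_self)
  then have "(1 + ?r) / 4 \<le> exp ((1 + ?r) / 4)" by linarith
  then have "((1 + ?r) / 4) ^ 4 \<le> exp ((1 + ?r) / 4) ^ 4" by (intro power_mono) auto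
  also have "\<dots> = exp (1 + ?r)" by (simp flip: exp_of_nat_mult)
  finally have p4: "(1 + ?r) ^ 4 \<le> 256 * exp (1 + ?r)" by (simp add: power_divide)
  have "- (b \<bullet> x) \<le> B * ?r"
    using Cauchy_Schwarz_ineq2[of b x] mult_right_mono[OF b norm_ge_zero[of x]] by linarith
  then have "- 1/2 * (x \<bullet> (V *v x)) - b \<bullet> x - \<gamma> \<le> - c / 2 * ?r\<^sup>2 + B * ?r + B"
    using V \<gamma> by (simp add: field_simps)
  then have e: "gauss_exp V b \<gamma> x \<le> exp (- c / 2 * ?r\<^sup>2 + B * ?r + B)" unfolding gauss_exp_def by simp
  have "(1 + ?r) ^ 4 * gauss_exp V b \<gamma> x \<le> (256 * exp (1 + ?r)) * exp (- c / 2 * ?r\<^sup>2 + B * ?r + B)"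
    by (intro mult_mono p4 e) (auto simp: gauss_exp_def)
  also have "\<dots> = 256 * exp (1 + ?r + (- c / 2 * ?r\<^sup>2 + B * ?r + B))" by (simp add: exp_add)
  also have "\<dots> \<le> 256 * exp (1 + B + (B + 1)\<^sup>2 / (2 * c))"
  proof -
    have "0 \<le> (c * ?r - (B + 1))\<^sup>2 / (2 * c)" using c by simp
    also have "\<dots> = c / 2 * ?r\<^sup>2 - (B + 1) * ?r + (B + 1)\<^sup>2 / (2 * c)"
      using c by (simp add: power2_eq_square field_simps)
    finally have "1 + ?r + (- c / 2 * ?r\<^sup>2 + B * ?r + B) \<le> 1 + B + (B + 1)\<^sup>2 / (2 * c)"
      by (simp add: algebra_simps)
    then show ?thesis by simp
  qed
  finally show ?thesis .
qed

text \<open>Third-order Taylor expansion along the segment from \<open>x\<close> to \<open>x + \<xi>\<close>, on which the function is the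
exponential of a quadratic polynomial in one variable. Its logarithmic derivative is
\<open>- q u = - ((V *v y + b) \<bullet> \<xi>)\<close> at the point \<open>y\<close> reached at parameter \<open>u\<close>.\<close>

lemma gauss_exp_taylor:
  fixes V :: "real^'n^'n"
  assumes V_sym: "transpose V = V" and V: "norm V \<le> B" and b: "norm b \<le> B"
    and decay: "\<And>y. (1 + norm y) ^ 4 * gauss_exp V b \<gamma> y \<le> C"
  shows "\<bar>gauss_exp V b \<gamma> (x + \<xi>) - gauss_exp V b \<gamma> x *
      (1 - (V *v x + b) \<bullet> \<xi> + 1/2 * (((V *v x + b) \<bullet> \<xi>)\<^sup>2 - \<xi> \<bullet> (V *v \<xi>)))\<bar>
    \<le> (3 * B\<^sup>2 + B ^ 3) * C * norm \<xi> ^ 3"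
proof -
  have B: "0 \<le> B" using V norm_ge_zero order_trans by blast
  define \<beta> where "\<beta> = (V *v x + b) \<bullet> \<xi>"
  define \<kappa> where "\<kappa> = \<xi> \<bullet> (V *v \<xi>)"
  define g where "g u = gauss_exp V b \<gamma> (x + u *\<^sub>R \<xi>)" for u
  define q where "q u = \<beta> + \<kappa> * u" for u
  \<comment> \<open>Symmetry merges the two cross terms of the quadratic form.\<close>
  have sw: "x \<bullet> (V *v \<xi>) = \<xi> \<bullet> (V *v x)"
    using inner_matrix_vector_transpose[of x V \<xi>] V_sym by (simp add: inner_commute)
  have g: "g u = exp (- 1/2 * (x \<bullet> (V *v x)) - b \<bullet> x - \<gamma> - \<beta> * u - 1/2 * \<kappa> * u\<^sup>2)" for u
    unfolding g_def gauss_exp_def \<beta>_def \<kappa>_def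
    by (simp add: matrix_vector_right_distrib matrix_vector_mult_scaleR inner_add_left inner_add_right sw
        power2_eq_square algebra_simps inner_commute)
  define diff where "diff m u = (if m = 0 then g u else if m = 1 then - q u * g u
      else if m = 2 then ((q u)\<^sup>2 - \<kappa>) * g u else (3 * \<kappa> * q u - q u ^ 3) * g u)" for m :: nat and u
  have dg: "(g has_real_derivative - q u * g u) (at u)" for u
    unfolding g q_def by (auto intro!: derivative_eq_intros simp: algebra_simps)
  have dq: "(q has_real_derivative \<kappa>) (at u)" for u
    unfolding q_def by (auto intro!: derivative_eq_intros)
  have "DERIV (diff m) u :> diff (Suc m) u" if "m < 3" for m u
  proof -
    have "m = 0 \<or> m = 1 \<or> m = 2" using that by auto
    then show ?thesis
    proof (elim disjE)
      assume 1: "m = 0"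
      show ?thesis using dg[of u] unfolding 1 diff_def by simp
    next
      assume 2: "m = 1"
      show ?thesis unfolding 2 diff_def
        by (auto intro!: derivative_eq_intros dg dq simp: power2_eq_square algebra_simps)
    next
      assume 3: "m = 2"
      show ?thesis unfolding 3 diff_def
        by (auto intro!: derivative_eq_intros dg dq simp: power2_eq_square power3_eq_cube algebra_simps)
    qed
  qed
  moreover have d0: "diff 0 = g" by (rule ext) (simp add: diff_def)
  ultimately obtain u where u: "0 < u" "u < 1" "g 1 = (\<Sum>m<3. diff m 0 / fact m * 1 ^ m) + diff 3 u / fact 3 * 1 ^ 3"
    using Maclaurin[of 1 3 diff g, OF _ _ d0] by auto
  have "(\<Sum>m<3. diff m 0 / fact m * 1 ^ m) = g 0 * (1 - \<beta> + 1/2 * (\<beta>\<^sup>2 - \<kappa>))"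
    by (simp add: eval_nat_numeral diff_def q_def algebra_simps)
  then have e: "g 1 - g 0 * (1 - \<beta> + 1/2 * (\<beta>\<^sup>2 - \<kappa>)) = diff 3 u / 6"
    using u(3) by (simp add: fact_numeral)
  let ?y = "x + u *\<^sub>R \<xi>" and ?n = "norm \<xi>"
  have qu: "q u = (V *v ?y + b) \<bullet> \<xi>"
    unfolding q_def \<beta>_def \<kappa>_def
    by (simp add: matrix_vector_right_distrib matrix_vector_mult_scaleR inner_add_left inner_commute algebra_simps)
  have "norm (V *v ?y + b) \<le> B * norm ?y + B"
    using norm_matrix_vector_mult_le[of V ?y] mult_right_mono[OF V norm_ge_zero[of ?y]] b
    by (intro norm_triangle_le) linarith
  then have "norm (V *v ?y + b) \<le> B * (1 + norm ?y)" by (simp add: algebra_simps)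
  then have q1: "\<bar>q u\<bar> \<le> B * (1 + norm ?y) * ?n"
    unfolding qu by (intro order_trans[OF Cauchy_Schwarz_ineq2] mult_right_mono) auto
  have k1: "\<bar>\<kappa>\<bar> \<le> B * ?n\<^sup>2"
  proof -
    have "\<bar>\<kappa>\<bar> \<le> ?n * (norm V * ?n)"
      unfolding \<kappa>_def by (intro order_trans[OF Cauchy_Schwarz_ineq2] mult_left_mono norm_matrix_vector_mult_le) auto
    also have "\<dots> \<le> ?n * (B * ?n)" by (intro mult_left_mono mult_right_mono V) auto
    finally show ?thesis by (simp add: power2_eq_square mult_ac)
  qed
  let ?Y = "1 + norm ?y"
  have Y: "1 \<le> ?Y" by simp
  have "\<bar>3 * \<kappa> * q u - q u ^ 3\<bar> \<le> 3 * \<bar>\<kappa>\<bar> * \<bar>q u\<bar> + \<bar>q u\<bar> ^ 3"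
    by (rule order_trans[OF abs_triangle_ineq4]) (simp add: abs_mult power_abs)
  also have "\<dots> \<le> 3 * (B * ?n\<^sup>2) * (B * ?Y * ?n) + (B * ?Y * ?n) ^ 3"
    using B by (intro add_mono mult_mono power_mono q1 k1 mult_left_mono) auto
  also have "\<dots> = (3 * B\<^sup>2 * ?Y + B ^ 3 * ?Y ^ 3) * ?n ^ 3"
    by (simp add: power2_eq_square power3_eq_cube algebra_simps)
  also have "\<dots> \<le> (3 * B\<^sup>2 * ?Y ^ 4 + B ^ 3 * ?Y ^ 4) * ?n ^ 3"
    using B power_increasing[OF _ Y, of 1 4] power_increasing[OF _ Y, of 3 4]
    by (intro mult_right_mono add_mono mult_left_mono) auto
  also have "\<dots> = (3 * B\<^sup>2 + B ^ 3) * ?n ^ 3 * ?Y ^ 4" by (simp add: algebra_simps)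
  finally have "\<bar>3 * \<kappa> * q u - q u ^ 3\<bar> * g u \<le> ((3 * B\<^sup>2 + B ^ 3) * ?n ^ 3 * ?Y ^ 4) * g u"
    by (rule mult_right_mono) (simp add: g)
  also have "\<dots> \<le> (3 * B\<^sup>2 + B ^ 3) * ?n ^ 3 * C"
    unfolding mult.assoc using decay[of ?y] B by (intro mult_left_mono) (auto simp: g_def)
  finally have "\<bar>diff 3 u\<bar> \<le> (3 * B\<^sup>2 + B ^ 3) * ?n ^ 3 * C"
    by (simp add: diff_def abs_mult g)
  moreover have "\<bar>diff 3 u / 6\<bar> \<le> \<bar>diff 3 u\<bar>" by simp
  ultimately have "\<bar>g 1 - g 0 * (1 - \<beta> + 1/2 * (\<beta>\<^sup>2 - \<kappa>))\<bar> \<le> (3 * B\<^sup>2 + B ^ 3) * C * ?n ^ 3"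
    unfolding e by (simp add: mult_ac)
  then show ?thesis unfolding \<beta>_def \<kappa>_def g_def by simp
qed

lemma gauss_exp_measurable [measurable]: "gauss_exp V b \<gamma> \<in> borel_measurable borel"
  unfolding gauss_exp_def
  by (intro borel_measurable_continuous_onI continuous_intros
      bounded_linear.continuous_on[OF bounded_bilinear.bounded_linear_right[OF bounded_bilinear_matrix_vector_mult]])

lemma trace_mult_transpose: "trace (V ** (A ** transpose A)) = A \<bullet> (V ** A)" if "transpose V = V"
  for A V :: "real^'n^'n"
proof -
  have "trace (V ** (A ** transpose A)) = trace ((V ** A) ** transpose A)"
    by (simp only: matrix_mul_assoc)
  also have "\<dots> = trace (transpose A ** (V ** A))" by (rule trace_mul_sym)
  also have "\<dots> = A \<bullet> (V ** A)"
    unfolding trace_def matrix_matrix_mult_def inner_vec_def transpose_def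
    by (simp add: sum_distrib_left) (rule sum.swap)
  finally show ?thesis .
qed

lemma trace_mult_eq_inner: "trace (V ** S) = transpose V \<bullet> S" for V S :: "real^'n^'n"
  unfolding trace_def matrix_matrix_mult_def inner_vec_def transpose_def
  by simp (rule sum.swap)

context brownian_motion begin

lemma increment_linear_expectation:
  assumes "0 \<le> s" "s \<le> t"
  shows "integrable M (\<lambda>\<omega>. a \<bullet> (W t \<omega> - W s \<omega>))" "expectation (\<lambda>\<omega>. a \<bullet> (W t \<omega> - W s \<omega>)) = 0"
    and "integrable M (\<lambda>\<omega>. (a \<bullet> (W t \<omega> - W s \<omega>))\<^sup>2)"
    and "expectation (\<lambda>\<omega>. (a \<bullet> (W t \<omega> - W s \<omega>))\<^sup>2) = (t - s) * (a \<bullet> a)"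
proof -
  have l: "a \<bullet> (W t \<omega> - W s \<omega>) = (\<Sum>i\<in>UNIV. a $ i * (W t \<omega> - W s \<omega>) $ i)" for \<omega>
    unfolding inner_vec_def by simp
  note i = integrable_mult_right[OF increment_integrable[OF assms]]
  show "integrable M (\<lambda>\<omega>. a \<bullet> (W t \<omega> - W s \<omega>))"
    unfolding l by (intro Bochner_Integration.integrable_sum i)
  show "expectation (\<lambda>\<omega>. a \<bullet> (W t \<omega> - W s \<omega>)) = 0"
    unfolding l by (subst Bochner_Integration.integral_sum)
      (auto simp only: i integral_mult_right_zero increment_moment(2)[OF assms] mult_zero_right sum.neutral_const)
  have l2: "(a \<bullet> (W t \<omega> - W s \<omega>))\<^sup>2 =
      (\<Sum>i\<in>UNIV. \<Sum>j\<in>UNIV. (a $ i * a $ j) * ((W t \<omega> - W s \<omega>) $ i * (W t \<omega> - W s \<omega>) $ j))" for \<omega>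
    unfolding l power2_eq_square sum_product by (intro sum.cong refl) (simp only: mult_ac)
  note i2 = integrable_mult_right[OF increment_product_integrable[OF assms assms]]
  show "integrable M (\<lambda>\<omega>. (a \<bullet> (W t \<omega> - W s \<omega>))\<^sup>2)"
    unfolding l2 by (intro Bochner_Integration.integrable_sum i2)
  have "expectation (\<lambda>\<omega>. (a \<bullet> (W t \<omega> - W s \<omega>))\<^sup>2)
      = (\<Sum>i\<in>UNIV. \<Sum>j\<in>UNIV. (a $ i * a $ j) * (if i = j then t - s else 0))"
    unfolding l2
    by (simp only: Bochner_Integration.integral_sum Bochner_Integration.integrable_sum i2
        integral_mult_right_zero increment_covariance[OF assms])
  also have "\<dots> = (t - s) * (a \<bullet> a)"
    by (simp add: inner_vec_def sum_distrib_left if_distrib[of "\<lambda>x. _ * x"] mult_ac cong: if_cong)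
  finally show "expectation (\<lambda>\<omega>. (a \<bullet> (W t \<omega> - W s \<omega>))\<^sup>2) = (t - s) * (a \<bullet> a)" .
qed

text \<open>The expectation of the Taylor polynomial involves only the mean and the covariance of the increment,
and the remainder its third moment, which is of order \<open>(t - s) * sqrt (t - s)\<close>. The resulting
correction is the length of the time step times the generator of the diffusion with covariance
\<open>A ** transpose A\<close>, applied to the Gaussian.\<close>

lemma gauss_exp_increment_expectation:
  fixes V A :: "real^'n^'n"
  assumes st: "0 \<le> s" "s \<le> t"
    and V_sym: "transpose V = V" and V: "norm V \<le> B" and b: "norm b \<le> B" and A: "norm A \<le> B"
    and decay: "\<And>y. (1 + norm y) ^ 4 * gauss_exp V b \<gamma> y \<le> C"
  shows "\<bar>expectation (\<lambda>\<omega>. gauss_exp V b \<gamma> (x + A *v (W t \<omega> - W s \<omega>))) -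
      gauss_exp V b \<gamma> x * (1 + (t - s) / 2 *
        ((V *v x + b) \<bullet> ((A ** transpose A) *v (V *v x + b)) - trace (V ** (A ** transpose A))))\<bar>
    \<le> (3 * B\<^sup>2 + B ^ 3) * C * B ^ 3 * (2 * (real CARD('n))\<^sup>2) * ((t - s) * sqrt (t - s))"
proof -
  let ?D = "\<lambda>\<omega>. W t \<omega> - W s \<omega>" and ?p = "V *v x + b" and ?G = "gauss_exp V b \<gamma>"
  let ?a = "transpose A *v ?p"
  have B: "0 \<le> B" using V norm_ge_zero order_trans by blast
  have C: "0 \<le> C" using decay[of 0] by (auto simp: gauss_exp_def intro: order_trans[OF exp_ge_zero])
  have G: "0 \<le> ?G y \<and> ?G y \<le> C" for y
  proof -
    have g: "0 \<le> ?G y" by (simp add: gauss_exp_def)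
    have "1 * ?G y \<le> (1 + norm y) ^ 4 * ?G y" by (intro mult_right_mono one_le_power g) simp
    then show ?thesis using decay[of y] g by linarith
  qed
  have pa: "?p \<bullet> (A *v w) = ?a \<bullet> w" for w by (rule inner_matrix_vector_transpose)
  have mD [measurable]: "?D \<in> borel_measurable M" by (rule increment_measurable) (use st in auto)
  have iG: "integrable M (\<lambda>\<omega>. ?G (x + A *v ?D \<omega>))"
  proof (rule integrable_const_bound[where B = C])
    show "(\<lambda>\<omega>. ?G (x + A *v ?D \<omega>)) \<in> borel_measurable M"
      by (intro measurable_compose[OF _ gauss_exp_measurable] borel_measurable_add borel_measurable_const
          borel_measurable_matrix_vector_mult mD)
  qed (use G in auto)
  define R where "R \<omega> = ?G (x + A *v ?D \<omega>) - ?G x * (1 - ?a \<bullet> ?D \<omega> + 1/2 * ((?a \<bullet> ?D \<omega>)\<^sup>2 - (A *v ?D \<omega>) \<bullet> ((V ** A) *v ?D \<omega>)))" for \<omega>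
  note lin = increment_linear_expectation[OF st, of ?a]
  note quad = increment_image_inner[OF st st, of A "V ** A"]
  have k: "(\<integral>r. indicator {s<..t} r * indicator {s<..t} r \<partial>lborel) = t - s"
    using st by (simp add: indicator_inter_arith[symmetric])
  have iT: "integrable M (\<lambda>\<omega>. ?G x * (1 - ?a \<bullet> ?D \<omega> + 1/2 * ((?a \<bullet> ?D \<omega>)\<^sup>2 - (A *v ?D \<omega>) \<bullet> ((V ** A) *v ?D \<omega>))))"
    by (intro integrable_mult_right Bochner_Integration.integrable_add Bochner_Integration.integrable_diff lin quad integrable_const)
  have iR: "integrable M R" unfolding R_def by (rule Bochner_Integration.integrable_diff[OF iG iT])
  have ET: "expectation (\<lambda>\<omega>. ?G x * (1 - ?a \<bullet> ?D \<omega> + 1/2 * ((?a \<bullet> ?D \<omega>)\<^sup>2 - (A *v ?D \<omega>) \<bullet> ((V ** A) *v ?D \<omega>))))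
     = ?G x * (1 + (t - s) / 2 * (?a \<bullet> ?a - A \<bullet> (V ** A)))"
  proof -
    have "expectation (\<lambda>\<omega>. (1 - ?a \<bullet> ?D \<omega>) + 1/2 * ((?a \<bullet> ?D \<omega>)\<^sup>2 - (A *v ?D \<omega>) \<bullet> ((V ** A) *v ?D \<omega>)))
      = expectation (\<lambda>\<omega>. 1 - ?a \<bullet> ?D \<omega>) + expectation (\<lambda>\<omega>. 1/2 * ((?a \<bullet> ?D \<omega>)\<^sup>2 - (A *v ?D \<omega>) \<bullet> ((V ** A) *v ?D \<omega>)))"
      by (intro Bochner_Integration.integral_add integrable_mult_right Bochner_Integration.integrable_diff lin quad integrable_const)
    also have "expectation (\<lambda>\<omega>. 1 - ?a \<bullet> ?D \<omega>) = 1"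
      by (subst Bochner_Integration.integral_diff[OF integrable_const lin(1)]) (simp only: lin(2), simp add: prob_space)
    also have "expectation (\<lambda>\<omega>. 1/2 * ((?a \<bullet> ?D \<omega>)\<^sup>2 - (A *v ?D \<omega>) \<bullet> ((V ** A) *v ?D \<omega>)))
        = 1/2 * ((t - s) * (?a \<bullet> ?a) - (A \<bullet> (V ** A)) * (t - s))"
      unfolding integral_mult_right_zero
      by (subst Bochner_Integration.integral_diff[OF lin(3) quad(1)]) (simp only: lin(4) quad(2) k)
    finally have e: "expectation (\<lambda>\<omega>. (1 - ?a \<bullet> ?D \<omega>) + 1/2 * ((?a \<bullet> ?D \<omega>)\<^sup>2 - (A *v ?D \<omega>) \<bullet> ((V ** A) *v ?D \<omega>)))
      = 1 + 1/2 * ((t - s) * (?a \<bullet> ?a) - (A \<bullet> (V ** A)) * (t - s))" .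
    have "1 + 1/2 * ((t - s) * u - v * (t - s)) = 1 + (t - s) / 2 * (u - v)" for u v by (simp add: field_simps)
    then show ?thesis unfolding integral_mult_right_zero e by simp
  qed
  have aa: "?a \<bullet> ?a = ?p \<bullet> ((A ** transpose A) *v ?p)"
    unfolding matrix_vector_mul_assoc[symmetric] pa ..
  have RE: "expectation (\<lambda>\<omega>. ?G (x + A *v ?D \<omega>)) - ?G x * (1 + (t - s) / 2 * (?p \<bullet> ((A ** transpose A) *v ?p) - trace (V ** (A ** transpose A))))
      = expectation R"
    unfolding R_def Bochner_Integration.integral_diff[OF iG iT] ET aa trace_mult_transpose[OF V_sym] ..
  have "\<bar>expectation R\<bar> \<le> expectation (\<lambda>\<omega>. (3 * B\<^sup>2 + B ^ 3) * C * B ^ 3 * norm (?D \<omega>) ^ 3)"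
  proof (rule order_trans[OF integral_abs_bound integral_mono])
    fix \<omega>
    have "\<bar>R \<omega>\<bar> \<le> (3 * B\<^sup>2 + B ^ 3) * C * norm (A *v ?D \<omega>) ^ 3"
      using gauss_exp_taylor[OF V_sym V b decay, of x "A *v ?D \<omega>"]
      unfolding R_def pa by (simp add: matrix_vector_mul_assoc)
    also have "\<dots> \<le> (3 * B\<^sup>2 + B ^ 3) * C * (B * norm (?D \<omega>)) ^ 3"
      using B C A by (intro mult_left_mono power_mono order_trans[OF norm_matrix_vector_mult_le] mult_right_mono) auto
    finally show "\<bar>R \<omega>\<bar> \<le> (3 * B\<^sup>2 + B ^ 3) * C * B ^ 3 * norm (?D \<omega>) ^ 3" by (simp add: power_mult_distrib mult_ac)
  qed (use iR increment_norm_moments(1)[OF st] in auto)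
  also have "\<dots> \<le> (3 * B\<^sup>2 + B ^ 3) * C * B ^ 3 * (2 * (real CARD('n))\<^sup>2 * (t - s) * sqrt (t - s))"
    unfolding integral_mult_right_zero using B C
    by (intro mult_left_mono increment_norm_moments(2)[OF st]) auto
  finally show ?thesis unfolding RE by (simp add: mult_ac)
qed

end

section \<open>The value function over one cell\<close>

lemma has_ac_derivative_add:
  assumes "has_ac_derivative T y f" "has_ac_derivative T w g"
  shows "has_ac_derivative T (\<lambda>s. y s + w s) (\<lambda>s. f s + g s)"
  unfolding has_ac_derivative_def
proof (intro conjI allI impI)
  have b: "bounded_measurable_on {0..T} f" "bounded_measurable_on {0..T} g"
    using assms unfolding has_ac_derivative_def by auto
  show "bounded_measurable_on {0..T} (\<lambda>s. f s + g s)" by (intro bounded_measurable_on_add b)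
  fix r s assume rs: "0 \<le> r \<and> r \<le> s \<and> s \<le> T"
  have "integral {r..s} (\<lambda>s. f s + g s) = integral {r..s} f + integral {r..s} g"
    using rs by (intro Henstock_Kurzweil_Integration.integral_add bounded_measurable_on_imp_integrable[OF b(1)]
        bounded_measurable_on_imp_integrable[OF b(2)]) auto
  moreover have "y s - y r = integral {r..s} f" "w s - w r = integral {r..s} g"
    using assms rs unfolding has_ac_derivative_def by auto
  ultimately show "y s + w s - (y r + w r) = integral {r..s} (\<lambda>s. f s + g s)" by (simp add: algebra_simps)
qed

text \<open>The factor \<open>1 + exp q\<close>, in place of \<open>exp \<bar>q\<bar>\<close>, is essential in the application, where \<open>q\<close> grows
quadratically in space but the product of \<open>exp q\<close> with the discounted value function at the end of a
cell is the value function at its start.\<close>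

lemma exp_second_order_bound:
  fixes q :: real
  shows "\<bar>exp q - 1 - q\<bar> \<le> q\<^sup>2 * (1 + exp q)"
proof -
  have 1: "1 + q \<le> exp q" by (rule exp_ge_add_one_self)
  have "(1 - q) * exp q \<le> exp (- q) * exp q"
    using exp_ge_add_one_self[of "- q"] by (intro mult_right_mono) auto
  then have 2: "exp q - 1 \<le> q * exp q" by (simp add: algebra_simps flip: exp_add)
  have "exp q - 1 - q \<le> q * (exp q - 1)" using 2 by (simp add: algebra_simps)
  also have "\<dots> \<le> q\<^sup>2 * (1 + exp q)"
  proof (cases "0 \<le> q")
    case True
    then have "q * (exp q - 1) \<le> q * (q * exp q)" using 2 by (intro mult_left_mono)
    also have "\<dots> \<le> q\<^sup>2 * (1 + exp q)" by (simp add: power2_eq_square algebra_simps)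
    finally show ?thesis .
  next
    case False
    have "q * (exp q - 1) = (- q) * (1 - exp q)" by (simp add: algebra_simps)
    also have "\<dots> \<le> (- q) * (- q)" using False 1 by (intro mult_left_mono) linarith+
    also have "\<dots> = q\<^sup>2 * 1" by (simp add: power2_eq_square)
    also have "\<dots> \<le> q\<^sup>2 * (1 + exp q)" by (intro mult_left_mono) auto
    finally show ?thesis .
  qed
  finally show ?thesis using 1 by linarith
qed

lemma norm_covariance_diff_le:
  fixes A S :: "real^'n^'n"
  assumes "norm A \<le> B" "norm S \<le> B"
  shows "norm (S ** transpose S - A ** transpose A) \<le> 2 * B * norm (A - S)"
proof -
  have "S ** transpose S - A ** transpose A = (S - A) ** transpose S + A ** transpose (S - A)"
    by (simp add: transpose_add_minus bounded_bilinear.diff_left[OF bounded_bilinear_matrix_mult]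
        bounded_bilinear.diff_right[OF bounded_bilinear_matrix_mult])
  also have "norm \<dots> \<le> norm (S - A) * B + B * norm (S - A)"
    using assms order_trans[OF norm_ge_zero assms(1)]
    by (intro norm_triangle_le add_mono order_trans[OF norm_matrix_mult_le] mult_mono)
      (simp_all only: norm_transpose norm_ge_zero order_refl)
  finally show ?thesis by (simp add: norm_minus_commute algebra_simps)
qed

text \<open>A solution of the Riccati system together with the quantitative information used for error bounds:
one constant \<open>B\<close> for all upper and Lipschitz bounds, and one constant \<open>c\<close> of coercivity.\<close>

locale riccati_solution =
  fixes T B c :: real and \<sigma> Q V :: "real \<Rightarrow> real^'n^'n" and z b :: "real \<Rightarrow> real^'n" and \<gamma> :: "real \<Rightarrow> real"
  assumes T: "0 < T" and c: "0 < c" and B: "1 \<le> B"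
    and \<sigma>_bm: "bounded_measurable_on {0..T} \<sigma>" and Q_bm: "bounded_measurable_on {0..T} Q"
    and z_bm: "bounded_measurable_on {0..T} z"
    and \<sigma>_le: "s \<in> {0..T} \<Longrightarrow> norm (\<sigma> s) \<le> B" and Q_le: "s \<in> {0..T} \<Longrightarrow> norm (Q s) \<le> B"
    and z_le: "s \<in> {0..T} \<Longrightarrow> norm (z s) \<le> B"
    and V_le: "s \<in> {0..T} \<Longrightarrow> norm (V s) \<le> B" and b_le: "s \<in> {0..T} \<Longrightarrow> norm (b s) \<le> B"
    and \<gamma>_le: "s \<in> {0..T} \<Longrightarrow> \<bar>\<gamma> s\<bar> \<le> B"
    and V_lip: "r \<in> {0..T} \<Longrightarrow> s \<in> {0..T} \<Longrightarrow> norm (V s - V r) \<le> B * \<bar>s - r\<bar>"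
    and b_lip: "r \<in> {0..T} \<Longrightarrow> s \<in> {0..T} \<Longrightarrow> norm (b s - b r) \<le> B * \<bar>s - r\<bar>"
    and V_sym: "s \<in> {0..T} \<Longrightarrow> transpose (V s) = V s"
    and V_pos: "s \<in> {0..T} \<Longrightarrow> c * (norm x)\<^sup>2 \<le> x \<bullet> (V s *v x)"
    and Q_pos: "s \<in> {0..T} \<Longrightarrow> c * (norm x)\<^sup>2 \<le> x \<bullet> (Q s *v x)"
    and V_deriv: "has_ac_derivative T V (\<lambda>s. V s ** (\<sigma> s ** transpose (\<sigma> s)) ** V s - Q s)"
    and b_deriv: "has_ac_derivative T b (\<lambda>s. (V s ** (\<sigma> s ** transpose (\<sigma> s))) *v b s - z s)"
    and \<gamma>_deriv: "has_ac_derivative T \<gamma> (\<lambda>s. 1/2 * (b s \<bullet> ((\<sigma> s ** transpose (\<sigma> s)) *v b s)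
        - trace (V s ** (\<sigma> s ** transpose (\<sigma> s)))))"
    and V_T: "V T = Q T" and b_T: "b T = z T" and \<gamma>_T: "\<gamma> T = 0"
begin

abbreviation cov :: "real \<Rightarrow> real^'n^'n" where "cov s \<equiv> \<sigma> s ** transpose (\<sigma> s)"

definition cost :: "real \<Rightarrow> real^'n \<Rightarrow> real" where
  "cost s x = 1/2 * (x \<bullet> (Q s *v x)) + z s \<bullet> x"

definition val :: "real \<Rightarrow> real^'n \<Rightarrow> real" where
  "val s x = gauss_exp (V s) (b s) (\<gamma> s) x"

text \<open>For a smooth \<open>U\<close> with gradient \<open>p\<close> and Hessian \<open>V\<close>, the diffusion generator with covariance \<open>S\<close> maps
\<open>exp (- U)\<close> to \<open>exp (- U)\<close> times this expression. The covariance is a parameter because the true one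
at time \<open>s\<close> has to be compared with that of an approximating matrix.\<close>

definition generator :: "real \<Rightarrow> real^'n \<Rightarrow> real^'n^'n \<Rightarrow> real" where
  "generator s x S = 1/2 * ((V s *v x + b s) \<bullet> (S *v (V s *v x + b s)) - trace (V s ** S))"

lemma cov_sym: "transpose (cov s) = cov s"
  by (simp add: matrix_transpose_mul)

lemma cov_le: "s \<in> {0..T} \<Longrightarrow> norm (cov s) \<le> B * B"
  using \<sigma>_le B by (intro order_trans[OF norm_matrix_mult_le] mult_mono) auto

text \<open>The Riccati system in integrated form. Comparing coefficients of powers of \<open>x\<close>, the three equations
say that the exponent \<open>U s x = 1/2 * (x \<bullet> (V s *v x)) + b s \<bullet> x + \<gamma> s\<close> has derivative
\<open>generator s x (cov s) - cost s x\<close> in \<open>s\<close>.\<close>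

lemma value_increment:
  assumes "0 \<le> s" "s \<le> s'" "s' \<le> T"
  shows "bounded_measurable_on {0..T} (\<lambda>r. generator r x (cov r))"
    and "bounded_measurable_on {0..T} (\<lambda>r. cost r x)"
    and "val s x = exp (- integral {s..s'} (\<lambda>r. cost r x)) * val s' x
      * exp (integral {s..s'} (\<lambda>r. generator r x (cov r)))"
proof -
  have V_bm: "bounded_measurable_on {0..T} V" and b_bm: "bounded_measurable_on {0..T} b"
    using V_deriv b_deriv has_ac_derivative_bounded_measurable by blast+
  have cov_bm: "bounded_measurable_on {0..T} cov"
    by (intro bounded_measurable_on_matrix_mult bounded_measurable_on_transpose \<sigma>_bm)
  show bg: "bounded_measurable_on {0..T} (\<lambda>r. generator r x (cov r))"
    unfolding generator_def
    by (intro bounded_measurable_on_linear[OF bounded_linear_mult_right] bounded_measurable_on_diff bounded_measurable_on_add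
        bounded_measurable_on_inner bounded_measurable_on_matrix_vector_mult bounded_measurable_on_matrix_mult
        bounded_measurable_on_linear[OF bounded_linear_trace] V_bm b_bm cov_bm bounded_measurable_on_const
        bounded_measurable_on_transpose \<sigma>_bm)
  show bc: "bounded_measurable_on {0..T} (\<lambda>r. cost r x)"
    unfolding cost_def
    by (intro bounded_measurable_on_linear[OF bounded_linear_mult_right] bounded_measurable_on_add
        bounded_measurable_on_inner bounded_measurable_on_matrix_vector_mult Q_bm z_bm bounded_measurable_on_const)
  define U where "U s = 1/2 * (x \<bullet> (V s *v x)) + b s \<bullet> x + \<gamma> s" for s
  have bl: "bounded_linear (\<lambda>M. 1/2 * (x \<bullet> (M *v x)))"
    by (intro bounded_linear_compose[OF bounded_linear_mult_right] bounded_linear_compose[OF bounded_linear_inner_right]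
        bounded_bilinear.bounded_linear_left[OF bounded_bilinear_matrix_vector_mult])
  have "has_ac_derivative T U (\<lambda>r. generator r x (cov r) - cost r x)"
    unfolding U_def
  proof (rule has_ac_derivative_cong[OF has_ac_derivative_add[OF has_ac_derivative_add[OF
        has_ac_derivative_linear[OF bl V_deriv] has_ac_derivative_linear[OF bounded_linear_inner_left[of x] b_deriv]] \<gamma>_deriv]])
    fix r assume r: "r \<in> {0..T}"
    have 1: "x \<bullet> ((V r ** cov r ** V r) *v x) = (V r *v x) \<bullet> (cov r *v (V r *v x))"
      unfolding matrix_vector_mul_assoc[symmetric] inner_matrix_vector_transpose[of x "V r"] V_sym[OF r] ..
    have 2: "((V r ** cov r) *v b r) \<bullet> x = (V r *v x) \<bullet> (cov r *v b r)"
      unfolding matrix_vector_mul_assoc[symmetric]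
      by (subst inner_commute) (unfold inner_matrix_vector_transpose[of x "V r"] V_sym[OF r], rule refl)
    have 3: "b r \<bullet> (cov r *v (V r *v x)) = (V r *v x) \<bullet> (cov r *v b r)"
      unfolding inner_matrix_vector_transpose[of "b r"] cov_sym by (rule inner_commute)
    have "1/2 * (x \<bullet> ((V r ** cov r ** V r - Q r) *v x)) + ((V r ** cov r) *v b r - z r) \<bullet> x +
        1/2 * (b r \<bullet> (cov r *v b r) - trace (V r ** cov r))
      = 1/2 * (x \<bullet> ((V r ** cov r ** V r) *v x)) + ((V r ** cov r) *v b r) \<bullet> x
        + 1/2 * (b r \<bullet> (cov r *v b r) - trace (V r ** cov r)) - (1/2 * (x \<bullet> (Q r *v x)) + z r \<bullet> x)"
      unfolding matrix_vector_mult_diff_rdistrib inner_diff_left inner_diff_right by (simp add: right_diff_distrib)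
    also have "\<dots> = generator r x (cov r) - cost r x"
      unfolding 1 2 generator_def cost_def matrix_vector_right_distrib inner_add_left inner_add_right 3
      by (simp add: algebra_simps)
    finally show "1/2 * (x \<bullet> ((V r ** cov r ** V r - Q r) *v x)) + ((V r ** cov r) *v b r - z r) \<bullet> x +
        1/2 * (b r \<bullet> (cov r *v b r) - trace (V r ** cov r)) = generator r x (cov r) - cost r x" .
  qed simp
  then have "U s' - U s = integral {s..s'} (\<lambda>r. generator r x (cov r) - cost r x)"
    using assms unfolding has_ac_derivative_def by auto
  also have "\<dots> = integral {s..s'} (\<lambda>r. generator r x (cov r)) - integral {s..s'} (\<lambda>r. cost r x)"
    using assms by (intro Henstock_Kurzweil_Integration.integral_diff bounded_measurable_on_imp_integrable[OF bg]
        bounded_measurable_on_imp_integrable[OF bc]) auto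
  finally have "- U s = - integral {s..s'} (\<lambda>r. cost r x) + - U s' + integral {s..s'} (\<lambda>r. generator r x (cov r))"
    by simp
  moreover have "val s x = exp (- U s)" for s
    unfolding val_def gauss_exp_def U_def by (simp add: algebra_simps)
  ultimately show "val s x = exp (- integral {s..s'} (\<lambda>r. cost r x)) * val s' x
      * exp (integral {s..s'} (\<lambda>r. generator r x (cov r)))"
    by (simp only: exp_add)
qed

lemma momentum_le: "s \<in> {0..T} \<Longrightarrow> norm (V s *v x + b s) \<le> B * (1 + norm x)"
proof -
  assume s: "s \<in> {0..T}"
  have "norm (V s *v x + b s) \<le> B * norm x + B"
    using norm_matrix_vector_mult_le[of "V s" x] mult_right_mono[OF V_le[OF s] norm_ge_zero[of x]] b_le[OF s]
    by (intro norm_triangle_le) linarith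
  then show ?thesis by (simp add: algebra_simps)
qed

lemma generator_le:
  assumes s: "s \<in> {0..T}" and S: "norm S \<le> B * B"
  shows "\<bar>generator s x S\<bar> \<le> B ^ 4 * (1 + norm x)\<^sup>2"
proof -
  let ?p = "V s *v x + b s" and ?X = "1 + norm x"
  have "\<bar>?p \<bullet> (S *v ?p)\<bar> \<le> (B * ?X) * ((B * B) * (B * ?X))"
    by (rule inner_matrix_le[OF momentum_le[OF s] S momentum_le[OF s]])
  also have "\<dots> = B ^ 4 * ?X\<^sup>2" by (simp add: power2_eq_square power4_eq_xxxx)
  finally have 1: "\<bar>?p \<bullet> (S *v ?p)\<bar> \<le> B ^ 4 * ?X\<^sup>2" .
  have "\<bar>trace (V s ** S)\<bar> \<le> B * (B * B)"
    unfolding trace_mult_eq_inner V_sym[OF s] using V_le[OF s] S B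
    by (intro order_trans[OF Cauchy_Schwarz_ineq2] mult_mono) auto
  also have "\<dots> = B ^ 3 * 1" by (simp add: power3_eq_cube)
  also have "\<dots> \<le> B ^ 4 * ?X\<^sup>2"
    using B by (intro mult_mono power_increasing one_le_power) auto
  finally have 2: "\<bar>trace (V s ** S)\<bar> \<le> B ^ 4 * ?X\<^sup>2" .
  have "\<bar>?p \<bullet> (S *v ?p) - trace (V s ** S)\<bar> \<le> 2 * (B ^ 4 * ?X\<^sup>2)" using 1 2 by linarith
  then show ?thesis unfolding generator_def by (simp add: abs_mult)
qed

lemma generator_diff_le:
  assumes r: "r \<in> {0..T}" and s: "s \<in> {0..T}" and h: "\<bar>r - s\<bar> \<le> h" and A: "norm A \<le> B"
  shows "\<bar>generator r x (cov r) - generator s x (A ** transpose A)\<bar>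
    \<le> 2 * B ^ 4 * (1 + norm x)\<^sup>2 * (h + norm (A - \<sigma> r))"
proof -
  let ?p = "V r *v x + b r" and ?p' = "V s *v x + b s" and ?X = "1 + norm x" and ?S = "A ** transpose A"
    and ?d = "norm (A - \<sigma> r)"
  have h0: "0 \<le> h" using h by linarith
  have X: "1 \<le> ?X" by simp
  have B0: "0 \<le> B" using B by simp
  have pd: "norm (?p - ?p') \<le> B * h * ?X"
  proof -
    have "?p - ?p' = (V r - V s) *v x + (b r - b s)" by (simp add: matrix_vector_mult_diff_rdistrib)
    also have "norm \<dots> \<le> (B * h) * norm x + B * h"
    proof (intro norm_triangle_le add_mono order_trans[OF norm_matrix_vector_mult_le] mult_right_mono)
      show "norm (V r - V s) \<le> B * h" using V_lip[OF s r] mult_left_mono[OF h B0] by linarith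
      show "norm (b r - b s) \<le> B * h" using b_lip[OF s r] mult_left_mono[OF h B0] by linarith
    qed simp
    finally show ?thesis by (simp add: algebra_simps)
  qed
  have Vd: "norm (V r - V s) \<le> B * h" using V_lip[OF s r] mult_left_mono[OF h B0] by linarith
  have Sd: "norm (cov r - ?S) \<le> 2 * B * ?d" by (rule norm_covariance_diff_le[OF A \<sigma>_le[OF r]])
  have "?p \<bullet> (cov r *v ?p) - ?p' \<bullet> (?S *v ?p') = (?p - ?p') \<bullet> (cov r *v ?p) + ?p' \<bullet> (cov r *v (?p - ?p'))
      + ?p' \<bullet> ((cov r - ?S) *v ?p')"
    by (simp add: inner_diff_left inner_diff_right matrix_vector_mult_diff_distrib matrix_vector_mult_diff_rdistrib)
  moreover have "\<bar>(?p - ?p') \<bullet> (cov r *v ?p)\<bar> \<le> (B * h * ?X) * ((B * B) * (B * ?X))"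
    by (rule inner_matrix_le[OF pd cov_le[OF r] momentum_le[OF r]])
  moreover have "\<bar>?p' \<bullet> (cov r *v (?p - ?p'))\<bar> \<le> (B * ?X) * ((B * B) * (B * h * ?X))"
    by (rule inner_matrix_le[OF momentum_le[OF s] cov_le[OF r] pd])
  moreover have "\<bar>?p' \<bullet> ((cov r - ?S) *v ?p')\<bar> \<le> (B * ?X) * ((2 * B * ?d) * (B * ?X))"
    by (rule inner_matrix_le[OF momentum_le[OF s] Sd momentum_le[OF s]])
  ultimately have q: "\<bar>?p \<bullet> (cov r *v ?p) - ?p' \<bullet> (?S *v ?p')\<bar>
      \<le> (B * h * ?X) * ((B * B) * (B * ?X)) + (B * ?X) * ((B * B) * (B * h * ?X)) + (B * ?X) * ((2 * B * ?d) * (B * ?X))"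
    by linarith
  have q': "\<bar>?p \<bullet> (cov r *v ?p) - ?p' \<bullet> (?S *v ?p')\<bar> \<le> 2 * B ^ 4 * (h * ?X\<^sup>2) + 2 * B ^ 3 * (?d * ?X\<^sup>2)"
    by (rule order_trans[OF q]) (simp add: power2_eq_square power3_eq_cube power4_eq_xxxx algebra_simps)
  have "trace (V r ** cov r) - trace (V s ** ?S) = (V r - V s) \<bullet> cov r + V s \<bullet> (cov r - ?S)"
    unfolding trace_mult_eq_inner V_sym[OF s] V_sym[OF r] by (simp add: inner_diff_left inner_diff_right)
  moreover have "\<bar>(V r - V s) \<bullet> cov r\<bar> \<le> (B * h) * (B * B)"
    using Vd cov_le[OF r] B0 h0 by (intro order_trans[OF Cauchy_Schwarz_ineq2] mult_mono) auto
  moreover have "\<bar>V s \<bullet> (cov r - ?S)\<bar> \<le> B * (2 * B * ?d)"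
    using V_le[OF s] Sd B0 by (intro order_trans[OF Cauchy_Schwarz_ineq2] mult_mono) auto
  ultimately have t: "\<bar>trace (V r ** cov r) - trace (V s ** ?S)\<bar> \<le> (B * h) * (B * B) + B * (2 * B * ?d)"
    by linarith
  have X2: "1 \<le> ?X\<^sup>2" by (rule one_le_power[OF X])
  have Bp: "B ^ 3 \<le> B ^ 4" "B ^ 2 \<le> B ^ 4" using B by (auto intro: power_increasing)
  have t': "\<bar>trace (V r ** cov r) - trace (V s ** ?S)\<bar> \<le> B ^ 4 * (h * ?X\<^sup>2) + 2 * B ^ 4 * (?d * ?X\<^sup>2)"
  proof (rule order_trans[OF t], rule add_mono)
    have "(B * h) * (B * B) = B ^ 3 * (h * 1)" by (simp add: power3_eq_cube)
    also have "\<dots> \<le> B ^ 4 * (h * ?X\<^sup>2)" using Bp h0 X2 B0 by (intro mult_mono) auto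
    finally show "(B * h) * (B * B) \<le> B ^ 4 * (h * ?X\<^sup>2)" .
    have "B * (2 * B * ?d) = 2 * B\<^sup>2 * (?d * 1)" by (simp add: power2_eq_square)
    also have "\<dots> \<le> 2 * B ^ 4 * (?d * ?X\<^sup>2)" using Bp X2 B0 by (intro mult_mono) auto
    finally show "B * (2 * B * ?d) \<le> 2 * B ^ 4 * (?d * ?X\<^sup>2)" .
  qed
  have "2 * B ^ 3 * (?d * ?X\<^sup>2) \<le> 2 * B ^ 4 * (?d * ?X\<^sup>2)" using Bp by (intro mult_right_mono) auto
  moreover have "0 \<le> B ^ 4 * (h * ?X\<^sup>2)" using h0 B0 by simp
  ultimately have "\<bar>(?p \<bullet> (cov r *v ?p) - trace (V r ** cov r)) - (?p' \<bullet> (?S *v ?p') - trace (V s ** ?S))\<bar>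
      \<le> 4 * (B ^ 4 * (h * ?X\<^sup>2)) + 4 * (B ^ 4 * (?d * ?X\<^sup>2))"
    using q' t' by linarith
  then have "\<bar>1/2 * (?p \<bullet> (cov r *v ?p) - trace (V r ** cov r)) - 1/2 * (?p' \<bullet> (?S *v ?p') - trace (V s ** ?S))\<bar>
      \<le> 2 * (B ^ 4 * (h * ?X\<^sup>2)) + 2 * (B ^ 4 * (?d * ?X\<^sup>2))"
    by (simp add: field_simps abs_le_iff)
  then show ?thesis unfolding generator_def by (simp add: algebra_simps)
qed


definition decay_const :: real where
  "decay_const = 256 * exp (1 + B + (B + 1)\<^sup>2 / (2 * c))"

lemma decay_const_pos: "0 < decay_const" unfolding decay_const_def by simp

lemma value_decay: "s \<in> {0..T} \<Longrightarrow> (1 + norm x) ^ 4 * val s x \<le> decay_const"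
  unfolding val_def decay_const_def
  by (rule gauss_exp_decay) (use c B b_le \<gamma>_le V_pos in auto)

lemma value_pos: "0 < val s x"
  unfolding val_def gauss_exp_def by simp

lemma cost_ge: "s \<in> {0..T} \<Longrightarrow> - (B\<^sup>2 / (2 * c)) \<le> cost s x"
proof -
  assume s: "s \<in> {0..T}"
  have "0 \<le> (c * norm x - B)\<^sup>2 / (2 * c)" using c by simp
  also have "\<dots> = c / 2 * (norm x)\<^sup>2 - B * norm x + B\<^sup>2 / (2 * c)"
    using c by (simp add: power2_eq_square field_simps)
  finally have "- (B\<^sup>2 / (2 * c)) \<le> c / 2 * (norm x)\<^sup>2 - B * norm x" by simp
  moreover have "c / 2 * (norm x)\<^sup>2 \<le> 1/2 * (x \<bullet> (Q s *v x))" using Q_pos[OF s, of x] by simp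
  moreover have "- (B * norm x) \<le> z s \<bullet> x"
    using Cauchy_Schwarz_ineq2[of "z s" x] mult_right_mono[OF z_le[OF s] norm_ge_zero[of x]] by linarith
  ultimately show ?thesis unfolding cost_def by linarith
qed

lemma integral_cost_ge:
  assumes "0 \<le> s" "s \<le> s'" "s' \<le> T"
  shows "- (B\<^sup>2 / (2 * c) * (s' - s)) \<le> integral {s..s'} (\<lambda>r. cost r x)"
proof -
  have "integral {s..s'} (\<lambda>r. - (B\<^sup>2 / (2 * c))) \<le> integral {s..s'} (\<lambda>r. cost r x)"
    using assms by (intro integral_le bounded_measurable_on_imp_integrable[OF value_increment(2)[OF assms]] cost_ge
        integrable_const_ivl) auto
  then show ?thesis using assms by (simp add: mult.commute)
qed

text \<open>By \<open>value_increment\<close> the error is that of replacing \<open>exp q\<close> by \<open>1 + q'\<close>, where \<open>q\<close> integrates the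
generator over the cell and \<open>q'\<close> freezes it at the right end with the covariance of \<open>A\<close>. The
difference \<open>q - q'\<close> is quadratic in space, the second-order error of the exponential quartic, and the
decay of the value function absorbs both.\<close>

lemma value_consistency:
  assumes s: "0 \<le> s" "s \<le> s'" "s' \<le> T" and A: "norm A \<le> B"
  shows "\<bar>exp (- integral {s..s'} (\<lambda>r. cost r x)) * (val s' x * (1 + (s' - s) * generator s' x (A ** transpose A))) - val s x\<bar>
    \<le> (4 * B ^ 8 * exp (B\<^sup>2 / (2 * c) * T) * decay_const) * ((s' - s)\<^sup>2 + integral {s..s'} (\<lambda>r. norm (A - \<sigma> r)))"
proof -
  define h where "h = s' - s"
  define L where "L = integral {s..s'} (\<lambda>r. cost r x)"
  define q where "q = integral {s..s'} (\<lambda>r. generator r x (cov r))"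
  define q' where "q' = h * generator s' x (A ** transpose A)"
  define \<epsilon> where "\<epsilon> = integral {s..s'} (\<lambda>r. norm (A - \<sigma> r))"
  let ?X = "1 + norm x"
  have X: "1 \<le> ?X" by simp
  have h: "0 \<le> h" "h \<le> T" using s unfolding h_def by auto
  have B0: "0 \<le> B" using B by simp
  have sub: "{s..s'} \<subseteq> {0..T}" and s'T: "s' \<in> {0..T}" and sT: "s \<in> {0..T}" using s by auto
  note gi = bounded_measurable_on_imp_integrable[OF value_increment(1)[OF s] sub, of x]
  have dbm: "bounded_measurable_on {0..T} (\<lambda>r. norm (A - \<sigma> r))"
    by (intro bounded_measurable_on_norm bounded_measurable_on_diff \<sigma>_bm bounded_measurable_on_const)
  note di = bounded_measurable_on_imp_integrable[OF dbm sub]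
  have \<epsilon>0: "0 \<le> \<epsilon>" unfolding \<epsilon>_def by (rule integral_norm_nonneg)
  have val: "val s x = exp (- L) * val s' x * exp q"
    unfolding L_def q_def by (rule value_increment(3)[OF s])
  have eL: "exp (- L) \<le> exp (B\<^sup>2 / (2 * c) * T)"
  proof -
    have "B\<^sup>2 / (2 * c) * (s' - s) \<le> B\<^sup>2 / (2 * c) * T" using s c by (intro mult_left_mono) auto
    then show ?thesis using integral_cost_ge[OF s, of x] unfolding L_def by simp
  qed
  have qb: "\<bar>q\<bar> \<le> B ^ 4 * ?X\<^sup>2 * h"
    unfolding q_def h_def real_norm_def[symmetric]
    by (rule bounded_measurable_on_integral_norm_le[OF value_increment(1)[OF s] sub])
      (use generator_le[OF _ cov_le] sub s in auto)
  have qd: "\<bar>q' - q\<bar> \<le> 2 * B ^ 4 * ?X\<^sup>2 * (h\<^sup>2 + \<epsilon>)"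
  proof -
    have "q' = integral {s..s'} (\<lambda>r. generator s' x (A ** transpose A))"
      unfolding q'_def h_def using s by simp
    then have "\<bar>q - q'\<bar> = norm (integral {s..s'} (\<lambda>r. generator r x (cov r) - generator s' x (A ** transpose A)))"
      unfolding q_def by (subst Henstock_Kurzweil_Integration.integral_diff[OF gi integrable_const_ivl]) simp
    also have "\<dots> \<le> integral {s..s'} (\<lambda>r. 2 * B ^ 4 * ?X\<^sup>2 * (h + norm (A - \<sigma> r)))"
    proof (rule integral_norm_bound_integral)
      show "(\<lambda>r. generator r x (cov r) - generator s' x (A ** transpose A)) integrable_on {s..s'}"
        by (intro integrable_diff gi integrable_const_ivl)
      show "(\<lambda>r. 2 * B ^ 4 * ?X\<^sup>2 * (h + norm (A - \<sigma> r))) integrable_on {s..s'}"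
        by (intro integrable_on_mult_right integrable_add integrable_const_ivl di)
      fix r assume r: "r \<in> {s..s'}"
      then have "\<bar>r - s'\<bar> \<le> h" unfolding h_def by auto
      then show "norm (generator r x (cov r) - generator s' x (A ** transpose A)) \<le> 2 * B ^ 4 * ?X\<^sup>2 * (h + norm (A - \<sigma> r))"
        using generator_diff_le[OF _ s'T _ A, of r h x] r sub by auto
    qed
    also have "\<dots> = 2 * B ^ 4 * ?X\<^sup>2 * (h * h + \<epsilon>)"
    proof -
      have "integral {s..s'} (\<lambda>r. h + norm (A - \<sigma> r)) = h * h + \<epsilon>"
        unfolding \<epsilon>_def using s
        by (subst Henstock_Kurzweil_Integration.integral_add[OF integrable_const_ivl di]) (simp add: h_def)
      then show ?thesis by simp
    qed
    finally show ?thesis by (simp add: power2_eq_square abs_minus_commute)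
  qed
  let ?E = "exp (B\<^sup>2 / (2 * c) * T)" and ?C = decay_const
  \<comment> \<open>Allows the three error terms to be collected under a single constant.\<close>
  have E1: "1 \<le> ?E" using T c by simp
  have decay2: "?X\<^sup>2 * val s' x \<le> ?C"
    by (rule order_trans[OF mult_right_mono[OF power_increasing[of 2 4]] value_decay[OF s'T]])
      (use value_pos[of s' x] in auto)
  have "exp (- L) * (val s' x * (1 + q')) - val s x = exp (- L) * val s' x * ((q' - q) - (exp q - 1 - q))"
    unfolding val by (simp add: algebra_simps)
  then have "\<bar>exp (- L) * (val s' x * (1 + q')) - val s x\<bar> = exp (- L) * val s' x * \<bar>(q' - q) - (exp q - 1 - q)\<bar>"
    using value_pos[of s' x] by (simp add: abs_mult)
  also have "\<dots> \<le> exp (- L) * val s' x * (\<bar>q' - q\<bar> + q\<^sup>2 * (1 + exp q))"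
    using exp_second_order_bound[of q] value_pos[of s' x] by (intro mult_left_mono) auto
  also have "\<dots> = exp (- L) * val s' x * \<bar>q' - q\<bar> + q\<^sup>2 * (exp (- L) * val s' x) + q\<^sup>2 * val s x"
    unfolding val by (simp add: algebra_simps)
  also have "\<dots> \<le> ?E * (2 * B ^ 4 * ?C * (h\<^sup>2 + \<epsilon>)) + ?E * (B ^ 8 * ?C * h\<^sup>2) + B ^ 8 * ?C * h\<^sup>2"
  proof (intro add_mono)
    have "exp (- L) * val s' x * \<bar>q' - q\<bar> \<le> ?E * val s' x * (2 * B ^ 4 * ?X\<^sup>2 * (h\<^sup>2 + \<epsilon>))"
      using value_pos[of s' x] by (intro mult_mono mult_right_mono eL qd) auto
    also have "\<dots> = ?E * (2 * B ^ 4 * (?X\<^sup>2 * val s' x) * (h\<^sup>2 + \<epsilon>))" by (simp add: mult_ac)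
    also have "\<dots> \<le> ?E * (2 * B ^ 4 * ?C * (h\<^sup>2 + \<epsilon>))"
      using decay2 B0 \<epsilon>0 by (intro mult_left_mono mult_right_mono) auto
    finally show "exp (- L) * val s' x * \<bar>q' - q\<bar> \<le> ?E * (2 * B ^ 4 * ?C * (h\<^sup>2 + \<epsilon>))" .
    have "\<bar>q\<bar>\<^sup>2 \<le> (B ^ 4 * ?X\<^sup>2 * h)\<^sup>2" by (intro power_mono qb) auto
    then have q2: "q\<^sup>2 \<le> B ^ 8 * ?X ^ 4 * h\<^sup>2"
      by (simp add: power_mult_distrib flip: power_mult)
    have "q\<^sup>2 * (exp (- L) * val s' x) \<le> (B ^ 8 * ?X ^ 4 * h\<^sup>2) * (?E * val s' x)"
      using value_pos[of s' x] B0 by (intro mult_mono mult_right_mono eL q2) auto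
    also have "\<dots> = ?E * (B ^ 8 * (?X ^ 4 * val s' x) * h\<^sup>2)" by (simp add: mult_ac)
    also have "\<dots> \<le> ?E * (B ^ 8 * ?C * h\<^sup>2)"
      using value_decay[OF s'T, of x] B0 by (intro mult_left_mono mult_right_mono) auto
    finally show "q\<^sup>2 * (exp (- L) * val s' x) \<le> ?E * (B ^ 8 * ?C * h\<^sup>2)" .
    have "q\<^sup>2 * val s x \<le> (B ^ 8 * ?X ^ 4 * h\<^sup>2) * val s x"
      using value_pos[of s x] by (intro mult_right_mono q2) auto
    also have "\<dots> = B ^ 8 * (?X ^ 4 * val s x) * h\<^sup>2" by (simp add: mult_ac)
    also have "\<dots> \<le> B ^ 8 * ?C * h\<^sup>2"
      using value_decay[OF sT, of x] B0 by (intro mult_left_mono mult_right_mono) auto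
    finally show "q\<^sup>2 * val s x \<le> B ^ 8 * ?C * h\<^sup>2" .
  qed
  also have "\<dots> \<le> ?E * (2 * B ^ 8 * ?C * (h\<^sup>2 + \<epsilon>)) + ?E * (B ^ 8 * ?C * (h\<^sup>2 + \<epsilon>)) + ?E * (B ^ 8 * ?C * (h\<^sup>2 + \<epsilon>))"
  proof (intro add_mono)
    have C0: "0 \<le> ?C" using decay_const_pos by simp
    show "?E * (2 * B ^ 4 * ?C * (h\<^sup>2 + \<epsilon>)) \<le> ?E * (2 * B ^ 8 * ?C * (h\<^sup>2 + \<epsilon>))"
      using B C0 \<epsilon>0 by (intro mult_left_mono mult_right_mono power_increasing) auto
    show "?E * (B ^ 8 * ?C * h\<^sup>2) \<le> ?E * (B ^ 8 * ?C * (h\<^sup>2 + \<epsilon>))"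
      using B0 C0 \<epsilon>0 by (intro mult_left_mono) auto
    have "B ^ 8 * ?C * h\<^sup>2 = 1 * (B ^ 8 * ?C * h\<^sup>2)" by simp
    also have "\<dots> \<le> ?E * (B ^ 8 * ?C * (h\<^sup>2 + \<epsilon>))"
      using B0 C0 \<epsilon>0 E1 by (intro mult_mono mult_left_mono) auto
    finally show "B ^ 8 * ?C * h\<^sup>2 \<le> ?E * (B ^ 8 * ?C * (h\<^sup>2 + \<epsilon>))" .
  qed
  also have "\<dots> = (4 * B ^ 8 * ?E * ?C) * (h\<^sup>2 + \<epsilon>)" by (simp add: algebra_simps)
  finally show ?thesis unfolding L_def q'_def h_def \<epsilon>_def .
qed

end

locale riccati_brownian = riccati_solution T B c \<sigma> Q V z b \<gamma> + brownian_motion M W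
  for T B c :: real and \<sigma> Q V :: "real \<Rightarrow> real^'n^'n" and z b :: "real \<Rightarrow> real^'n" and \<gamma> :: "real \<Rightarrow> real"
    and M :: "'w measure" and W :: "real \<Rightarrow> 'w \<Rightarrow> real^'n"
begin

definition step_const :: real where
  "step_const = exp (B\<^sup>2 / (2 * c) * T) * ((3 * B\<^sup>2 + B ^ 3) * decay_const * B ^ 3 * (2 * (real CARD('n))\<^sup>2))
    + 4 * B ^ 8 * exp (B\<^sup>2 / (2 * c) * T) * decay_const"

lemma step_const_nonneg: "0 \<le> step_const"
  unfolding step_const_def using B decay_const_pos by (intro add_nonneg_nonneg mult_nonneg_nonneg) auto

text \<open>Dynamic programming over one cell. The first two terms of the error are of higher order than the length
of the cell, the third measures how well \<open>A\<close> approximates \<open>\<sigma>\<close> there; none depends on the position.\<close>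

lemma one_step_error:
  assumes s: "0 \<le> s" "s \<le> s'" "s' \<le> T" and A: "norm A \<le> B"
  shows "\<bar>exp (- integral {s..s'} (\<lambda>r. cost r x)) * expectation (\<lambda>\<omega>. val s' (x + A *v (W s' \<omega> - W s \<omega>))) - val s x\<bar>
    \<le> step_const * ((s' - s) * sqrt (s' - s) + (s' - s)\<^sup>2 + integral {s..s'} (\<lambda>r. norm (A - \<sigma> r)))"
proof -
  let ?L = "integral {s..s'} (\<lambda>r. cost r x)" and ?\<epsilon> = "integral {s..s'} (\<lambda>r. norm (A - \<sigma> r))"
  let ?h = "s' - s" and ?e = "expectation (\<lambda>\<omega>. val s' (x + A *v (W s' \<omega> - W s \<omega>)))"
  let ?T = "val s' x * (1 + ?h * generator s' x (A ** transpose A))"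
  let ?E = "exp (B\<^sup>2 / (2 * c) * T)"
  let ?k1 = "(3 * B\<^sup>2 + B ^ 3) * decay_const * B ^ 3 * (2 * (real CARD('n))\<^sup>2)"
  let ?k2 = "4 * B ^ 8 * ?E * decay_const"
  have s'T: "s' \<in> {0..T}" using s by auto
  have B0: "0 \<le> B" using B by simp
  have k: "0 \<le> ?k1" "0 \<le> ?k2" using B0 decay_const_pos by (auto intro!: mult_nonneg_nonneg add_nonneg_nonneg)
  have "\<bar>?e - ?T\<bar> \<le> ?k1 * (?h * sqrt ?h)"
    using gauss_exp_increment_expectation[OF s(1,2) V_sym[OF s'T] V_le[OF s'T] b_le[OF s'T] A
        value_decay[OF s'T, unfolded val_def], of x]
    unfolding val_def generator_def by simp
  moreover have eL: "exp (- ?L) \<le> ?E"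
  proof -
    have "B\<^sup>2 / (2 * c) * ?h \<le> B\<^sup>2 / (2 * c) * T" using s c by (intro mult_left_mono) auto
    then show ?thesis using integral_cost_ge[OF s, of x] by simp
  qed
  ultimately have 1: "exp (- ?L) * \<bar>?e - ?T\<bar> \<le> ?E * (?k1 * (?h * sqrt ?h))"
    by (intro mult_mono) auto
  have 2: "\<bar>exp (- ?L) * ?T - val s x\<bar> \<le> ?k2 * (?h\<^sup>2 + ?\<epsilon>)" by (rule value_consistency[OF s A])
  have \<epsilon>0: "0 \<le> ?\<epsilon>" by (rule integral_norm_nonneg)
  have h: "0 \<le> ?h" using s by simp
  have "exp (- ?L) * ?e - val s x = exp (- ?L) * (?e - ?T) + (exp (- ?L) * ?T - val s x)"
    by (simp add: right_diff_distrib)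
  then have "\<bar>exp (- ?L) * ?e - val s x\<bar> \<le> exp (- ?L) * \<bar>?e - ?T\<bar> + \<bar>exp (- ?L) * ?T - val s x\<bar>"
    using abs_triangle_ineq[of "exp (- ?L) * (?e - ?T)" "exp (- ?L) * ?T - val s x"] by (simp add: abs_mult)
  also have "\<dots> \<le> ?E * (?k1 * (?h * sqrt ?h)) + ?k2 * (?h\<^sup>2 + ?\<epsilon>)" using 1 2 by linarith
  also have "\<dots> \<le> (?E * ?k1) * (?h * sqrt ?h + ?h\<^sup>2 + ?\<epsilon>) + ?k2 * (?h * sqrt ?h + ?h\<^sup>2 + ?\<epsilon>)"
    unfolding mult.assoc[of ?E ?k1, symmetric]
    using k \<epsilon>0 h by (intro add_mono mult_left_mono) (auto intro!: mult_nonneg_nonneg)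
  also have "\<dots> = step_const * (?h * sqrt ?h + ?h\<^sup>2 + ?\<epsilon>)"
    unfolding step_const_def by (simp only: distrib_right)
  finally show ?thesis .
qed

end

section \<open>The discretised problem\<close>

text \<open>The Markov chain driven by increments \<open>d\<close>. Written as a function of the increments it exhibits that
position \<open>k\<close> depends on the first \<open>k\<close> of them only, which is what independence is applied to.\<close>

definition chain :: "(nat \<Rightarrow> real^'n^'n) \<Rightarrow> real^'n \<Rightarrow> nat \<Rightarrow> (nat \<Rightarrow> real^'n) \<Rightarrow> real^'n" where
  "chain A x k d = x + (\<Sum>i<k. A i *v d i)"

lemma chain_0 [simp]: "chain A x 0 d = x" by (simp add: chain_def)

lemma chain_Suc: "chain A x (Suc k) d = chain A x k d + A k *v d k"
  by (simp add: chain_def add.assoc)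

lemma chain_cong: "(\<And>i. i < k \<Longrightarrow> d i = d' i) \<Longrightarrow> chain A x k d = chain A x k d'"
  unfolding chain_def by simp

lemma chain_measurable:
  assumes "j \<le> k"
  shows "chain A x j \<in> borel_measurable (PiM {..<k} (\<lambda>_. borel))"
  unfolding chain_def
  by (intro borel_measurable_add borel_measurable_const borel_measurable_sum borel_measurable_matrix_vector_mult
      measurable_component_singleton) (use assms in auto)

lemma chain_elementary_integral:
  "chain A x k (\<lambda>i. W (\<tau> (Suc i)) \<omega> - W (\<tau> i) \<omega>) = x + elementary_integral W k \<tau> A \<omega>"
  unfolding chain_def elementary_integral_def ..

lemma stage_cost_measurable [measurable]: "stage_cost Q z t T n k \<in> borel_measurable borel"
  unfolding stage_cost_def
  by (intro borel_measurable_continuous_onI continuous_intros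
      bounded_linear.continuous_on[OF bounded_bilinear.bounded_linear_right[OF bounded_bilinear_matrix_vector_mult]])

lemma abs_exp_minus_diff_le:
  fixes a b K :: real
  assumes "- K \<le> a" "- K \<le> b"
  shows "\<bar>exp (- a) - exp (- b)\<bar> \<le> exp K * \<bar>a - b\<bar>"
proof -
  have *: "exp (- a) - exp (- b) \<le> exp K * (b - a)" if "- K \<le> a" "a \<le> b" for a b :: real
  proof -
    have "exp (- a) - exp (- b) = exp (- a) * (1 - exp (a - b))" by (simp add: right_diff_distrib flip: exp_add)
    also have "\<dots> \<le> exp (- a) * (b - a)" using exp_ge_add_one_self[of "a - b"] by (intro mult_left_mono) (linarith, simp)
    also have "\<dots> \<le> exp K * (b - a)" using that by (intro mult_right_mono) auto
    finally show ?thesis .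
  qed
  show ?thesis
  proof (cases "a \<le> b")
    case True
    then show ?thesis using *[of a b] assms by simp
  next
    case False
    then show ?thesis using *[of b a] assms by simp
  qed
qed

lemma (in prob_space) abs_expectation_le:
  fixes f g :: "'a \<Rightarrow> real"
  assumes g: "integrable M g" and le: "AE \<omega> in M. \<bar>f \<omega>\<bar> \<le> g \<omega>"
  shows "\<bar>expectation f\<bar> \<le> expectation g"
proof (cases "integrable M f")
  case True
  show ?thesis
    by (rule order_trans[OF integral_abs_bound integral_mono_AE]) (use True g le in auto)
next
  case False
  have "0 \<le> expectation g"
    by (rule integral_nonneg_AE) (use le in eventually_elim, linarith)
  then show ?thesis using False by (simp add: not_integrable_integral_eq)
qed

text \<open>Young's inequality with a free weight \<open>\<eta>\<close>: differences of quadratic costs are bounded by a term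
small in expectation because \<open>\<eta>\<close> is, and one small because \<open>p - y\<close> is small in mean square.\<close>

lemma weighted_distance_le:
  fixes p y x Z :: "real^'n"
  assumes \<eta>: "0 < \<eta>" and p: "p = x + Z"
  shows "(1 + norm p + norm y) * norm (p - y)
    \<le> \<eta> * (1 + 8 * (norm x)\<^sup>2 + 8 * (norm Z)\<^sup>2) + (1 / (2 * \<eta>) + 1) * (norm (p - y))\<^sup>2"
proof -
  let ?w = "norm (p - y)" and ?P = "norm x + norm Z"
  have P: "norm p \<le> ?P" unfolding p by (rule norm_triangle_ineq)
  have "norm y \<le> norm p + ?w" using norm_triangle_ineq4[of p "p - y"] by simp
  then have "(1 + norm p + norm y) * ?w \<le> (1 + 2 * ?P + ?w) * ?w" using P by (intro mult_right_mono) auto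
  also have "\<dots> = (1 + 2 * ?P) * ?w + ?w\<^sup>2" by (simp add: power2_eq_square algebra_simps)
  also have "(1 + 2 * ?P) * ?w \<le> \<eta> / 2 * (1 + 2 * ?P)\<^sup>2 + 1 / (2 * \<eta>) * ?w\<^sup>2"
  proof -
    have "0 \<le> (\<eta> * (1 + 2 * ?P) - ?w)\<^sup>2 / (2 * \<eta>)" using \<eta> by simp
    also have "\<dots> = \<eta> / 2 * (1 + 2 * ?P)\<^sup>2 + 1 / (2 * \<eta>) * ?w\<^sup>2 - (1 + 2 * ?P) * ?w"
    proof -
      have "(\<eta> * m - v)\<^sup>2 / (2 * \<eta>) = \<eta> / 2 * m\<^sup>2 + 1 / (2 * \<eta>) * v\<^sup>2 - m * v" for m v
        using \<eta> by (simp add: power2_eq_square field_simps)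
      then show ?thesis .
    qed
    finally show ?thesis by simp
  qed
  also have "(1 + 2 * ?P)\<^sup>2 \<le> 2 * (1 + 8 * (norm x)\<^sup>2 + 8 * (norm Z)\<^sup>2)"
  proof -
    have "(1 + 2 * (u + v))\<^sup>2 \<le> 2 * (1 + 8 * u\<^sup>2 + 8 * v\<^sup>2)" for u v :: real
    proof -
      have "2 * (1 + 8 * u\<^sup>2 + 8 * v\<^sup>2) - (1 + 2 * (u + v))\<^sup>2 = (1 - 2 * (u + v))\<^sup>2 + 8 * (u - v)\<^sup>2"
        by (simp add: power2_eq_square algebra_simps)
      moreover have "0 \<le> (1 - 2 * (u + v))\<^sup>2 + 8 * (u - v)\<^sup>2" by simp
      ultimately show ?thesis by linarith
    qed
    then show ?thesis .
  qed
  finally show ?thesis using \<eta> by (simp add: algebra_simps)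
qed

context riccati_brownian begin

lemma cell_in: "0 \<le> t \<Longrightarrow> t \<le> T \<Longrightarrow> k < n \<Longrightarrow>
    0 \<le> grid t T n k \<and> grid t T n k \<le> grid t T n (Suc k) \<and> grid t T n (Suc k) \<le> T"
  using grid_ge[of t T n k] grid_mono[of t T k "Suc k" n] grid_le[of t T "Suc k" n] by auto

lemma stage_cost_eq:
  assumes "0 \<le> t" "t \<le> T" "k < n"
  shows "stage_cost Q z t T n k x = integral (cell t T n k) (\<lambda>r. cost r x)"
proof -
  have sub: "{t..T} \<subseteq> {0..T}" using assms by auto
  show ?thesis unfolding cost_def
    by (rule stage_cost_eq_integral(2)[OF bounded_measurable_on_subset[OF Q_bm sub]
        bounded_measurable_on_subset[OF z_bm sub] assms(2,3)]) auto
qed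

lemma stage_cost_ge:
  assumes "0 \<le> t" "t \<le> T" "k < n"
  shows "- (B\<^sup>2 / (2 * c) * ((T - t) / real n)) \<le> stage_cost Q z t T n k x"
  using integral_cost_ge[of "grid t T n k" "grid t T n (Suc k)" x] cell_in[OF assms]
  unfolding stage_cost_eq[OF assms] by (simp add: grid_Suc)

lemma stage_cost_sum_ge:
  assumes "0 \<le> t" "t \<le> T" "k \<le> n" "0 < n"
  shows "- (B\<^sup>2 / (2 * c) * T) \<le> (\<Sum>i<k. stage_cost Q z t T n i (y i))"
proof -
  have "B\<^sup>2 / (2 * c) * (real k * ((T - t) / real n)) \<le> B\<^sup>2 / (2 * c) * T"
  proof (intro mult_left_mono)
    have "real k * ((T - t) / real n) \<le> real n * ((T - t) / real n)" using assms by (intro mult_right_mono) auto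
    also have "\<dots> \<le> T" using assms by simp
    finally show "real k * ((T - t) / real n) \<le> T" .
  qed (use c in auto)
  then have "- (B\<^sup>2 / (2 * c) * T) \<le> (\<Sum>i<k. - (B\<^sup>2 / (2 * c) * ((T - t) / real n)))" by (simp add: mult_ac)
  also have "\<dots> \<le> (\<Sum>i<k. stage_cost Q z t T n i (y i))"
    using assms by (intro sum_mono stage_cost_ge) auto
  finally show ?thesis .
qed

definition discount :: "real \<Rightarrow> nat \<Rightarrow> (nat \<Rightarrow> real^'n^'n) \<Rightarrow> real^'n \<Rightarrow> nat \<Rightarrow> (nat \<Rightarrow> real^'n) \<Rightarrow> real" where
  "discount t n A x k d = exp (- (\<Sum>i<k. stage_cost Q z t T n i (chain A x i d)))"

lemma discount_le:
  assumes "0 \<le> t" "t \<le> T" "k \<le> n" "0 < n"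
  shows "discount t n A x k d \<le> exp (B\<^sup>2 / (2 * c) * T)"
  unfolding discount_def using stage_cost_sum_ge[OF assms, of "\<lambda>i. chain A x i d"] by simp

lemma discount_pos: "0 < discount t n A x k d"
  unfolding discount_def by simp

lemma discount_measurable: "discount t n A x k \<in> borel_measurable (PiM {..<k} (\<lambda>_. borel))"
  unfolding discount_def
  by (intro measurable_compose[OF _ borel_measurable_exp] borel_measurable_uminus borel_measurable_sum
      measurable_compose[OF chain_measurable stage_cost_measurable]) auto

lemma discount_cong: "(\<And>i. i < k \<Longrightarrow> d i = d' i) \<Longrightarrow> discount t n A x k d = discount t n A x k d'"
proof -
  assume "\<And>i. i < k \<Longrightarrow> d i = d' i"
  then have "chain A x i d = chain A x i d'" if "i < k" for i using that by (intro chain_cong) auto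
  then show ?thesis unfolding discount_def by (intro arg_cong[where f=exp] arg_cong[where f=uminus] sum.cong) auto
qed

definition increments :: "real \<Rightarrow> nat \<Rightarrow> 'w \<Rightarrow> nat \<Rightarrow> real^'n" where
  "increments t n \<omega> i = W (grid t T n (Suc i)) \<omega> - W (grid t T n i) \<omega>"

lemma increments_measurable: "0 \<le> t \<Longrightarrow> t \<le> T \<Longrightarrow> (\<lambda>\<omega>. increments t n \<omega> i) \<in> borel_measurable M"
  unfolding increments_def using grid_ge[of t T n i] grid_ge[of t T n "Suc i"]
  by (intro increment_measurable) auto

lemma restrict_increments_measurable:
  "0 \<le> t \<Longrightarrow> t \<le> T \<Longrightarrow> (\<lambda>\<omega>. restrict (increments t n \<omega>) J) \<in> measurable M (PiM J (\<lambda>_. borel))"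
  by (intro measurable_restrict increments_measurable)

lemma val_measurable [measurable]: "val s \<in> borel_measurable borel"
proof -
  have "val s = gauss_exp (V s) (b s) (\<gamma> s)" by (simp add: val_def fun_eq_iff)
  then show ?thesis using gauss_exp_measurable by metis
qed

lemma val_le: "s \<in> {0..T} \<Longrightarrow> val s x \<le> decay_const"
proof -
  assume s: "s \<in> {0..T}"
  have "1 * val s x \<le> (1 + norm x) ^ 4 * val s x"
    using value_pos[of s x] by (intro mult_right_mono one_le_power) auto
  then show ?thesis using value_decay[OF s, of x] by simp
qed

text \<open>Discounted costs up to stage \<open>k\<close>, followed by the value function. At \<open>k = 0\<close> this is the claimed
formula, at \<open>k = n\<close> it is the expectation of the exponential functional of the chain.\<close>

definition stage_value :: "real \<Rightarrow> nat \<Rightarrow> (nat \<Rightarrow> real^'n^'n) \<Rightarrow> real^'n \<Rightarrow> nat \<Rightarrow> real" where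
  "stage_value t n A x k = expectation (\<lambda>\<omega>. discount t n A x k (increments t n \<omega>) *
      val (grid t T n k) (chain A x k (increments t n \<omega>)))"

text \<open>The discount and the position at stage \<open>k\<close> are functions of the first \<open>k\<close> increments, of which the
next increment is independent. Integrating the latter out leaves the one-step error, uniformly in the
position.\<close>

lemma stage_value_step:
  assumes t: "0 \<le> t" "t \<le> T" and k: "k < n" and A: "\<And>k. norm (A k) \<le> B"
  shows "\<bar>stage_value t n A x (Suc k) - stage_value t n A x k\<bar>
    \<le> exp (B\<^sup>2 / (2 * c) * T) * (step_const * ((T - t) / real n * sqrt ((T - t) / real n) + ((T - t) / real n)\<^sup>2
      + integral (cell t T n k) (\<lambda>r. norm (A k - \<sigma> r))))"
proof -
  let ?s = "grid t T n k" and ?s' = "grid t T n (Suc k)" and ?D = "increments t n" and ?h = "(T - t) / real n"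
  let ?P = "PiM {..<k} (\<lambda>_. borel) :: (nat \<Rightarrow> real^'n) measure" and ?F = "PiM {k} (\<lambda>_. borel) :: (nat \<Rightarrow> real^'n) measure"
  let ?E = "exp (B\<^sup>2 / (2 * c) * T)"
  have n: "0 < n" using k by simp
  note ci = cell_in[OF t k]
  have s'T: "?s' \<in> {0..T}" and sT: "?s \<in> {0..T}" using ci by auto
  define err where "err = step_const * (?h * sqrt ?h + ?h\<^sup>2 + integral (cell t T n k) (\<lambda>r. norm (A k - \<sigma> r)))"
  define u where "u d = discount t n A x k d * exp (- stage_cost Q z t T n k (chain A x k d))" for d
  \<comment> \<open>The state at stage \<open>Suc k\<close> as a function of the past \<open>d\<close> and the next increment \<open>e k\<close>.\<close>
  define g where "g = (\<lambda>(d, e). u d * val ?s' (chain A x k d + A k *v e k))"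
  have dS: "discount t n A x (Suc k) d = u d" for d
    unfolding discount_def u_def by (simp flip: exp_add)
  have u_le: "0 < u d" "u d \<le> ?E" for d
    using discount_pos[of t n A x "Suc k" d] discount_le[OF t, of "Suc k" n A x d] k n unfolding dS by auto
  have um: "u \<in> borel_measurable ?P"
    unfolding u_def
    by (intro borel_measurable_times discount_measurable measurable_compose[OF _ borel_measurable_exp]
        borel_measurable_uminus measurable_compose[OF chain_measurable stage_cost_measurable]) auto
  have gm: "g \<in> borel_measurable (?P \<Otimes>\<^sub>M ?F)"
    unfolding g_def case_prod_beta
    by (intro borel_measurable_times measurable_compose[OF measurable_fst um] measurable_compose[OF _ val_measurable]
        borel_measurable_add measurable_compose[OF measurable_fst chain_measurable] borel_measurable_matrix_vector_mult
        measurable_compose[OF measurable_snd measurable_component_singleton]) auto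
  have gb: "\<bar>g y\<bar> \<le> ?E * decay_const" for y
    unfolding g_def case_prod_beta using u_le[of "fst y"] val_le[OF s'T] value_pos less_imp_le
    by (simp add: abs_mult) (intro mult_mono; simp add: less_imp_le)
  have p: "is_partition t (grid t T n n) n (grid t T n)" by (rule grid_partition[OF t(2)])
  note ind = past_future_indep[OF p t(1) k]
  let ?past = "\<lambda>\<omega>. restrict (?D \<omega>) {..<k}" and ?fut = "\<lambda>\<omega>. restrict (?D \<omega>) {k}"
  have ind: "indep_var ?P ?past ?F ?fut"
    using ind unfolding increments_def .
  have uc: "u (restrict d {..<k}) = u d" and cc: "chain A x k (restrict d {..<k}) = chain A x k d" for d
    unfolding u_def using discount_cong[of k "restrict d {..<k}" d] chain_cong[of k "restrict d {..<k}" d A x] by auto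
  have g_eq: "g (?past \<omega>, ?fut \<omega>') = u (?D \<omega>) * val ?s' (chain A x k (?D \<omega>) + A k *v (W ?s' \<omega>' - W ?s \<omega>'))" for \<omega> \<omega>'
    unfolding g_def by (simp add: uc cc increments_def)
  have "stage_value t n A x (Suc k) = expectation (\<lambda>\<omega>. g (?past \<omega>, ?fut \<omega>))"
    unfolding stage_value_def g_eq dS chain_Suc by (simp add: increments_def)
  also have "\<dots> = expectation (\<lambda>\<omega>. expectation (\<lambda>\<omega>'. g (?past \<omega>, ?fut \<omega>')))"
    by (rule indep_var_expectation(1)[OF ind gm gb])
  finally have SV: "stage_value t n A x (Suc k) = expectation (\<lambda>\<omega>. expectation (\<lambda>\<omega>'. g (?past \<omega>, ?fut \<omega>')))" .
  have m1: "(\<lambda>\<omega>. expectation (\<lambda>\<omega>'. g (?past \<omega>, ?fut \<omega>'))) \<in> borel_measurable M"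
    by (rule indep_var_expectation(2)[OF ind gm gb])
  have i1: "integrable M (\<lambda>\<omega>. expectation (\<lambda>\<omega>'. g (?past \<omega>, ?fut \<omega>')))"
  proof (rule integrable_const_bound[OF _ m1])
    have "\<bar>expectation (\<lambda>\<omega>'. g (?past \<omega>, ?fut \<omega>'))\<bar> \<le> ?E * decay_const" for \<omega>
    proof -
      have "\<bar>expectation (\<lambda>\<omega>'. g (?past \<omega>, ?fut \<omega>'))\<bar> \<le> expectation (\<lambda>\<omega>'. ?E * decay_const)"
        by (rule abs_expectation_le) (use gb in auto)
      then show ?thesis by (simp add: prob_space)
    qed
    then show "AE \<omega> in M. norm (expectation (\<lambda>\<omega>'. g (?past \<omega>, ?fut \<omega>'))) \<le> ?E * decay_const" by simp
  qed
  let ?v = "\<lambda>\<omega>. discount t n A x k (?D \<omega>) * val ?s (chain A x k (?D \<omega>))"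
  have i2: "integrable M ?v"
  proof (rule integrable_const_bound[where B = "?E * decay_const"])
    have "?v \<omega> = discount t n A x k (?past \<omega>) * val ?s (chain A x k (?past \<omega>))" for \<omega>
      using discount_cong[of k "?past \<omega>" "?D \<omega>"] cc by simp
    moreover have "(\<lambda>d. discount t n A x k d * val ?s (chain A x k d)) \<in> borel_measurable ?P"
      by (intro borel_measurable_times discount_measurable measurable_compose[OF chain_measurable val_measurable]) auto
    ultimately show "?v \<in> borel_measurable M"
      using measurable_compose[OF restrict_increments_measurable[OF t, of n "{..<k}"]] by simp
    show "AE \<omega> in M. norm (?v \<omega>) \<le> ?E * decay_const"
    proof (intro AE_I2)
      fix \<omega>
      show "norm (?v \<omega>) \<le> ?E * decay_const"
        using discount_le[OF t, of k n A x "?D \<omega>"] discount_pos[of t n A x k "?D \<omega>"] val_le[OF sT, of "chain A x k (?D \<omega>)"]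
          value_pos[of ?s "chain A x k (?D \<omega>)"] k n
        by (simp add: abs_mult mult_mono)
    qed
  qed
  have SV0: "stage_value t n A x k = expectation ?v" by (simp add: stage_value_def)
  have "\<bar>stage_value t n A x (Suc k) - stage_value t n A x k\<bar>
     = \<bar>expectation (\<lambda>\<omega>. expectation (\<lambda>\<omega>'. g (?past \<omega>, ?fut \<omega>')) - ?v \<omega>)\<bar>"
    unfolding SV SV0 by (subst Bochner_Integration.integral_diff[OF i1 i2]) simp
  also have "\<dots> \<le> expectation (\<lambda>\<omega>. ?E * err)"
  proof (rule abs_expectation_le[OF _ AE_I2])
    fix \<omega>
    let ?y = "chain A x k (?D \<omega>)" and ?d = "discount t n A x k (?D \<omega>)"
    have "expectation (\<lambda>\<omega>'. g (?past \<omega>, ?fut \<omega>')) - ?v \<omega>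
      = ?d * (exp (- integral (cell t T n k) (\<lambda>r. cost r ?y)) * expectation (\<lambda>\<omega>'. val ?s' (?y + A k *v (W ?s' \<omega>' - W ?s \<omega>'))) - val ?s ?y)"
      unfolding g_eq u_def stage_cost_eq[OF t k, symmetric] integral_mult_right_zero by (simp add: algebra_simps)
    also have "\<bar>\<dots>\<bar> \<le> ?E * err"
      unfolding abs_mult
    proof (intro mult_mono)
      show "\<bar>?d\<bar> \<le> ?E" using discount_le[OF t, of k n A x "?D \<omega>"] discount_pos[of t n A x k "?D \<omega>"] k n by simp
      show "\<bar>exp (- integral (cell t T n k) (\<lambda>r. cost r ?y)) * expectation (\<lambda>\<omega>'. val ?s' (?y + A k *v (W ?s' \<omega>' - W ?s \<omega>'))) - val ?s ?y\<bar> \<le> err"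
        using one_step_error[of ?s ?s' "A k" ?y] ci A unfolding err_def by (simp add: grid_Suc)
    qed auto
    finally show "\<bar>expectation (\<lambda>\<omega>'. g (?past \<omega>, ?fut \<omega>')) - ?v \<omega>\<bar> \<le> ?E * err" .
  qed auto
  also have "\<dots> = ?E * err" by (simp add: prob_space)
  finally show ?thesis unfolding err_def .
qed


lemma stage_value_0: "stage_value t n A x 0 = val t x"
  unfolding stage_value_def discount_def by (simp add: prob_space)

lemma val_T: "val T x = exp (- cost T x)"
  unfolding val_def gauss_exp_def cost_def V_T b_T \<gamma>_T by simp

text \<open>The grid has \<open>n\<close> cells of length \<open>h = (T - t) / n\<close>, so that the errors of order \<open>h * sqrt h\<close> and
\<open>h\<^sup>2\<close> sum to \<open>T * sqrt h\<close> and \<open>T * h\<close>.\<close>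

lemma stage_value_error:
  assumes t: "0 \<le> t" "t \<le> T" and n: "0 < n" and A: "\<And>k. norm (A k) \<le> B"
    and \<epsilon>: "(\<Sum>k<n. integral (cell t T n k) (\<lambda>r. norm (A k - \<sigma> r))) \<le> \<epsilon>"
  shows "\<bar>stage_value t n A x n - val t x\<bar>
    \<le> exp (B\<^sup>2 / (2 * c) * T) * step_const * (T * sqrt ((T - t) / real n) + T * ((T - t) / real n) + \<epsilon>)"
proof -
  let ?h = "(T - t) / real n" and ?e = "\<lambda>k. integral (cell t T n k) (\<lambda>r. norm (A k - \<sigma> r))"
  let ?E = "exp (B\<^sup>2 / (2 * c) * T)"
  have h: "0 \<le> ?h" using t by simp
  have nh: "real n * ?h \<le> T" using n t by simp
  have tel: "stage_value t n A x n - val t x = (\<Sum>k<n. stage_value t n A x (Suc k) - stage_value t n A x k)"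
    by (simp add: sum_lessThan_telescope stage_value_0)
  have "\<bar>stage_value t n A x n - val t x\<bar> \<le> (\<Sum>k<n. ?E * (step_const * (?h * sqrt ?h + ?h\<^sup>2 + ?e k)))"
    unfolding tel by (intro order_trans[OF sum_abs] sum_mono stage_value_step[OF t _ A]) simp
  also have "\<dots> = ?E * step_const * (real n * ?h * sqrt ?h + real n * ?h * ?h + (\<Sum>k<n. ?e k))"
  proof -
    have "(\<Sum>k<n. E * (C * (a + f k))) = E * C * (real n * a + (\<Sum>k<n. f k))" for E C a and f :: "nat \<Rightarrow> real"
    proof -
      have "(\<Sum>k<n. E * (C * (a + f k))) = (\<Sum>k<n. (E * C) * (a + f k))" by (simp only: mult.assoc)
      also have "\<dots> = E * C * (\<Sum>k<n. a + f k)" by (rule sum_distrib_left[symmetric])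
      also have "\<dots> = E * C * (real n * a + (\<Sum>k<n. f k))"
        by (simp only: sum.distrib sum_constant card_lessThan)
      finally show ?thesis .
    qed
    from this[of ?E step_const "?h * sqrt ?h + ?h\<^sup>2" ?e] show ?thesis
      by (simp only: power2_eq_square distrib_left[of "real n"] mult.assoc)
  qed
  also have "\<dots> \<le> ?E * step_const * (T * sqrt ?h + T * ?h + \<epsilon>)"
  proof (intro mult_left_mono add_mono \<epsilon>)
    show "real n * ?h * sqrt ?h \<le> T * sqrt ?h" by (rule mult_right_mono[OF nh]) (rule real_sqrt_ge_zero[OF h])
    show "real n * ?h * ?h \<le> T * ?h" by (rule mult_right_mono[OF nh h])
    show "0 \<le> ?E * step_const" using step_const_nonneg by (intro mult_nonneg_nonneg) auto
  qed
  finally show ?thesis .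
qed

lemma elementary_integral_L2:
  assumes t: "0 \<le> t" "t \<le> T" and k: "k \<le> n" "0 < n" and A: "\<And>k. norm (A k) \<le> B"
  shows "integrable M (\<lambda>\<omega>. (norm (elementary_integral W k (grid t T n) A \<omega>))\<^sup>2)"
    and "expectation (\<lambda>\<omega>. (norm (elementary_integral W k (grid t T n) A \<omega>))\<^sup>2) \<le> B\<^sup>2 * T"
proof -
  have p: "is_partition t (grid t T n k) k (grid t T n)" by (rule grid_partition[OF t(2)])
  note i = elementary_integral_inner[OF p t(1) p t(1), of A A]
  show "integrable M (\<lambda>\<omega>. (norm (elementary_integral W k (grid t T n) A \<omega>))\<^sup>2)"
    unfolding power2_norm_eq_inner by (rule i(1))
  have B0: "0 \<le> B" using B by simp
  have "expectation (\<lambda>\<omega>. (norm (elementary_integral W k (grid t T n) A \<omega>))\<^sup>2)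
    = (\<integral>r. step_function k (grid t T n) A r \<bullet> step_function k (grid t T n) A r \<partial>lborel)"
    unfolding power2_norm_eq_inner by (rule i(3))
  also have "\<dots> \<le> (\<integral>r. B\<^sup>2 * indicator {t..T} r \<partial>lborel)"
  proof (rule integral_mono[OF i(2)])
    show "integrable lborel (\<lambda>r. B\<^sup>2 * indicator {t..T} r)"
      by (intro integrable_mult_right integrable_real_indicator) (auto simp: emeasure_lborel_Icc_eq)
    fix r
    show "step_function k (grid t T n) A r \<bullet> step_function k (grid t T n) A r \<le> B\<^sup>2 * indicator {t..T} r"
    proof (cases "r \<in> {t<..grid t T n k}")
      case True
      then have r: "r \<in> {t..T}" using grid_le[OF t(2) k] by auto
      have "norm (step_function k (grid t T n) A r) \<le> B" by (rule step_function_norm_le[OF p A])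
      then have "(norm (step_function k (grid t T n) A r))\<^sup>2 \<le> B\<^sup>2" by (intro power_mono) auto
      then show ?thesis using r by (simp add: power2_norm_eq_inner)
    next
      case False
      then show ?thesis using step_function_eq_0[OF p False, of A] by simp
    qed
  qed
  also have "\<dots> = B\<^sup>2 * (T - t)" using t by simp
  also have "\<dots> \<le> B\<^sup>2 * T" using t by (intro mult_left_mono) auto
  finally show "expectation (\<lambda>\<omega>. (norm (elementary_integral W k (grid t T n) A \<omega>))\<^sup>2) \<le> B\<^sup>2 * T" .
qed

lemma elementary_integral_L2_error:
  assumes t: "0 \<le> t" "t \<le> T" and k: "k \<le> n" "0 < n" and A: "\<And>k. norm (A k) \<le> B"
    and \<epsilon>: "(\<Sum>k<n. integral (cell t T n k) (\<lambda>r. norm (A k - \<sigma> r))) \<le> \<epsilon>"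
    and Y: "has_stochastic_integral M W \<sigma> t (grid t T n k) Y"
  shows "integrable M (\<lambda>\<omega>. (norm (elementary_integral W k (grid t T n) A \<omega> - Y \<omega>))\<^sup>2)"
    and "expectation (\<lambda>\<omega>. (norm (elementary_integral W k (grid t T n) A \<omega> - Y \<omega>))\<^sup>2) \<le> 8 * B * \<epsilon>"
proof -
  have p: "is_partition t (grid t T n k) k (grid t T n)" by (rule grid_partition[OF t(2)])
  have B0: "0 \<le> B" using B by simp
  have \<sigma>': "bounded_measurable_on {t..T} \<sigma>" by (rule bounded_measurable_on_subset[OF \<sigma>_bm]) (use t in auto)
  have "bounded_measurable_on {t..grid t T n k} \<sigma>"
    by (rule bounded_measurable_on_subset[OF \<sigma>_bm]) (use t grid_le[OF t(2) k] in auto)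
  then have \<sigma>m: "\<sigma> \<in> borel_measurable (lebesgue_on {t..grid t T n k})" unfolding bounded_measurable_on_def by blast
  let ?f = "\<lambda>\<omega>. (norm (elementary_integral W k (grid t T n) A \<omega> - Y \<omega>))\<^sup>2"
  have "(\<integral>\<^sup>+\<omega>. ennreal (?f \<omega>) \<partial>M) \<le> 4 * (\<integral>\<^sup>+r\<in>{t..grid t T n k}. ennreal ((norm (step_function k (grid t T n) A r - \<sigma> r))\<^sup>2) \<partial>lebesgue)"
    by (rule stochastic_integral_elementary_approx[OF Y t(1) \<sigma>m p])
  also have "\<dots> \<le> 4 * ennreal (2 * B * (\<Sum>i<n. integral (cell t T n i) (\<lambda>r. norm (A i - \<sigma> r))))"
    by (intro mult_left_mono nn_integral_step_function_le[OF \<sigma>' \<sigma>_le A t(2) k]) (use t in auto)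
  also have "\<dots> \<le> 4 * ennreal (2 * B * \<epsilon>)"
    using B0 \<epsilon> by (intro mult_left_mono ennreal_leI) auto
  also have "\<dots> = ennreal (8 * B * \<epsilon>)"
    by (subst ennreal_numeral[symmetric], subst ennreal_mult'[symmetric]) (simp_all add: mult.assoc)
  finally have le: "(\<integral>\<^sup>+\<omega>. ennreal (?f \<omega>) \<partial>M) \<le> ennreal (8 * B * \<epsilon>)" .
  have mY: "Y \<in> borel_measurable M" using Y unfolding has_stochastic_integral_def by blast
  have mZ: "elementary_integral W k (grid t T n) A \<in> borel_measurable M"
    by (rule elementary_integral_measurable[OF p t(1)])
  have m: "?f \<in> borel_measurable M" using mY mZ by measurable
  show i: "integrable M ?f"
  proof (rule integrableI_nonneg[OF m])
    show "(\<integral>\<^sup>+\<omega>. ennreal (?f \<omega>) \<partial>M) < \<infinity>" using le by (rule le_less_trans) simp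
  qed simp
  have "0 \<le> \<epsilon>" by (rule order_trans[OF sum_nonneg \<epsilon>]) (rule integral_norm_nonneg)
  then show "expectation ?f \<le> 8 * B * \<epsilon>"
    using le B0 unfolding nn_integral_eq_integral[OF i AE_I2[OF zero_le_power2]] by (simp add: ennreal_le_iff)
qed

end

section \<open>Passage to the limit\<close>

context riccati_brownian begin

lemma cost_measurable [measurable]: "cost s \<in> borel_measurable borel"
  unfolding cost_def
  by (intro borel_measurable_continuous_onI continuous_intros
      bounded_linear.continuous_on[OF bounded_bilinear.bounded_linear_right[OF bounded_bilinear_matrix_vector_mult]])

lemma cell_integral_norm_le:
  fixes f :: "real \<Rightarrow> 'z::euclidean_space"
  assumes t: "0 \<le> t" "t \<le> T" "k < n" and f: "bounded_measurable_on {0..T} f" and B: "\<And>s. s \<in> {0..T} \<Longrightarrow> norm (f s) \<le> B"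
  shows "norm (integral (cell t T n k) f) \<le> B * ((T - t) / real n)"
proof -
  have "norm (integral (cell t T n k) f) \<le> B * (grid t T n (Suc k) - grid t T n k)"
    by (rule bounded_measurable_on_integral_norm_le[OF f]) (use cell_in[OF t] B in auto)
  then show ?thesis by (simp add: grid_Suc)
qed

lemma stage_cost_diff_le:
  assumes t: "0 \<le> t" "t \<le> T" "k < n"
  shows "\<bar>stage_cost Q z t T n k p - stage_cost Q z t T n k y\<bar>
    \<le> B * ((T - t) / real n) * ((1 + norm p + norm y) * norm (p - y))"
  using quadratic_form_diff_le[OF cell_integral_norm_le[OF t Q_bm Q_le] cell_integral_norm_le[OF t z_bm z_le], of p y]
  unfolding stage_cost_def by (simp only: mult.assoc)

lemma cost_diff_le:
  assumes "s \<in> {0..T}"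
  shows "\<bar>cost s p - cost s y\<bar> \<le> B * ((1 + norm p + norm y) * norm (p - y))"
  using quadratic_form_diff_le[OF Q_le[OF assms] z_le[OF assms], of p y]
  unfolding cost_def by (simp only: mult.assoc)

definition cost_floor :: real where "cost_floor = B\<^sup>2 / (2 * c) * T + B\<^sup>2 / (2 * c)"

lemma total_cost_ge:
  assumes "0 \<le> t" "t \<le> T" "0 < n"
  shows "- cost_floor \<le> (\<Sum>i<n. stage_cost Q z t T n i (y i)) + cost T w"
  using stage_cost_sum_ge[OF assms(1,2) order_refl assms(3), of y] cost_ge[of T w] T unfolding cost_floor_def by simp

definition grid_functional :: "real \<Rightarrow> nat \<Rightarrow> (real \<Rightarrow> 'w \<Rightarrow> real^'n) \<Rightarrow> 'w \<Rightarrow> real" where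
  "grid_functional t n Y \<omega> = exp (- ((\<Sum>i<n. stage_cost Q z t T n i (Y (grid t T n i) \<omega>)) + cost T (Y T \<omega>)))"

lemma grid_functional_bounded:
  assumes "0 \<le> t" "t \<le> T" "0 < n"
  shows "0 < grid_functional t n Y \<omega>" "grid_functional t n Y \<omega> \<le> exp cost_floor"
  unfolding grid_functional_def using total_cost_ge[OF assms, of "\<lambda>i. Y (grid t T n i) \<omega>" "Y T \<omega>"] by auto

lemma grid_functional_measurable:
  assumes t: "0 \<le> t" "t \<le> T" and n: "0 < n" and Y: "\<And>s. s \<in> {t..T} \<Longrightarrow> Y s \<in> borel_measurable M"
  shows "grid_functional t n Y \<in> borel_measurable M"
  unfolding grid_functional_def
proof (intro measurable_compose[OF _ borel_measurable_exp] borel_measurable_uminus borel_measurable_add borel_measurable_sum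
    measurable_compose[OF Y stage_cost_measurable] measurable_compose[OF Y cost_measurable])
  show "grid t T n i \<in> {t..T}" if "i \<in> {..<n}" for i
    using grid_ge[OF t(2), of n i] grid_le[OF t(2), of i n] that n by auto
qed (use t in auto)

definition approx_const :: "real^'n \<Rightarrow> real" where
  "approx_const x = exp cost_floor * (B * (T + 1) * (1 + 8 * (norm x)\<^sup>2 + 8 * (B\<^sup>2 * T) + 12 * B))"

text \<open>The chain and the diffusion differ by a stochastic integral of \<open>A - \<sigma>\<close>, which is of size
\<open>sqrt \<epsilon>\<close> in \<open>L\<^sup>2\<close>. Since costs are bounded below, the exponential is Lipschitz on their range, and
it suffices to compare the costs themselves; weight \<open>sqrt \<epsilon>\<close> balances the two terms of the
comparison.\<close>

lemma grid_functional_approx: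
  assumes t: "0 \<le> t" "t < T" and n: "0 < n" and A: "\<And>k. norm (A k) \<le> B"
    and \<epsilon>: "(\<Sum>k<n. integral (cell t T n k) (\<lambda>r. norm (A k - \<sigma> r))) \<le> \<epsilon>" "0 < \<epsilon>" "\<epsilon> \<le> 1"
    and Y: "sde_solution M W \<sigma> T t x Y"
  shows "\<bar>stage_value t n A x n - expectation (grid_functional t n Y)\<bar> \<le> approx_const x * sqrt \<epsilon>"
proof -
  have tT: "t \<le> T" using t by simp
  have B0: "0 \<le> B" using B by simp
  let ?h = "(T - t) / real n" and ?D = "increments t n"
  let ?p = "\<lambda>k \<omega>. chain A x k (?D \<omega>)" and ?y = "\<lambda>k \<omega>. Y (grid t T n k) \<omega>"
  let ?Z = "\<lambda>k. elementary_integral W k (grid t T n) A"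
  have gT: "grid t T n k \<in> {t..T}" if "k \<le> n" for k
    using grid_ge[OF tT, of n k] grid_le[OF tT that n] by auto
  have Ym: "Y s \<in> borel_measurable M" if "s \<in> {t..T}" for s
    using Y that unfolding sde_solution_def by blast
  have Y0: "AE \<omega> in M. Y t \<omega> = x" using Y unfolding sde_solution_def by blast
  have Yi: "has_stochastic_integral M W \<sigma> t (grid t T n k) (\<lambda>\<omega>. Y (grid t T n k) \<omega> - Y t \<omega>)" if "k \<le> n" for k
    using Y gT[OF that] unfolding sde_solution_def by blast
  have pZ: "?p k \<omega> = x + ?Z k \<omega>" for k \<omega>
    using chain_elementary_integral[of A x k W "grid t T n" \<omega>] unfolding increments_def[abs_def] .
  let ?\<delta> = "\<lambda>k \<omega>. (norm (?Z k \<omega> - (Y (grid t T n k) \<omega> - Y t \<omega>)))\<^sup>2"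
  define f where "f k \<omega> = sqrt \<epsilon> * (1 + 8 * (norm x)\<^sup>2 + 8 * (norm (?Z k \<omega>))\<^sup>2) + (1 / (2 * sqrt \<epsilon>) + 1) * ?\<delta> k \<omega>" for k \<omega>
  define m where "m = sqrt \<epsilon> * (1 + 8 * (norm x)\<^sup>2 + 8 * (B\<^sup>2 * T)) + (1 / (2 * sqrt \<epsilon>) + 1) * (8 * B * \<epsilon>)"
  have s\<epsilon>: "0 < sqrt \<epsilon>" using \<epsilon> by simp
  have m0: "0 \<le> m" unfolding m_def using B0 T s\<epsilon> \<epsilon> by (intro add_nonneg_nonneg mult_nonneg_nonneg) auto
  have Zi: "integrable M (\<lambda>\<omega>. (norm (?Z k \<omega>))\<^sup>2)" "expectation (\<lambda>\<omega>. (norm (?Z k \<omega>))\<^sup>2) \<le> B\<^sup>2 * T" if "k \<le> n" for k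
    using elementary_integral_L2[OF t(1) tT that n A] by auto
  have \<delta>i: "integrable M (?\<delta> k)" "expectation (?\<delta> k) \<le> 8 * B * \<epsilon>" if "k \<le> n" for k
    using elementary_integral_L2_error[OF t(1) tT that n A \<epsilon>(1) Yi[OF that]] by auto
  have fi: "integrable M (f k)" if "k \<le> n" for k
    unfolding f_def by (intro Bochner_Integration.integrable_add integrable_mult_right integrable_const Zi \<delta>i that)
  have fE: "expectation (f k) \<le> m" if k: "k \<le> n" for k
  proof -
    have "expectation (f k) = sqrt \<epsilon> * (1 + 8 * (norm x)\<^sup>2 + 8 * expectation (\<lambda>\<omega>. (norm (?Z k \<omega>))\<^sup>2)) + (1 / (2 * sqrt \<epsilon>) + 1) * expectation (?\<delta> k)"
      unfolding f_def using Zi[OF k] \<delta>i[OF k] by (simp add: prob_space)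
    also have "\<dots> \<le> m"
      unfolding m_def using s\<epsilon> Zi(2)[OF k] \<delta>i(2)[OF k]
      by (intro add_mono mult_left_mono) auto
    finally show ?thesis .
  qed
  \<comment> \<open>Holds almost surely only, because the diffusion starts at \<open>x\<close> almost surely.\<close>
  have fge: "AE \<omega> in M. \<forall>k\<le>n. (1 + norm (?p k \<omega>) + norm (?y k \<omega>)) * norm (?p k \<omega> - ?y k \<omega>) \<le> f k \<omega>"
    using Y0
  proof eventually_elim
    case (elim \<omega>)
    show ?case
    proof (intro allI impI)
      fix k
      have d: "?p k \<omega> - ?y k \<omega> = ?Z k \<omega> - (Y (grid t T n k) \<omega> - Y t \<omega>)" using elim by (simp add: pZ)
      show "(1 + norm (?p k \<omega>) + norm (?y k \<omega>)) * norm (?p k \<omega> - ?y k \<omega>) \<le> f k \<omega>"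
        using weighted_distance_le[OF s\<epsilon> pZ[of k \<omega>], of "?y k \<omega>"] unfolding f_def d .
    qed
  qed
  define a where "a \<omega> = (\<Sum>i<n. stage_cost Q z t T n i (?p i \<omega>)) + cost T (?p n \<omega>)" for \<omega>
  define b' where "b' \<omega> = (\<Sum>i<n. stage_cost Q z t T n i (?y i \<omega>)) + cost T (Y T \<omega>)" for \<omega>
  have SV: "stage_value t n A x n = expectation (\<lambda>\<omega>. exp (- a \<omega>))"
    unfolding stage_value_def a_def discount_def grid_end[OF n] val_T minus_add_distrib exp_add ..
  have GF: "grid_functional t n Y = (\<lambda>\<omega>. exp (- b' \<omega>))"
    by (rule ext) (simp only: grid_functional_def b'_def)
  have am: "(\<lambda>\<omega>. exp (- a \<omega>)) \<in> borel_measurable M"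
  proof -
    have pm: "?p k \<in> borel_measurable M" for k
      unfolding pZ by (intro borel_measurable_add borel_measurable_const elementary_integral_measurable[OF grid_partition[OF tT] t(1)])
    show ?thesis unfolding a_def
      by (intro measurable_compose[OF _ borel_measurable_exp] borel_measurable_uminus borel_measurable_add borel_measurable_sum
          measurable_compose[OF pm stage_cost_measurable] measurable_compose[OF pm cost_measurable])
  qed
  have bm: "(\<lambda>\<omega>. exp (- b' \<omega>)) \<in> borel_measurable M"
    unfolding GF[symmetric] by (rule grid_functional_measurable[OF t(1) tT n]) (rule Ym)
  have a_ge: "- cost_floor \<le> a \<omega>" and b_ge: "- cost_floor \<le> b' \<omega>" for \<omega>
    unfolding a_def b'_def by (rule total_cost_ge[OF t(1) tT n])+
  have ai: "integrable M (\<lambda>\<omega>. exp (- a \<omega>))"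
    by (rule integrable_const_bound[OF _ am, of "exp cost_floor"]) (use a_ge in \<open>auto simp: minus_le_iff\<close>)
  have bi: "integrable M (\<lambda>\<omega>. exp (- b' \<omega>))"
    by (rule integrable_const_bound[OF _ bm, of "exp cost_floor"]) (use b_ge in \<open>auto simp: minus_le_iff\<close>)
  let ?g = "\<lambda>\<omega>. exp cost_floor * ((\<Sum>i<n. B * ?h * f i \<omega>) + B * f n \<omega>)"
  have "\<bar>stage_value t n A x n - expectation (grid_functional t n Y)\<bar> = \<bar>expectation (\<lambda>\<omega>. exp (- a \<omega>) - exp (- b' \<omega>))\<bar>"
    unfolding SV GF by (subst Bochner_Integration.integral_diff[OF ai bi]) simp
  also have "\<dots> \<le> expectation ?g"
  proof (rule abs_expectation_le)
    show "integrable M ?g"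
      by (intro integrable_mult_right Bochner_Integration.integrable_add Bochner_Integration.integrable_sum fi) auto
    show "AE \<omega> in M. \<bar>exp (- a \<omega>) - exp (- b' \<omega>)\<bar> \<le> ?g \<omega>"
      using fge
    proof eventually_elim
      case (elim \<omega>)
      have "a \<omega> - b' \<omega> = (\<Sum>i<n. stage_cost Q z t T n i (?p i \<omega>) - stage_cost Q z t T n i (?y i \<omega>)) + (cost T (?p n \<omega>) - cost T (?y n \<omega>))"
        unfolding a_def b'_def by (simp add: sum_subtractf grid_end[OF n])
      then have "\<bar>a \<omega> - b' \<omega>\<bar> \<le> (\<Sum>i<n. \<bar>stage_cost Q z t T n i (?p i \<omega>) - stage_cost Q z t T n i (?y i \<omega>)\<bar>) + \<bar>cost T (?p n \<omega>) - cost T (?y n \<omega>)\<bar>"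
        using sum_abs[of "\<lambda>i. stage_cost Q z t T n i (?p i \<omega>) - stage_cost Q z t T n i (?y i \<omega>)" "{..<n}"] by linarith
      also have "\<dots> \<le> (\<Sum>i<n. B * ?h * f i \<omega>) + B * f n \<omega>"
      proof (intro add_mono sum_mono)
        fix i assume "i \<in> {..<n}"
        then have i: "i < n" by simp
        show "\<bar>stage_cost Q z t T n i (?p i \<omega>) - stage_cost Q z t T n i (?y i \<omega>)\<bar> \<le> B * ?h * f i \<omega>"
          by (rule order_trans[OF stage_cost_diff_le[OF t(1) tT i]]) (use elim i B0 tT in \<open>intro mult_left_mono; simp\<close>)
      next
        show "\<bar>cost T (?p n \<omega>) - cost T (?y n \<omega>)\<bar> \<le> B * f n \<omega>"
          by (rule order_trans[OF cost_diff_le]) (use elim B0 T in \<open>auto intro: mult_left_mono\<close>)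
      qed
      finally have "exp cost_floor * \<bar>a \<omega> - b' \<omega>\<bar> \<le> ?g \<omega>" by (intro mult_left_mono) auto
      then show ?case using abs_exp_minus_diff_le[OF a_ge b_ge, of \<omega> \<omega>] by linarith
    qed
  qed
  also have "\<dots> = exp cost_floor * ((\<Sum>i<n. B * ?h * expectation (f i)) + B * expectation (f n))"
  proof -
    have i: "integrable M (\<lambda>\<omega>. u * f k \<omega>)" if "k \<le> n" for u k by (intro integrable_mult_right fi that)
    have "integrable M (\<lambda>\<omega>. \<Sum>k<n. B * ?h * f k \<omega>)" by (intro Bochner_Integration.integrable_sum i) simp
    then have "expectation (\<lambda>\<omega>. (\<Sum>k<n. B * ?h * f k \<omega>) + B * f n \<omega>)
        = expectation (\<lambda>\<omega>. \<Sum>k<n. B * ?h * f k \<omega>) + expectation (\<lambda>\<omega>. B * f n \<omega>)"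
      by (rule Bochner_Integration.integral_add) (rule i[OF order_refl])
    also have "expectation (\<lambda>\<omega>. \<Sum>k<n. B * ?h * f k \<omega>) = (\<Sum>k<n. expectation (\<lambda>\<omega>. B * ?h * f k \<omega>))"
      by (rule Bochner_Integration.integral_sum) (rule i, simp)
    finally show ?thesis by (simp only: integral_mult_right_zero)
  qed
  also have "\<dots> \<le> exp cost_floor * ((\<Sum>i<n. B * ?h * m) + B * m)"
    using fE B0 tT by (intro mult_left_mono add_mono sum_mono) auto
  also have "(\<Sum>i<n. B * ?h * m) + B * m = (T - t + 1) * (B * m)" using n by (simp add: field_simps)
  also have "\<dots> \<le> (T + 1) * (B * (sqrt \<epsilon> * (1 + 8 * (norm x)\<^sup>2 + 8 * (B\<^sup>2 * T) + 12 * B)))"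
  proof (intro mult_mono mult_left_mono)
    have "\<epsilon> = sqrt \<epsilon> * sqrt \<epsilon>" using \<epsilon> by simp
    then have "(1 / (2 * sqrt \<epsilon>) + 1) * (8 * B * \<epsilon>) = 4 * B * sqrt \<epsilon> + 8 * B * \<epsilon>"
      using s\<epsilon> by (simp add: field_simps)
    moreover have "\<epsilon> \<le> sqrt \<epsilon>"
      using \<epsilon> mult_left_mono[of "sqrt \<epsilon>" 1 "sqrt \<epsilon>"] \<open>\<epsilon> = sqrt \<epsilon> * sqrt \<epsilon>\<close> by simp
    then have "8 * B * \<epsilon> \<le> 8 * B * sqrt \<epsilon>" using B0 by (intro mult_left_mono) auto
    ultimately show "m \<le> sqrt \<epsilon> * (1 + 8 * (norm x)\<^sup>2 + 8 * (B\<^sup>2 * T) + 12 * B)"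
      unfolding m_def by (simp add: algebra_simps)
  qed (use t B0 T m0 in auto)
  finally show ?thesis unfolding approx_const_def by (simp add: mult_ac)
qed

text \<open>For a fixed accuracy \<open>\<epsilon>\<close> of the step approximation the grid is refined first: the functional on the
grid converges by dominated convergence, and the discretisation errors vanish. What remains is of
order \<open>sqrt \<epsilon>\<close>, and \<open>\<epsilon>\<close> is arbitrary.\<close>

lemma expectation_eq_value:
  assumes t: "0 \<le> t" "t < T" and Y: "sde_solution M W \<sigma> T t x Y"
  shows "expectation (\<lambda>\<omega>. exp (- (LINT s:{t..T}|lebesgue. cost s (Y s \<omega>)) - cost T (Y T \<omega>))) = val t x"
    (is "expectation ?F = _")
proof -
  have tT: "t \<le> T" using t by simp
  have sub: "{t..T} \<subseteq> {0..T}" using t by auto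
  have Q': "bounded_measurable_on {t..T} Q" and z': "bounded_measurable_on {t..T} z" and \<sigma>': "bounded_measurable_on {t..T} \<sigma>"
    by (rule bounded_measurable_on_subset[OF _ sub]; simp add: Q_bm z_bm \<sigma>_bm)+
  have Ym: "Y s \<in> borel_measurable M" if "s \<in> {t..T}" for s
    using Y that unfolding sde_solution_def by blast
  have Yc: "continuous_on {t..T} (\<lambda>s. Y s \<omega>)" if "\<omega> \<in> space M" for \<omega>
    using Y that unfolding sde_solution_def by blast
  \<comment> \<open>The shift by one excludes the degenerate grid without cells.\<close>
  have lim: "(\<lambda>n. grid_functional t (Suc n) Y \<omega>) \<longlonglongrightarrow> ?F \<omega>" if "\<omega> \<in> space M" for \<omega>
  proof -
    have "(\<lambda>n. \<Sum>k<n. stage_cost Q z t T n k (Y (grid t T n k) \<omega>)) \<longlonglongrightarrow> (LINT s:{t..T}|lebesgue. cost s (Y s \<omega>))"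
      unfolding cost_def by (rule stage_cost_sum_tendsto[OF Q' z' t(2) Yc[OF that]])
    then have "(\<lambda>n. exp (- ((\<Sum>k<n. stage_cost Q z t T n k (Y (grid t T n k) \<omega>)) + cost T (Y T \<omega>))))
        \<longlonglongrightarrow> exp (- ((LINT s:{t..T}|lebesgue. cost s (Y s \<omega>)) + cost T (Y T \<omega>)))"
      by (intro tendsto_intros)
    from LIMSEQ_Suc[OF this] show ?thesis unfolding grid_functional_def by simp
  qed
  have gm: "grid_functional t (Suc n) Y \<in> borel_measurable M" for n
    by (rule grid_functional_measurable[OF t(1) tT _ Ym]) auto
  have Fm: "?F \<in> borel_measurable M"
    by (rule borel_measurable_LIMSEQ_real[OF lim gm])
  have conv: "(\<lambda>n. expectation (grid_functional t (Suc n) Y)) \<longlonglongrightarrow> expectation ?F"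
  proof (rule integral_dominated_convergence[where w = "\<lambda>_. exp cost_floor"])
    show "AE \<omega> in M. norm (grid_functional t (Suc n) Y \<omega>) \<le> exp cost_floor" for n
      using grid_functional_bounded[OF t(1) tT, of "Suc n" Y] by (auto simp: less_imp_le)
  qed (use Fm gm lim in auto)
  define C where "C = approx_const x + exp (B\<^sup>2 / (2 * c) * T) * step_const"
  have B0: "0 \<le> B" using B by simp
  have bound: "\<bar>expectation ?F - val t x\<bar> \<le> C * sqrt \<epsilon>" if \<epsilon>: "0 < \<epsilon>" "\<epsilon> \<le> 1" for \<epsilon>
  proof -
    let ?E = "exp (B\<^sup>2 / (2 * c) * T) * step_const"
    have E0: "0 \<le> ?E" using step_const_nonneg by simp
    have "\<forall>\<^sub>F n in sequentially. \<exists>A. (\<forall>k. norm (A k) \<le> B) \<and>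
        (\<Sum>k<n. integral (cell t T n k) (\<lambda>r. norm (A k - \<sigma> r))) \<le> \<epsilon>"
      by (rule step_approximation_L1[OF \<sigma>' _ B0 t(2) \<epsilon>(1)]) (use \<sigma>_le sub in auto)
    then have "\<forall>\<^sub>F n in sequentially. \<exists>A. (\<forall>k. norm (A k) \<le> B) \<and>
        (\<Sum>k<Suc n. integral (cell t T (Suc n) k) (\<lambda>r. norm (A k - \<sigma> r))) \<le> \<epsilon>"
      by (rule eventually_compose_filterlim[OF _ filterlim_Suc])
    then have ev: "\<forall>\<^sub>F n in sequentially. \<bar>expectation (grid_functional t (Suc n) Y) - val t x\<bar>
        \<le> approx_const x * sqrt \<epsilon> + ?E * (T * sqrt ((T - t) / real (Suc n)) + T * ((T - t) / real (Suc n)) + \<epsilon>)"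
    proof eventually_elim
      case (elim n)
      then obtain A where A: "\<And>k. norm (A k) \<le> B"
        "(\<Sum>k<Suc n. integral (cell t T (Suc n) k) (\<lambda>r. norm (A k - \<sigma> r))) \<le> \<epsilon>" by blast
      show ?case
        using grid_functional_approx[OF t _ A(1) A(2) \<epsilon> Y] stage_value_error[OF t(1) tT _ A(1) A(2), of x] by simp
    qed
    have h0: "(\<lambda>n. (T - t) / real (Suc n)) \<longlonglongrightarrow> 0"
      using LIMSEQ_Suc[OF lim_const_over_n[of "T - t"]] .
    have "(\<lambda>n. approx_const x * sqrt \<epsilon> + ?E * (T * sqrt ((T - t) / real (Suc n)) + T * ((T - t) / real (Suc n)) + \<epsilon>))
       \<longlonglongrightarrow> approx_const x * sqrt \<epsilon> + ?E * (T * sqrt 0 + T * 0 + \<epsilon>)"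
      by (intro tendsto_intros h0)
    moreover have "(\<lambda>n. \<bar>expectation (grid_functional t (Suc n) Y) - val t x\<bar>) \<longlonglongrightarrow> \<bar>expectation ?F - val t x\<bar>"
      by (intro tendsto_intros conv)
    ultimately have "\<bar>expectation ?F - val t x\<bar> \<le> approx_const x * sqrt \<epsilon> + ?E * (T * sqrt 0 + T * 0 + \<epsilon>)"
      using ev by (intro tendsto_le[OF sequentially_bot])
    also have "\<dots> = approx_const x * sqrt \<epsilon> + ?E * \<epsilon>" by simp
    also have "?E * \<epsilon> \<le> ?E * sqrt \<epsilon>"
    proof (rule mult_left_mono[OF _ E0])
      have "sqrt \<epsilon> * sqrt \<epsilon> \<le> 1 * sqrt \<epsilon>" using \<epsilon> by (intro mult_right_mono) auto
      then show "\<epsilon> \<le> sqrt \<epsilon>" using \<epsilon> by simp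
    qed
    finally show ?thesis unfolding C_def by (simp add: algebra_simps)
  qed
  have "(\<lambda>n. C * sqrt (1 / real (Suc n))) \<longlonglongrightarrow> C * sqrt 0"
    by (intro tendsto_intros LIMSEQ_Suc[OF lim_const_over_n[of 1]])
  moreover have "\<bar>expectation ?F - val t x\<bar> \<le> C * sqrt (1 / real (Suc n))" for n
    by (rule bound) auto
  ultimately have "\<bar>expectation ?F - val t x\<bar> \<le> C * sqrt 0"
    by (intro LIMSEQ_le_const[of "\<lambda>n. C * sqrt (1 / real (Suc n))"]) auto
  then show ?thesis by simp
qed

lemma exp_functional_eq_value:
  assumes t: "t \<in> {0..T}" and X: "sde_solution M W \<sigma> T t x (X t x)"
  shows "exp_functional M T Q z X t x = val t x"
proof -
  have e: "exp_functional M T Q z X t x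
      = expectation (\<lambda>\<omega>. exp (- (LINT s:{t..T}|lebesgue. cost s (X t x s \<omega>)) - cost T (X t x T \<omega>)))"
    unfolding exp_functional_def quadratic_cost_def cost_def ..
  show ?thesis
  proof (cases "t < T")
    case True
    then show ?thesis unfolding e using t by (intro expectation_eq_value X) auto
  next
    case False
    then have tT: "t = T" using t by simp
    have "(LINT s:{t..T}|lebesgue. g s) = 0" for g :: "real \<Rightarrow> real"
      unfolding set_lebesgue_integral_def
    proof (rule integral_eq_zero_AE)
      have "AE s in lebesgue. s \<noteq> T" by (rule AE_completion) (rule AE_lborel_singleton)
      then show "AE s in lebesgue. indicator {t..T} s *\<^sub>R g s = 0"
        by eventually_elim (auto simp: tT split: split_indicator)
    qed
    then have "exp_functional M T Q z X t x = expectation (\<lambda>\<omega>. exp (- cost T (X t x T \<omega>)))"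
      unfolding e by simp
    also have "\<dots> = expectation (\<lambda>\<omega>. exp (- cost T x))"
    proof (rule integral_cong_AE)
      have "X t x T \<in> borel_measurable M" using X t unfolding sde_solution_def by auto
      then show "(\<lambda>\<omega>. exp (- cost T (X t x T \<omega>))) \<in> borel_measurable M"
        by (intro measurable_compose[OF _ borel_measurable_exp] borel_measurable_uminus measurable_compose[OF _ cost_measurable])
      have "AE \<omega> in M. X t x t \<omega> = x" using X unfolding sde_solution_def by blast
      then show "AE \<omega> in M. exp (- cost T (X t x T \<omega>)) = exp (- cost T x)"
        by eventually_elim (simp add: tT)
    qed simp
    also have "\<dots> = val t x" by (simp add: prob_space val_T tT)
    finally show ?thesis .
  qed
qed

end

section \<open>The exponential quadratic functional\<close>

theorem theorem1:
  fixes T :: real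
    and \<sigma> \<Sigma> Q :: "real \<Rightarrow> real^'n^'n"
    and z :: "real \<Rightarrow> real^'n"
    and M :: "'w measure"
    and W :: "real \<Rightarrow> 'w \<Rightarrow> real^'n"
    and X :: "real \<Rightarrow> real^'n \<Rightarrow> real \<Rightarrow> 'w \<Rightarrow> real^'n"
    and F :: "real \<Rightarrow> real^'n \<Rightarrow> real"
  assumes T: "0 < T"
    and \<sigma>: "bounded_measurable_on {0..T} \<sigma>"
    and \<Sigma>: "\<And>t. \<Sigma> t = \<sigma> t ** transpose (\<sigma> t)"
    and W: "brownian_motion M W"
    and X: "\<And>t x. t \<in> {0..T} \<Longrightarrow> sde_solution M W \<sigma> T t x (X t x)"
    and Q: "bounded_measurable_on {0..T} Q"
    and Q_pos: "\<And>t. t \<in> {0..T} \<Longrightarrow> pos_def_sym (Q t)"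
    and Q_inv: "bounded ((\<lambda>t. matrix_inv (Q t)) ` {0..T})"
    and z: "bounded_measurable_on {0..T} z"
    and F: "\<And>t x. F t x = exp_functional M T Q z X t x"
  shows "\<exists>V b \<gamma>.
           riccati_system T \<Sigma> Q z V b \<gamma> \<and>
           (\<forall>V' b' \<gamma>'. riccati_system T \<Sigma> Q z V' b' \<gamma>' \<longrightarrow>
              (\<forall>t\<in>{0..T}. V' t = V t \<and> b' t = b t \<and> \<gamma>' t = \<gamma> t)) \<and>
           (\<forall>t\<in>{0..T}. \<forall>x. F t x = exp (- 1/2 * (x \<bullet> (V t *v x)) - b t \<bullet> x - \<gamma> t))"
proof -
  have \<Sigma>_eq: "\<Sigma> = (\<lambda>t. \<sigma> t ** transpose (\<sigma> t))" by (rule ext) (rule \<Sigma>)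
  have \<Sigma>_bm: "bounded_measurable_on {0..T} \<Sigma>"
    unfolding \<Sigma>_eq by (intro bounded_measurable_on_matrix_mult bounded_measurable_on_transpose \<sigma>)
  have \<Sigma>_sym: "transpose (\<Sigma> s) = \<Sigma> s" for s by (simp add: \<Sigma>_eq matrix_transpose_mul)
  have \<Sigma>_pos: "0 \<le> x \<bullet> (\<Sigma> s *v x)" for s x
    unfolding \<Sigma>_eq matrix_vector_mul_assoc[symmetric] inner_matrix_vector_transpose[of x "\<sigma> s"] by simp
  obtain K where K: "0 < K" "\<And>s. s \<in> {0..T} \<Longrightarrow> norm (matrix_inv (Q s)) \<le> K"
    using Q_inv unfolding bounded_pos by auto
  have Q_coercive: "1 / K * (norm x)\<^sup>2 \<le> x \<bullet> (Q s *v x)" if "s \<in> {0..T}" for s x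
    by (rule pos_def_coercive[OF Q_pos[OF that] K(2)[OF that] K(1)])
  have Q_sym: "transpose (Q s) = Q s" if "s \<in> {0..T}" for s using Q_pos[OF that] unfolding pos_def_sym_def by blast
  have Q_nonneg: "0 \<le> x \<bullet> (Q s *v x)" if "s \<in> {0..T}" for s x
    using Q_pos[OF that] unfolding pos_def_sym_def by (cases "x = 0") (auto simp: less_imp_le)
  have TT: "0 \<le> T" "T \<in> {0..T}" using T by auto
  have K0: "0 < 1 / K" using K(1) by simp
  obtain V b \<gamma> c' where V: "has_ac_derivative T V (\<lambda>s. V s ** \<Sigma> s ** V s - Q s)" "V T = Q T"
    and b: "has_ac_derivative T b (\<lambda>s. (V s ** \<Sigma> s) *v b s - z s)" "b T = z T"
    and \<gamma>: "has_ac_derivative T \<gamma> (\<lambda>s. 1/2 * (b s \<bullet> (\<Sigma> s *v b s) - trace (V s ** \<Sigma> s)))" "\<gamma> T = 0"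
    and V_sym: "\<And>s. s \<in> {0..T} \<Longrightarrow> transpose (V s) = V s"
    and c': "0 < c'" "\<And>s x. s \<in> {0..T} \<Longrightarrow> c' * (norm x)\<^sup>2 \<le> x \<bullet> (V s *v x)"
    and sys: "riccati_system T \<Sigma> Q z V b \<gamma>"
    by (rule riccati_system_exists[OF TT(1) \<Sigma>_bm Q z \<Sigma>_sym \<Sigma>_pos Q_sym Q_nonneg K0 Q_coercive[OF TT(2)]])
      (assumption | rule that)+
  have unique: "V' t = V t \<and> b' t = b t \<and> \<gamma>' t = \<gamma> t"
    if "riccati_system T \<Sigma> Q z V' b' \<gamma>'" "t \<in> {0..T}" for V' b' \<gamma>' t
    by (rule riccati_system_unique[OF \<Sigma>_bm sys that])
  obtain K1 where K1: "0 < K1" "\<And>s. s \<in> {0..T} \<Longrightarrow> norm (\<sigma> s) \<le> K1" using bounded_measurable_on_bound[OF \<sigma>] by blast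
  obtain K2 where K2: "0 < K2" "\<And>s. s \<in> {0..T} \<Longrightarrow> norm (Q s) \<le> K2" using bounded_measurable_on_bound[OF Q] by blast
  obtain K3 where K3: "0 < K3" "\<And>s. s \<in> {0..T} \<Longrightarrow> norm (z s) \<le> K3" using bounded_measurable_on_bound[OF z] by blast
  obtain K4 where K4: "0 < K4" "\<And>s. s \<in> {0..T} \<Longrightarrow> norm (V s) \<le> K4"
    using bounded_measurable_on_bound[OF has_ac_derivative_bounded_measurable[OF V(1)]] by blast
  obtain K5 where K5: "0 < K5" "\<And>s. s \<in> {0..T} \<Longrightarrow> norm (b s) \<le> K5"
    using bounded_measurable_on_bound[OF has_ac_derivative_bounded_measurable[OF b(1)]] by blast
  obtain K6 where K6: "0 < K6" "\<And>s. s \<in> {0..T} \<Longrightarrow> norm (\<gamma> s) \<le> K6"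
    using bounded_measurable_on_bound[OF has_ac_derivative_bounded_measurable[OF \<gamma>(1)]] by blast
  obtain L1 where L1: "L1 \<ge> 0" "\<And>r s. r \<in> {0..T} \<Longrightarrow> s \<in> {0..T} \<Longrightarrow> norm (V s - V r) \<le> L1 * \<bar>s - r\<bar>"
    using has_ac_derivative_lipschitz[OF V(1)] by blast
  obtain L2 where L2: "L2 \<ge> 0" "\<And>r s. r \<in> {0..T} \<Longrightarrow> s \<in> {0..T} \<Longrightarrow> norm (b s - b r) \<le> L2 * \<bar>s - r\<bar>"
    using has_ac_derivative_lipschitz[OF b(1)] by blast
  \<comment> \<open>All constants are nonnegative, so that their sum bounds each of them.\<close>
  define B where "B = 1 + K1 + K2 + K3 + K4 + K5 + K6 + L1 + L2"
  have B: "1 \<le> B" "K1 \<le> B" "K2 \<le> B" "K3 \<le> B" "K4 \<le> B" "K5 \<le> B" "K6 \<le> B" "L1 \<le> B" "L2 \<le> B"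
    unfolding B_def using K1(1) K2(1) K3(1) K4(1) K5(1) K6(1) L1(1) L2(1) by linarith+
  define c where "c = min c' (1 / K)"
  have c: "0 < c" "c \<le> c'" "c \<le> 1 / K" unfolding c_def using c'(1) K(1) by auto
  interpret brownian_motion M W by (rule W)
  interpret riccati_brownian T B c \<sigma> Q V z b \<gamma> M W
  proof unfold_locales
    show "norm (V s - V r) \<le> B * \<bar>s - r\<bar>" if "r \<in> {0..T}" "s \<in> {0..T}" for r s
      using L1(2)[OF that] mult_right_mono[OF B(8) abs_ge_zero[of "s - r"]] by linarith
    show "norm (b s - b r) \<le> B * \<bar>s - r\<bar>" if "r \<in> {0..T}" "s \<in> {0..T}" for r s
      using L2(2)[OF that] mult_right_mono[OF B(9) abs_ge_zero[of "s - r"]] by linarith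
    show "c * (norm x)\<^sup>2 \<le> x \<bullet> (V s *v x)" if "s \<in> {0..T}" for s x
      using c'(2)[OF that, of x] mult_right_mono[OF c(2) zero_le_power2[of "norm x"]] by linarith
    show "c * (norm x)\<^sup>2 \<le> x \<bullet> (Q s *v x)" if "s \<in> {0..T}" for s x
      using Q_coercive[OF that, of x] mult_right_mono[OF c(3) zero_le_power2[of "norm x"]] by linarith
    show "norm (\<sigma> s) \<le> B" if "s \<in> {0..T}" for s using K1(2)[OF that] B by linarith
    show "norm (Q s) \<le> B" if "s \<in> {0..T}" for s using K2(2)[OF that] B by linarith
    show "norm (z s) \<le> B" if "s \<in> {0..T}" for s using K3(2)[OF that] B by linarith
    show "norm (V s) \<le> B" if "s \<in> {0..T}" for s using K4(2)[OF that] B by linarith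
    show "norm (b s) \<le> B" if "s \<in> {0..T}" for s using K5(2)[OF that] B by linarith
    show "\<bar>\<gamma> s\<bar> \<le> B" if "s \<in> {0..T}" for s using K6(2)[OF that] B by simp
  qed (fact T c(1) B(1) \<sigma> Q z V_sym V(2) b(2) \<gamma>(2) V(1)[unfolded \<Sigma>_eq] b(1)[unfolded \<Sigma>_eq] \<gamma>(1)[unfolded \<Sigma>_eq])+
  have "F t x = exp (- 1/2 * (x \<bullet> (V t *v x)) - b t \<bullet> x - \<gamma> t)" if "t \<in> {0..T}" for t x
    using exp_functional_eq_value[OF that, of x X] X[OF that] unfolding F val_def gauss_exp_def by simp
  then show ?thesis using sys unique by blast
qed

end
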